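(* The following identities of formal power series in $x$ (with coefficients polynomials in $t$) hold: $$\bar{A}(x)=\frac{M(x)}{1-xM(x)}-1,$$ $$\bar{B}(x)=\frac{Q(x)}{1-xM(x)}+\frac{x^2t^3}{1-xt^2}\,\frac{M(x)M(tx)}{1-xM(x)},$$ $$\bar{D}(x)=2\,\frac{Q^{o}(x)}{1-xM(x)}+\frac{M(x)}{1-xM(x)}+\frac{xt^2}{1-xt^2}\,\frac{M(x)M(tx)}{1-xM(x)}.$$ Moreover all these series can be explicitly computed thanks to the functional equations $$M(x)=1+tx^2M(x)M(tx),\qquad Q(x)=M(x)\bigl(1+xt\,Q(tx)\bigr),\qquad Q^{o}(x)=xt\,M(x)M(tx)\bigl(1+xt^2Q^{o}(xt^2)\bigr),$$ which are satisfied by $M$, $Q$ and $Q^o$.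
   Context: Coxeter groups: $A_{n-1}$ has generators $s_1,\dots,s_{n-1}$ and Coxeter graph the path $s_1-\cdots-s_{n-1}$ with all edges labelled $3$ ($A_0$ is trivial). $B_n$ has generators $s_1,\dots,s_n$ and Coxeter graph the path $s_1-\cdots-s_n$ with $m_{s_is_{i+1}}=3$ for $i\le n-2$ and $m_{s_{n-1}s_n}=4$ ($B_0$ is trivial, $B_1$ has one generator). $D_{n+1}$ ($n\ge1$) has generators $s_1,\dots,s_{n+1}$ and Coxeter graph the path $s_1-\cdots-s_{n-1}$ together with $s_n$ and $s_{n+1}$ each joined to $s_{n-1}$, all edges labelled $3$ ($D_2$ has two commuting generators). For a Coxeter system $(W,S)$ with length function $\ell$, an element $w$ is fully commutative (FC) if any reduced expression of $w$ can be obtained from any other one using only commutation relations $st=ts$ (pairs with $m_{st}=2$). An involution is an element with $w^2=1$ (identity included). $\bar W^{FC}$ is the set of FC involutions of $W$ and $\bar W^{FC}(t)=\sum_{w\in\bar W^{FC}}t^{\ell(w)}$. Put $$\bar{A}(x)=\sum_{n\ge1}\bar{A}_{n-1}^{FC}(t)x^n,\quad \bar{B}(x)=\sum_{n\ge0}\bar{B}_n^{FC}(t)x^n,\quad \bar{D}(x)=\sum_{n\ge0}\bar{D}_{n+1}^{FC}(t)x^n,$$ where $\bar{D}_1^{FC}(t):=1$. Walks: consider sequences $P=(P_0,\dots,P_n)$ of points $P_i=(i,h_i)$ with $h_i\in\mathbb{N}=\{0,1,2,\dots\}$, $h_0=0$, and all steps $P_{i+1}-P_i\in\{(1,1),(1,-1)\}$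 (prefixes of Dyck paths of length $n$). The total height of $P$ is $\mathrm{ht}(P)=\sum_{i=0}^n h_i$. Then $Q(x)=\sum_{n\ge0}x^n\sum_P t^{\mathrm{ht}(P)}$, the inner sum being over all such $P$ of length $n$; $M(x)$ is the analogous series restricted to those $P$ with $h_n=0$ (Dyck paths); $Q^o(x)$ is the analogous series restricted to those $P$ with $h_n$ odd. Notation such as $M(tx)$ means substituting $tx$ for $x$ while keeping $t$. *)

theory Defs
  imports
    "HOL-Algebra.Group"
    "HOL-Computational_Algebra.Polynomial"
    "HOL-Computational_Algebra.Formal_Power_Series"
begin

section \<open>Coxeter groups\<close>

text \<open>
  A Coxeter system is given by its set of generators \<open>S\<close> and its Coxeter matrix
  \<open>m\<close>, where \<open>m s t = 0\<close> would encode the label infinity. Since \<open>m s s = 1\<close> makes every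
  generator its own inverse, the group presented by the relations \<open>(s t) ^ m s t = 1\<close> is a
  quotient of the free monoid of words over \<open>S\<close>; no formal inverses are needed.
\<close>

inductive coxeter_eq :: "'a set \<Rightarrow> ('a \<Rightarrow> 'a \<Rightarrow> nat) \<Rightarrow> 'a list \<Rightarrow> 'a list \<Rightarrow> bool"
  for S m where
  relator: "\<lbrakk>s \<in> S; t \<in> S; u \<in> lists S; v \<in> lists S\<rbrakk> \<Longrightarrow>
    coxeter_eq S m (u @ concat (replicate (m s t) [s, t]) @ v) (u @ v)"
| refl: "u \<in> lists S \<Longrightarrow> coxeter_eq S m u u"
| sym: "coxeter_eq S m u v \<Longrightarrow> coxeter_eq S m v u"
| trans: "coxeter_eq S m u v \<Longrightarrow> coxeter_eq S m v w \<Longrightarrow> coxeter_eq S m u w"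

definition coxeter_rel :: "'a set \<Rightarrow> ('a \<Rightarrow> 'a \<Rightarrow> nat) \<Rightarrow> ('a list \<times> 'a list) set" where
  "coxeter_rel S m = {(u, v). coxeter_eq S m u v}"

definition coxeter_group :: "'a set \<Rightarrow> ('a \<Rightarrow> 'a \<Rightarrow> nat) \<Rightarrow> 'a list set monoid" where
  "coxeter_group S m =
    \<lparr>carrier = lists S // coxeter_rel S m,
     monoid.mult = (\<lambda>w w'. \<Union>u\<in>w. \<Union>v\<in>w'. coxeter_rel S m `` {u @ v}),
     monoid.one = coxeter_rel S m `` {[]}\<rparr>"

text \<open>
  An element of the group is the set of all words that represent it, so its length is the
  least length of a member.
\<close>

definition coxeter_length :: "'a list set \<Rightarrow> nat" where
  "coxeter_length w = (LEAST k. \<exists>u\<in>w. length u = k)"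

definition reduced_words :: "'a list set \<Rightarrow> 'a list set" where
  "reduced_words w = {u \<in> w. length u = coxeter_length w}"

inductive commutation_step :: "'a set \<Rightarrow> ('a \<Rightarrow> 'a \<Rightarrow> nat) \<Rightarrow> 'a list \<Rightarrow> 'a list \<Rightarrow> bool"
  for S m where
  "\<lbrakk>s \<in> S; t \<in> S; m s t = 2\<rbrakk> \<Longrightarrow>
    commutation_step S m (u @ [s, t] @ v) (u @ [t, s] @ v)"

definition fully_commutative :: "'a set \<Rightarrow> ('a \<Rightarrow> 'a \<Rightarrow> nat) \<Rightarrow> 'a list set \<Rightarrow> bool" where
  "fully_commutative S m w \<longleftrightarrow>
    (\<forall>u\<in>reduced_words w. \<forall>v\<in>reduced_words w. (commutation_step S m)\<^sup>*\<^sup>* u v)"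

definition fc_involutions :: "'a set \<Rightarrow> ('a \<Rightarrow> 'a \<Rightarrow> nat) \<Rightarrow> 'a list set set" where
  "fc_involutions S m =
    {w \<in> carrier (coxeter_group S m).
       w \<otimes>\<^bsub>coxeter_group S m\<^esub> w = \<one>\<^bsub>coxeter_group S m\<^esub> \<and> fully_commutative S m w}"

text \<open>
  Polynomials in \<open>t\<close> are elements of \<^typ>\<open>int poly\<close>. The sum is used only for the finite
  groups of types A, B and D.
\<close>

definition fc_inv_poly :: "'a set \<Rightarrow> ('a \<Rightarrow> 'a \<Rightarrow> nat) \<Rightarrow> int poly" where
  "fc_inv_poly S m = (\<Sum>w\<in>fc_involutions S m. monom 1 (coxeter_length w))"

section \<open>The types A, B and D\<close>

text \<open>The generator \<open>s\<^sub>i\<close> is represented by the number \<open>i\<close>.\<close>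

definition matrix_A :: "nat \<Rightarrow> nat \<Rightarrow> nat" where
  "matrix_A i j = (if i = j then 1 else if j = i + 1 \<or> i = j + 1 then 3 else 2)"

definition matrix_B :: "nat \<Rightarrow> nat \<Rightarrow> nat \<Rightarrow> nat" where
  "matrix_B n i j =
    (if i = j then 1
     else if j = i + 1 \<or> i = j + 1 then (if i = n \<or> j = n then 4 else 3)
     else 2)"

text \<open>
  The matrix of \<open>D\<^bsub>n+1\<^esub>\<close>: the edges are \<open>i - (i+1)\<close> for \<open>i + 1 \<le> n\<close> and
  \<open>(n-1) - (n+1)\<close>. The entries are used only for indices between \<open>1\<close> and \<open>n + 1\<close>, so
  for \<open>n = 1\<close> there is no edge.
\<close>

definition edge_D :: "nat \<Rightarrow> nat \<Rightarrow> nat \<Rightarrow> bool" where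
  "edge_D n i j \<longleftrightarrow> (j = i + 1 \<and> j \<le> n) \<or> (i + 1 = n \<and> j = n + 1)"

definition matrix_D :: "nat \<Rightarrow> nat \<Rightarrow> nat \<Rightarrow> nat" where
  "matrix_D n i j =
    (if i = j then 1 else if edge_D n i j \<or> edge_D n j i then 3 else 2)"

definition A_series :: "int poly fps" where
  "A_series = Abs_fps (\<lambda>n. if n = 0 then 0 else fc_inv_poly {1..n - 1} matrix_A)"

definition B_series :: "int poly fps" where
  "B_series = Abs_fps (\<lambda>n. fc_inv_poly {1..n} (matrix_B n))"

definition D_series :: "int poly fps" where
  "D_series = Abs_fps (\<lambda>n. if n = 0 then 1 else fc_inv_poly {1..n + 1} (matrix_D n))"

section \<open>Walks\<close>

text \<open>A walk of length \<open>n\<close> is given by the list \<open>[h\<^sub>0, \<dots>, h\<^sub>n]\<close> of its heights.\<close>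

definition walks :: "nat \<Rightarrow> nat list set" where
  "walks n = {h. length h = n + 1 \<and> h ! 0 = 0 \<and>
     (\<forall>i<n. h ! (i + 1) = h ! i + 1 \<or> h ! i = h ! (i + 1) + 1)}"

definition walk_series :: "(nat \<Rightarrow> bool) \<Rightarrow> int poly fps" where
  "walk_series P = Abs_fps (\<lambda>n. \<Sum>h | h \<in> walks n \<and> P (h ! n). monom 1 (sum_list h))"

definition M_series :: "int poly fps" where
  "M_series = walk_series (\<lambda>k. k = 0)"

definition Q_series :: "int poly fps" where
  "Q_series = walk_series (\<lambda>k. True)"

definition Qo_series :: "int poly fps" where
  "Qo_series = walk_series odd"

section \<open>Operations on power series in \<open>x\<close>\<close>

abbreviation fps_t :: "int poly fps" where
  "fps_t \<equiv> fps_const [:0, 1:]"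

text \<open>
  The coefficient ring is not a field, so the division of \<^typ>\<open>int poly fps\<close> is not
  available. Every denominator below has constant coefficient \<open>1\<close> and is thus a unit; the
  argument \<open>1\<close> of \<open>fps_right_inverse\<close> is the inverse of that coefficient.
\<close>

definition fps_quot :: "int poly fps \<Rightarrow> int poly fps \<Rightarrow> int poly fps" (infixl "\<oslash>" 70) where
  "f \<oslash> g = f * fps_right_inverse g 1"

lemma fps_quot_mult: "fps_nth g 0 = 1 \<Longrightarrow> (f \<oslash> g) * g = f"
  using fps_right_inverse[of g 1] by (simp add: fps_quot_def mult.assoc mult.commute)

lemma finite_walks: "finite (walks n)"
proof -
  have bound: "h ! i \<le> i" if "h \<in> walks n" "i \<le> n" for h i
    using that(2)
  proof (induction i)
    case 0
    then show ?case using that(1) by (simp add: walks_def)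
  next
    case (Suc i)
    then have "h ! (i + 1) = h ! i + 1 \<or> h ! i = h ! (i + 1) + 1"
      using that(1) by (auto simp: walks_def)
    then show ?case using Suc by auto
  qed
  have "walks n \<subseteq> {h. set h \<subseteq> {..n} \<and> length h = n + 1}"
  proof (intro subsetI CollectI conjI)
    fix h x assume h: "h \<in> walks n" and "x \<in> set h"
    then obtain i where "i < length h" "x = h ! i" by (auto simp: in_set_conv_nth)
    then show "x \<in> {..n}" using bound[OF h, of i] h by (auto simp: walks_def)
  qed (simp add: walks_def)
  then show ?thesis
    by (rule finite_subset) (rule finite_lists_length_eq, simp)
qed

lemma coxeter_eq_lists:
  "coxeter_eq S m u v \<Longrightarrow> u \<in> lists S \<and> v \<in> lists S"
  by (induction rule: coxeter_eq.induct) (auto split: if_splits)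

lemma equiv_coxeter_rel: "equiv (lists S) (coxeter_rel S m)"
  by (intro equivI refl_onI symI transI)
    (auto simp: coxeter_rel_def dest: coxeter_eq_lists
      intro: coxeter_eq.refl coxeter_eq.sym coxeter_eq.trans)

lemma coxeter_eq_append_left:
  "coxeter_eq S m u v \<Longrightarrow> a \<in> lists S \<Longrightarrow> coxeter_eq S m (a @ u) (a @ v)"
proof (induction rule: coxeter_eq.induct)
  case (relator s t u v)
  then show ?case using coxeter_eq.relator[of s S t "a @ u" v m] by simp
next
  case (refl u)
  then show ?case by (intro coxeter_eq.refl) simp
qed (blast intro: coxeter_eq.sym coxeter_eq.trans)+

lemma coxeter_eq_append_right:
  "coxeter_eq S m u v \<Longrightarrow> a \<in> lists S \<Longrightarrow> coxeter_eq S m (u @ a) (v @ a)"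
proof (induction rule: coxeter_eq.induct)
  case (relator s t u v)
  then show ?case using coxeter_eq.relator[of s S t u "v @ a" m] by simp
next
  case (refl u)
  then show ?case by (intro coxeter_eq.refl) simp
qed (blast intro: coxeter_eq.sym coxeter_eq.trans)+

lemma coxeter_mult_class:
  assumes "u \<in> lists S" "v \<in> lists S"
  shows "coxeter_rel S m `` {u} \<otimes>\<^bsub>coxeter_group S m\<^esub> coxeter_rel S m `` {v} =
    coxeter_rel S m `` {u @ v}"
proof -
  have "congruent2 (coxeter_rel S m) (coxeter_rel S m) (\<lambda>u v. coxeter_rel S m `` {u @ v})"
  proof (rule congruent2I')
    fix y1 z1 y2 z2
    assume "(y1, z1) \<in> coxeter_rel S m" "(y2, z2) \<in> coxeter_rel S m"
    then have "coxeter_eq S m (y1 @ y2) (z1 @ z2)"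
      by (auto simp: coxeter_rel_def
        intro: coxeter_eq.trans[OF coxeter_eq_append_right coxeter_eq_append_left]
        dest: coxeter_eq_lists)
    then show "coxeter_rel S m `` {y1 @ y2} = coxeter_rel S m `` {z1 @ z2}"
      by (intro equiv_class_eq[OF equiv_coxeter_rel]) (simp add: coxeter_rel_def)
  qed
  from UN_equiv_class2[OF equiv_coxeter_rel equiv_coxeter_rel this assms]
  show ?thesis by (simp add: coxeter_group_def)
qed

lemma group_coxeter_group:
  assumes diag: "\<And>s. s \<in> S \<Longrightarrow> m s s = 1"
  shows "group (coxeter_group S m)"
proof -
  let ?G = "coxeter_group S m" and ?c = "\<lambda>u. coxeter_rel S m `` {u}"
  have car: "carrier ?G = ?c ` lists S"
    by (auto simp: coxeter_group_def quotient_def)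
  have one: "\<one>\<^bsub>?G\<^esub> = ?c []" by (simp add: coxeter_group_def)
  have mult: "?c u \<otimes>\<^bsub>?G\<^esub> ?c v = ?c (u @ v)"
    if "\<forall>s\<in>set u. s \<in> S" "\<forall>s\<in>set v. s \<in> S" for u v
    using that by (intro coxeter_mult_class) auto
  have inv: "coxeter_eq S m (rev u @ u) []" if "u \<in> lists S" for u
    using that
  proof (induction u)
    case (Cons s u)
    have "coxeter_eq S m (rev u @ concat (replicate (m s s) [s, s]) @ u) (rev u @ u)"
      using Cons by (intro coxeter_eq.relator) auto
    then have "coxeter_eq S m (rev (s # u) @ s # u) (rev u @ u)"
      using diag Cons by simp
    then show ?case using Cons by (blast intro: coxeter_eq.trans)
  qed (simp add: coxeter_eq.refl)
  show ?thesis
  proof (rule groupI)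
    fix x assume "x \<in> carrier ?G"
    then obtain u where u: "u \<in> lists S" "x = ?c u" using car by auto
    have "?c (rev u) \<otimes>\<^bsub>?G\<^esub> ?c u = ?c (rev u @ u)"
      using u(1) by (intro coxeter_mult_class) auto
    also have "\<dots> = ?c []"
      using inv[OF u(1)]
      by (intro equiv_class_eq[OF equiv_coxeter_rel]) (simp add: coxeter_rel_def)
    finally have "?c (rev u) \<otimes>\<^bsub>?G\<^esub> x = \<one>\<^bsub>?G\<^esub>"
      using u(2) one by simp
    then show "\<exists>y\<in>carrier ?G. y \<otimes>\<^bsub>?G\<^esub> x = \<one>\<^bsub>?G\<^esub>"
      using u car by (intro bexI[of _ "?c (rev u)"]) auto
  qed (auto simp: car one mult ball_Un intro!: imageI)
qed

end

theory Submission
  imports Defs "HOL-Library.Sublist"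
begin

text \<open>
  An element is fully commutative iff no word in the commutation class of one of its reduced
  words contains a square or a full braid; the exchange property gives this without Matsumoto's
  theorem. So the FC involutions are the commutation classes of such words that are closed under
  reversal, and a commutation class is determined by its projections to the pairs of
  non-commuting generators. Outside the zigzags described below these projections alternate, so
  being palindromes they are determined by the numbers of occurrences of the generators along the
  diagram, and these numbers form a walk with steps up, down, and flat at height \<open>0\<close>. In type B the
  walk ends anywhere; a zigzag at the end of the diagram adds the second term. In type D the last
  height is shared by the two end nodes, whose occurrences alternate, which is possible in two
  ways if the height is odd and in none if it is positive and even.
\<close>

section \<open>Reflections and the exchange property\<close>

text \<open>Alternation is a counting fact. Between two consecutive \<open>i\<close> a fully
  commutative word has at least two letters not commuting with \<open>i\<close>, or a single one
  across a bond labelled 4. At the left end there is only one neighbour, so the projection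
  alternates there, and this propagates: two \<open>i\<close> between consecutive
  \<open>i + 1\<close> would themselves need an \<open>i + 1\<close> in between. From the right the
  propagation can fail, because the label 4 or the fork lets the word turn back, and each failure is
  a zigzag. A phantom generator 0 that never occurs makes the walk start at height 0; type A has a
  second one on the right, which is why its walks end at 0. The obstacle in type D is that neither
  edge at the fork need alternate by itself; only the word with both end nodes identified does. Such
  words are therefore handled as a folded word together with the sequence of its end letters. The
  series identities are not proved by cutting walks: both sides satisfy the same recursion with a
  factor x in front, and so agree coefficient by coefficient.\<close>

primrec parity_upto :: "(nat \<Rightarrow> bool) \<Rightarrow> nat \<Rightarrow> bool" where
  "parity_upto P 0 = False"
| "parity_upto P (Suc n) = (parity_upto P n \<noteq> P n)"

lemma parity_upto_add:
  "parity_upto P (m + n) = (parity_upto P m \<noteq> parity_upto (\<lambda>i. P (m + i)) n)"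
  by (induction n) auto

text \<open>The two halves have equal parity and cancel.\<close>

lemma parity_upto_periodic:
  assumes "\<And>i. P (m + i) = P i"
  shows "\<not> parity_upto P (2 * m)"
  using parity_upto_add[of P m m] assms by (simp add: mult_2)

lemma rev_in_lists_iff [simp]: "rev u \<in> lists A \<longleftrightarrow> u \<in> lists A"
  by (simp add: in_lists_conv_set)

text \<open>The labels 2, 3 and 4 are those of types A, B and D, and they keep the exchange argument
  down to three kinds of braid. The order on the generators orients the bonds labelled 4 in
  \<open>weight\<close>.\<close>

locale small_coxeter =
  fixes S :: "'a :: linorder set" and m :: "'a \<Rightarrow> 'a \<Rightarrow> nat"
  assumes m_diag: "s \<in> S \<Longrightarrow> m s s = 1"
    and m_sym: "s \<in> S \<Longrightarrow> t \<in> S \<Longrightarrow> m s t = m t s"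
    and m_range: "s \<in> S \<Longrightarrow> t \<in> S \<Longrightarrow> s \<noteq> t \<Longrightarrow> m s t \<in> {2, 3, 4}"
begin

section \<open>Words modulo the Coxeter relations\<close>

abbreviation word_eq :: "'a list \<Rightarrow> 'a list \<Rightarrow> bool" (infix "\<sim>" 50) where
  "u \<sim> v \<equiv> coxeter_eq S m u v"

lemma word_eq_lists1: "u \<sim> v \<Longrightarrow> u \<in> lists S"
  and word_eq_lists2: "u \<sim> v \<Longrightarrow> v \<in> lists S"
  by (auto dest: coxeter_eq_lists)

lemma word_eq_context:
  assumes "u \<sim> v" "a \<in> lists S" "b \<in> lists S"
  shows "a @ u @ b \<sim> a @ v @ b"
  by (intro coxeter_eq_append_left coxeter_eq_append_right assms)

lemma word_eq_refl: "u \<in> lists S \<Longrightarrow> u \<sim> u"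
  by (rule coxeter_eq.refl)

lemma word_eq_cong:
  assumes "u \<sim> u'" "v \<sim> v'"
  shows "u @ v \<sim> u' @ v'"
  using assms
  by (meson coxeter_eq.trans coxeter_eq_append_left coxeter_eq_append_right coxeter_eq_lists)

lemma word_eq_Cons: "u \<sim> v \<Longrightarrow> s \<in> S \<Longrightarrow> s # u \<sim> s # v"
  using coxeter_eq_append_left[of S m u v "[s]"] by simp

lemma rev_append_eq: "u \<in> lists S \<Longrightarrow> rev u @ u \<sim> []"
proof (induction u)
  case (Cons s u)
  have "rev u @ concat (replicate (m s s) [s, s]) @ u \<sim> rev u @ u"
    using Cons by (intro coxeter_eq.relator) auto
  then show ?case using Cons m_diag by (auto intro: coxeter_eq.trans)
qed (simp add: coxeter_eq.refl)

lemma append_rev_eq: "u \<in> lists S \<Longrightarrow> u @ rev u \<sim> []"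
  using rev_append_eq[of "rev u"] by simp

lemma cancel_left:
  assumes "a \<in> lists S"
  shows "a @ u \<sim> a @ v \<longleftrightarrow> u \<sim> v"
proof
  assume eq: "a @ u \<sim> a @ v"
  then have uv: "u \<in> lists S" "v \<in> lists S" by (auto dest: coxeter_eq_lists)
  have "(rev a @ a) @ u \<sim> (rev a @ a) @ v"
    using coxeter_eq_append_left[OF eq, of "rev a"] assms by auto
  moreover have "(rev a @ a) @ u \<sim> [] @ u" "(rev a @ a) @ v \<sim> [] @ v"
    using assms uv by (blast intro!: word_eq_cong rev_append_eq word_eq_refl)+
  ultimately show "u \<sim> v"
    by (metis append_Nil coxeter_eq.sym coxeter_eq.trans)
qed (rule coxeter_eq_append_left[OF _ assms])

lemma cancel_right:
  assumes "a \<in> lists S"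
  shows "u @ a \<sim> v @ a \<longleftrightarrow> u \<sim> v"
proof
  assume eq: "u @ a \<sim> v @ a"
  then have uv: "u \<in> lists S" "v \<in> lists S" by (auto dest: coxeter_eq_lists)
  have "u @ (a @ rev a) \<sim> v @ (a @ rev a)"
    using coxeter_eq_append_right[OF eq, of "rev a"] assms by auto
  moreover have "u @ (a @ rev a) \<sim> u @ []" "v @ (a @ rev a) \<sim> v @ []"
    using assms uv by (blast intro!: word_eq_cong append_rev_eq word_eq_refl)+
  ultimately show "u \<sim> v"
    by (metis append_Nil2 coxeter_eq.sym coxeter_eq.trans)
qed (rule coxeter_eq_append_right[OF _ assms])

lemma move_left:
  assumes "a \<in> lists S"
  shows "rev a @ r \<sim> x \<longleftrightarrow> r \<sim> a @ x"
proof -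
  have "rev a @ r \<sim> x \<longleftrightarrow> a @ rev a @ r \<sim> a @ x" using assms by (simp add: cancel_left)
  also have "\<dots> \<longleftrightarrow> r \<sim> a @ x"
  proof -
    have "(a @ rev a) @ r \<sim> [] @ r" if "r \<in> lists S"
      using that assms by (intro word_eq_cong append_rev_eq word_eq_refl)
    then show ?thesis
      by (metis append_assoc append_in_lists_conv append_Nil coxeter_eq.sym coxeter_eq.trans coxeter_eq_lists)
  qed
  finally show ?thesis .
qed

lemma move_right:
  assumes "a \<in> lists S"
  shows "r @ a \<sim> x \<longleftrightarrow> r \<sim> x @ rev a"
proof -
  have "r @ a \<sim> x \<longleftrightarrow> (r @ a) @ rev a \<sim> x @ rev a" using assms by (subst cancel_right) auto
  also have "\<dots> \<longleftrightarrow> r \<sim> x @ rev a"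
  proof -
    have "r @ (a @ rev a) \<sim> r @ []" if "r \<in> lists S"
      using that assms by (intro word_eq_cong append_rev_eq word_eq_refl)
    then show ?thesis
      by (metis append_assoc append_in_lists_conv append_Nil2 coxeter_eq.sym coxeter_eq.trans coxeter_eq_lists)
  qed
  finally show ?thesis .
qed

lemma conj_iff:
  assumes "a \<in> lists S"
  shows "rev a @ r @ a \<sim> x \<longleftrightarrow> r \<sim> a @ x @ rev a"
  using move_left[OF assms, of "r @ a" x] move_right[OF assms, of r "a @ x"] by simp

text \<open>
  The reflections of a word \<open>s\<^sub>1 \<dots> s\<^sub>k\<close> are \<open>s\<^sub>1 \<dots> s\<^sub>i \<dots> s\<^sub>1\<close>. Whether a given group element
  occurs an odd number of times among them depends only on the group element of the word.
\<close>

primrec refl_parity :: "'a list \<Rightarrow> 'a list \<Rightarrow> bool" where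
  "refl_parity [] r = False"
| "refl_parity (s # u) r = ((r \<sim> [s]) \<noteq> refl_parity u (s # r @ [s]))"

lemma refl_parity_cong:
  assumes "r \<sim> r'" "u \<in> lists S"
  shows "refl_parity u r = refl_parity u r'"
  using assms
proof (induction u arbitrary: r r')
  case (Cons s u)
  have "r \<sim> [s] \<longleftrightarrow> r' \<sim> [s]" using Cons.prems by (meson coxeter_eq.sym coxeter_eq.trans)
  moreover have "s # r @ [s] \<sim> s # r' @ [s]"
    using word_eq_context[OF Cons.prems(1), of "[s]" "[s]"] Cons.prems by simp
  ultimately show ?case using Cons by simp
qed simp

lemma refl_parity_append:
  "refl_parity (u @ v) r = (refl_parity u r \<noteq> refl_parity v (rev u @ r @ u))"
  by (induction u arbitrary: r) auto

text \<open>The reflections of (s t)^k are s, s t s, s t s t s and so on, that is, (s t)^i s for i <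
  2k. In this form they are visibly periodic once a power of s t is trivial.\<close>

lemma refl_parity_alternating:
  assumes st: "s \<in> S" "t \<in> S" and r: "r \<in> lists S"
  defines "c \<equiv> \<lambda>i. concat (replicate i [s, t])"
  shows "refl_parity (c k) r = parity_upto (\<lambda>i. r \<sim> c i @ [s]) (2 * k)"
proof (induction k)
  case (Suc k)
  have c: "c i \<in> lists S" for i
    unfolding c_def using st by (induction i) auto
  have cSuc: "c (Suc i) = c i @ [s, t]" for i
    unfolding c_def using replicate_append_same[of i "[s, t]"]
    by (metis append_Nil2 concat.simps concat_append replicate_Suc)
  \<comment> \<open>Conjugation by \<open>s\<close> inverts s t, here as an equality of words; so
    conjugating \<open>s\<close> by \<open>c k\<close> yields
    \<open>c (2 * k) @ [s]\<close>.\<close>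
  have s_rev: "s # rev (c i) = c i @ [s]" for i
  proof (induction i)
    case (Suc i)
    have "s # rev (c (Suc i)) = (s # rev (c i)) @ [t, s]" by (simp add: c_def)
    then show ?case using cSuc Suc by simp
  qed (simp add: c_def)
  have c_add: "c (i + j) = c i @ c j" for i j
    by (simp add: c_def replicate_add)
  let ?r = "rev (c k) @ r @ c k"
  have "?r \<sim> [s] \<longleftrightarrow> r \<sim> c (2 * k) @ [s]"
    using conj_iff[OF c, of k r "[s]"] s_rev by (simp add: mult_2 c_add)
  moreover have "s # ?r @ [s] \<sim> [t] \<longleftrightarrow> r \<sim> c (2 * k + 1) @ [s]"
  proof -
    have "s # ?r @ [s] \<sim> [t] \<longleftrightarrow> ?r \<sim> [s, t, s]"
      using conj_iff[of "[s]" ?r "[t]"] st by simp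
    also have "\<dots> \<longleftrightarrow> r \<sim> c k @ [s, t] @ s # rev (c k)"
      using conj_iff[OF c, of k r "[s,t,s]"] by simp
    also have "c k @ [s, t] @ s # rev (c k) = c (k + 1 + k) @ [s]"
      unfolding s_rev c_add by (simp add: c_def)
    finally show ?thesis by (simp add: mult_2)
  qed
  ultimately show ?case
    unfolding cSuc refl_parity_append using Suc by auto
qed (simp add: c_def)

text \<open>The reflections with numbers i and \<open>m s t + i\<close> coincide because the relator
  is trivial, so every group element is counted an even number of times.\<close>

lemma refl_parity_relator:
  assumes st: "s \<in> S" "t \<in> S" and r: "r \<in> lists S"
  shows "\<not> refl_parity (concat (replicate (m s t) [s, t])) r"
proof -
  let ?c = "\<lambda>i. concat (replicate i [s, t])"
  have c: "?c i \<in> lists S" for i using st by (induction i) auto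
  have "?c (m s t) \<sim> []"
    using coxeter_eq.relator[OF st, of "[]" "[]" m] by simp
  then have "?c (m s t) @ ?c i @ [s] \<sim> [] @ ?c i @ [s]" for i
    using c[of i] st by (intro word_eq_cong word_eq_refl) auto
  then have "?c (m s t + i) @ [s] \<sim> ?c i @ [s]" for i
    by (simp add: replicate_add)
  then have "(r \<sim> ?c (m s t + i) @ [s]) = (r \<sim> ?c i @ [s])" for i
    by (blast intro: coxeter_eq.sym coxeter_eq.trans)
  then show ?thesis
    unfolding refl_parity_alternating[OF assms]
    by (rule parity_upto_periodic[where P = "\<lambda>i. r \<sim> ?c i @ [s]"])
qed

text \<open>A relator contributes an even count by itself, and conjugating by it does not change the
  reflections of what follows.\<close>

lemma refl_parity_word_eq:
  "u \<sim> v \<Longrightarrow> r \<in> lists S \<Longrightarrow> refl_parity u r = refl_parity v r"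
proof (induction rule: coxeter_eq.induct)
  case (relator s t u v)
  let ?c = "concat (replicate (m s t) [s, t])"
  let ?r = "rev u @ r @ u"
  have c: "?c \<in> lists S" using relator by (auto split: if_splits)
  have r: "?r \<in> lists S" using relator by auto
  have c1: "?c \<sim> []"
    using coxeter_eq.relator[OF relator(1,2), of "[]" "[]" m] by simp
  have "rev ?c \<sim> []" using move_left[OF c, of "[]" "[]"] c1 by (simp add: coxeter_eq.sym)
  then have "rev ?c @ ?r @ ?c \<sim> [] @ ?r @ []"
    using r c1 by (intro word_eq_cong word_eq_refl)
  then have "refl_parity v (rev ?c @ ?r @ ?c) = refl_parity v ?r"
    using relator by (intro refl_parity_cong) auto
  then show ?case
    using refl_parity_relator[OF relator(1,2) r] by (simp add: refl_parity_append)
qed auto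

text \<open>An odd count is not zero. The letter \<open>x\<close> is the one that the exchange
  property deletes.\<close>

lemma refl_parity_witness:
  assumes "refl_parity u r" "u \<in> lists S" "r \<in> lists S"
  shows "\<exists>a x b. u = a @ x # b \<and> r \<sim> a @ x # rev a"
  using assms
proof (induction u arbitrary: r)
  case (Cons s u)
  show ?case
  proof (cases "r \<sim> [s]")
    case True
    then show ?thesis by (intro exI[of _ "[]"] exI[of _ s] exI[of _ u]) simp
  next
    case False
    then have "refl_parity u (s # r @ [s])" using Cons.prems by simp
    then obtain a x b where *: "u = a @ x # b" "s # r @ [s] \<sim> a @ x # rev a"
      using Cons.IH[of "s # r @ [s]"] Cons.prems by auto
    then have "r \<sim> (s # a) @ x # rev (s # a)"
      using conj_iff[of "[s]" r "a @ x # rev a"] Cons.prems by simp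
    then show ?thesis using * by (metis append_Cons)
  qed
qed simp

definition reduced :: "'a list \<Rightarrow> bool" where
  "reduced u \<longleftrightarrow> u \<in> lists S \<and> (\<forall>v. v \<sim> u \<longrightarrow> length u \<le> length v)"

text \<open>If \<open>s\<close> is a reflection of \<open>u\<close>, a letter of \<open>u\<close>
  can be deleted. Otherwise \<open>s\<close> is a reflection of \<open>v\<close>, and deleting a
  letter there represents \<open>u\<close> by a word shorter than \<open>u\<close>.\<close>

lemma exchange:
  assumes u: "reduced u" and s: "s \<in> S" and v: "v \<sim> s # u" "length v \<le> length u"
  obtains a x b where "u = a @ x # b" "s # u \<sim> a @ b"
proof -
  have uS: "u \<in> lists S" and vS: "v \<in> lists S"
    using u word_eq_lists1[OF v(1)] by (auto simp: reduced_def)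
  \<comment> \<open>From s = a x a^-1 follows s a x b = a x x b = a b.\<close>
  have deletion: "\<exists>a x b. w = a @ x # b \<and> s # w \<sim> a @ b"
    if par: "refl_parity w [s]" and wS: "w \<in> lists S" for w
  proof -
    obtain a x b where w: "w = a @ x # b" "[s] \<sim> a @ x # rev a"
      using refl_parity_witness[OF par wS] s by auto
    then have S: "a \<in> lists S" "x \<in> S" "b \<in> lists S" using wS by auto
    have "[s] @ w \<sim> (a @ x # rev a) @ a @ x # b"
      using word_eq_cong[OF w(2) word_eq_refl[OF wS]] w(1) by simp
    also have "(a @ x # rev a) @ a @ x # b = (a @ [x]) @ (rev a @ a) @ x # b" by simp
    finally have "[s] @ w \<sim> (a @ [x]) @ (rev a @ a) @ x # b" .
    moreover have "(a @ [x]) @ (rev a @ a) @ x # b \<sim> (a @ [x]) @ [] @ x # b"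
      using S by (intro word_eq_cong rev_append_eq word_eq_refl) auto
    moreover have "a @ (rev [x] @ [x]) @ b \<sim> a @ [] @ b"
      using S by (intro word_eq_cong rev_append_eq word_eq_refl) auto
    ultimately have "s # w \<sim> a @ b" by (auto intro: coxeter_eq.trans)
    then show ?thesis using w by blast
  qed
  have "refl_parity u [s]"
  proof (rule ccontr)
    assume no: "\<not> refl_parity u [s]"
    have "u \<sim> s # v"
    proof -
      have "[s] @ v \<sim> [s] @ s # u" using v s by (intro word_eq_cong word_eq_refl) auto
      moreover have "(rev [s] @ [s]) @ u \<sim> [] @ u"
        using s uS by (intro word_eq_cong rev_append_eq word_eq_refl) auto
      ultimately have "s # v \<sim> u" by (auto intro: coxeter_eq.trans)
      then show ?thesis by (rule coxeter_eq.sym)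
    qed
    then have "\<not> refl_parity (s # v) [s]" using no refl_parity_word_eq s by simp
    moreover have "[s] \<sim> [s]" using s by (simp add: word_eq_refl)
    \<comment> \<open>Conjugation by \<open>s\<close> fixes the reflection \<open>s\<close>, so the
      leading letter of \<open>s # v\<close> just flips the parity.\<close>
    moreover have "refl_parity v (s # [s] @ [s]) = refl_parity v [s]"
    proof (rule refl_parity_cong[OF _ vS])
      have "(rev [s] @ [s]) @ [s] \<sim> [] @ [s]"
        using s by (intro word_eq_cong rev_append_eq word_eq_refl) auto
      then show "s # [s] @ [s] \<sim> [s]" by simp
    qed
    ultimately have "refl_parity v [s]" by simp
    then obtain a x b where "v = a @ x # b" "s # v \<sim> a @ b" using deletion vS by blast
    with \<open>u \<sim> s # v\<close> have "a @ b \<sim> u" "length (a @ b) < length u"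
      using v(2) by (auto intro: coxeter_eq.trans coxeter_eq.sym)
    then show False using u by (force simp: reduced_def)
  qed
  then show thesis using deletion uS that by blast
qed

text \<open>
  The numbers game: an action of the group on integer labellings of the diagram, faithful enough
  to tell apart the short words that occur in the exchange argument below.
\<close>

definition weight :: "'a \<Rightarrow> 'a \<Rightarrow> int" where
  "weight s t = (if m s t = 2 then 0 else if m s t = 4 \<and> s < t then 2 else 1)"

definition fire :: "'a \<Rightarrow> ('a \<Rightarrow> int) \<Rightarrow> 'a \<Rightarrow> int" where
  "fire s f = (\<lambda>t. if t = s then - f s else f t + weight s t * f s)"

lemma fire_fire:
  assumes "s \<noteq> t"
  shows "fire s (fire t f) s = - f s - weight t s * f t"
    and "fire s (fire t f) t = - f t + weight s t * (f s + weight t s * f t)"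
    and "x \<noteq> s \<Longrightarrow> x \<noteq> t \<Longrightarrow>
      fire s (fire t f) x = f x + weight t x * f t + weight s x * (f s + weight t s * f t)"
  using assms by (auto simp: fire_def algebra_simps)

text \<open>For distinct generators the product \<open>weight s t * weight t s\<close> is 0, 1 or 2
  for the labels 2, 3, 4, which is 4 cos^2(pi / m); this makes the m-th power of firing
  \<open>t\<close> and then \<open>s\<close> the identity. The two orientations of a bond labelled 4
  are separate cases.\<close>

lemma fire_relator:
  assumes "s \<in> S" "t \<in> S"
  shows "foldr fire (concat (replicate (m s t) [s, t])) f = f"
proof (cases "s = t")
  case True
  then show ?thesis using assms by (auto simp: m_diag fire_def)
next
  case False
  consider (2) "m s t = 2" "weight s t = 0" "weight t s = 0"
    | (3) "m s t = 3" "weight s t = 1" "weight t s = 1"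
    | (4) "m s t = 4" "weight s t = 2" "weight t s = 1"
    | (5) "m s t = 4" "weight s t = 1" "weight t s = 2"
    using m_range[OF assms False] m_sym[OF assms] False
    by (auto simp: weight_def neq_iff)
  then show ?thesis
  proof cases
    case 2
    have "foldr fire [s, t, s, t] f x = f x" for x
      using 2 False by (cases "x = s"; cases "x = t"; simp add: fire_fire algebra_simps)
    then show ?thesis using 2 by (auto simp: numeral_eq_Suc)
  next
    case 3
    have "foldr fire [s, t, s, t, s, t] f x = f x" for x
      using 3 False by (cases "x = s"; cases "x = t"; simp add: fire_fire algebra_simps)
    then show ?thesis using 3 by (auto simp: numeral_eq_Suc)
  next
    case 4
    have "foldr fire [s, t, s, t, s, t, s, t] f x = f x" for x
      using 4 False by (cases "x = s"; cases "x = t"; simp add: fire_fire algebra_simps)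
    then show ?thesis using 4 by (auto simp: numeral_eq_Suc)
  next
    case 5
    have "foldr fire [s, t, s, t, s, t, s, t] f x = f x" for x
      using 5 False by (cases "x = s"; cases "x = t"; simp add: fire_fire algebra_simps)
    then show ?thesis using 5 by (auto simp: numeral_eq_Suc)
  qed
qed

lemma fire_word_eq: "u \<sim> v \<Longrightarrow> foldr fire u f = foldr fire v f"
  by (induction arbitrary: f rule: coxeter_eq.induct) (simp_all add: fire_relator)

text \<open>These coincidences would arise if an exchange step deleted a letter of the initial braid
  instead of a later one. The labelling that is 1 at \<open>s\<close> and 0 elsewhere tells the two
  sides apart.\<close>

lemma short_words_neq:
  assumes st: "s \<in> S" "t \<in> S" "s \<noteq> t"
  shows "\<not> [s] \<sim> [t]"
    and "m s t = 3 \<or> m s t = 4 \<Longrightarrow> \<not> [s, t, s] \<sim> [t]"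
    and "m s t = 4 \<Longrightarrow> \<not> [s, t, s, t] \<sim> []"
    and "m s t = 4 \<Longrightarrow> \<not> [s, t, s, t] \<sim> [t, s]"
proof -
  let ?f = "\<lambda>x. if x = s then 1 else 0 :: int"
  have "foldr fire [s] ?f s \<noteq> foldr fire [t] ?f s" using st by (simp add: fire_def)
  then show "\<not> [s] \<sim> [t]" using fire_word_eq by metis
  have "foldr fire [s, t, s] ?f s \<noteq> foldr fire [t] ?f s" if "m s t = 3 \<or> m s t = 4"
    using st that m_sym[of s t] by (auto simp: fire_def weight_def)
  then show "m s t = 3 \<or> m s t = 4 \<Longrightarrow> \<not> [s, t, s] \<sim> [t]" using fire_word_eq by metis
  have "foldr fire [s, t, s, t] ?f s \<noteq> foldr fire [] ?f s" if "m s t = 4"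
    using st that m_sym[of s t] by (auto simp: fire_def weight_def)
  then show "m s t = 4 \<Longrightarrow> \<not> [s, t, s, t] \<sim> []" using fire_word_eq by metis
  have "foldr fire [s, t, s, t] ?f s \<noteq> foldr fire [t, s] ?f s \<or>
      foldr fire [s, t, s, t] ?f t \<noteq> foldr fire [t, s] ?f t" if "m s t = 4"
    using st that m_sym[of s t] by (auto simp: fire_def weight_def)
  then show "m s t = 4 \<Longrightarrow> \<not> [s, t, s, t] \<sim> [t, s]" using fire_word_eq by metis
qed


section \<open>Fully commutative words\<close>

lemma cons_cancel: "s \<in> S \<Longrightarrow> s # u \<sim> s # v \<longleftrightarrow> u \<sim> v"
  using cancel_left[of "[s]"] by simp

lemma cons_move: "s # u \<sim> v \<Longrightarrow> s \<in> S \<Longrightarrow> u \<sim> s # v"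
  using move_left[of "[s]"] by simp

lemma cons_move': "u \<sim> s # v \<Longrightarrow> s \<in> S \<Longrightarrow> s # u \<sim> v"
  using move_left[of "[s]"] by simp

lemma word_eq_braid:
  assumes "s \<in> S" "t \<in> S"
  shows "m s t = 2 \<Longrightarrow> [s, t] \<sim> [t, s]"
    and "m s t = 3 \<Longrightarrow> [s, t, s] \<sim> [t, s, t]"
    and "m s t = 4 \<Longrightarrow> [s, t, s, t] \<sim> [t, s, t, s]"
proof -
  have rel: "concat (replicate (m s t) [s, t]) \<sim> []"
    using coxeter_eq.relator[OF assms, of "[]" "[]" m] by simp
  show "[s, t] \<sim> [t, s]" if "m s t = 2"
    using rel move_right[of "[s, t]" "[s, t]" "[]"] assms that by (simp add: numeral_eq_Suc)
  show "[s, t, s] \<sim> [t, s, t]" if "m s t = 3"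
    using rel move_right[of "[t, s, t]" "[s, t, s]" "[]"] assms that by (simp add: numeral_eq_Suc)
  show "[s, t, s, t] \<sim> [t, s, t, s]" if "m s t = 4"
    using rel move_right[of "[s, t, s, t]" "[s, t, s, t]" "[]"] assms that
    by (simp add: numeral_eq_Suc)
qed

section \<open>Commutation classes\<close>

abbreviation comm :: "'a list \<Rightarrow> 'a list \<Rightarrow> bool" where
  "comm \<equiv> (commutation_step S m)\<^sup>*\<^sup>*"

lemma comm_swap:
  "s \<in> S \<Longrightarrow> t \<in> S \<Longrightarrow> m s t = 2 \<Longrightarrow> comm (u @ [s, t] @ v) (u @ [t, s] @ v)"
  by (intro r_into_rtranclp commutation_step.intros)

lemma commutation_step_sym: "commutation_step S m u v \<Longrightarrow> commutation_step S m v u"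
  by (induction rule: commutation_step.induct) (metis commutation_step.intros m_sym)

lemma comm_sym: "comm u v \<Longrightarrow> comm v u"
  by (induction rule: rtranclp_induct)
    (auto intro: converse_rtranclp_into_rtranclp commutation_step_sym)

lemma commutation_step_context:
  "commutation_step S m u v \<Longrightarrow> commutation_step S m (a @ u @ b) (a @ v @ b)"
proof (induction rule: commutation_step.induct)
  case (1 s t u v)
  then show ?case using commutation_step.intros[of s S t m "a @ u" "v @ b"] by simp
qed

lemma comm_context: "comm u v \<Longrightarrow> comm (a @ u @ b) (a @ v @ b)"
  by (induction rule: rtranclp_induct)
    (auto intro: rtranclp.rtrancl_into_rtrancl commutation_step_context)

lemma comm_cong: "comm u u' \<Longrightarrow> comm v v' \<Longrightarrow> comm (u @ v) (u' @ v')"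
  using comm_context[of u u' "[]" v] comm_context[of v v' u' "[]"] by auto

lemma comm_Cons: "comm u v \<Longrightarrow> comm (s # u) (s # v)"
  using comm_context[of u v "[s]" "[]"] by simp

lemma comm_lists: "comm u v \<Longrightarrow> u \<in> lists S \<Longrightarrow> v \<in> lists S"
proof (induction rule: rtranclp_induct)
  case (step v w)
  from step(2,3) step.prems show ?case by cases auto
qed

lemma comm_length: "comm u v \<Longrightarrow> length u = length v"
  by (induction rule: rtranclp_induct) (auto elim: commutation_step.cases)

lemma comm_count: "comm u v \<Longrightarrow> count_list u x = count_list v x"
  by (induction rule: rtranclp_induct) (auto elim: commutation_step.cases)

text \<open>A swap exchanges two commuting letters, and at most one of them satisfies
  \<open>P\<close>.\<close>

lemma comm_filter_noncommuting:
  assumes "comm u v" "\<And>s t. P s \<Longrightarrow> P t \<Longrightarrow> s \<in> S \<Longrightarrow> t \<in> S \<Longrightarrow> m s t \<noteq> 2"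
  shows "filter P u = filter P v"
  using assms(1)
proof (induction rule: rtranclp_induct)
  case (step v w)
  from step(2) have "filter P v = filter P w"
    by cases (use assms(2) in auto)
  then show ?case using step by simp
qed simp

lemma comm_word_eq: "comm u v \<Longrightarrow> u \<in> lists S \<Longrightarrow> u \<sim> v"
proof (induction rule: rtranclp_induct)
  case (step v w)
  have "v \<in> lists S" by (rule comm_lists[OF step(1) step.prems])
  with step(2) have "v \<sim> w"
  proof cases
    case (1 s t a b)
    then show ?thesis
      using \<open>v \<in> lists S\<close> word_eq_context[OF word_eq_braid(1), of s t a b] by auto
  qed
  then show ?case using step by (blast intro: coxeter_eq.trans)
qed (simp add: coxeter_eq.refl)

definition fc_word :: "'a list \<Rightarrow> bool" where
  "fc_word u \<longleftrightarrow> u \<in> lists S \<and>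
     (\<forall>v a b s t. comm u v \<longrightarrow> v \<noteq> a @ [s, s] @ b \<and>
        (m s t = 3 \<longrightarrow> v \<noteq> a @ [s, t, s] @ b) \<and>
        (m s t = 4 \<longrightarrow> v \<noteq> a @ [s, t, s, t] @ b))"

lemma fc_wordD:
  assumes "fc_word u"
  shows "u \<in> lists S" "\<not> comm u (a @ [s, s] @ b)"
    "m s t = 3 \<Longrightarrow> \<not> comm u (a @ [s, t, s] @ b)"
    "m s t = 4 \<Longrightarrow> \<not> comm u (a @ [s, t, s, t] @ b)"
  using assms unfolding fc_word_def by blast+

lemma fc_word_comm: "fc_word u \<Longrightarrow> comm u v \<Longrightarrow> fc_word v"
  unfolding fc_word_def by (metis comm_lists rtranclp_trans)

lemma fc_word_factor:
  assumes "fc_word (p @ u @ q)"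
  shows "fc_word u"
  unfolding fc_word_def
proof (intro conjI allI impI)
  show "u \<in> lists S" using fc_wordD(1)[OF assms] by simp
next
  fix v a b s t
  assume v: "comm u v"
  then have *: "comm (p @ u @ q) (p @ v @ q)" by (rule comm_context)
  show "v \<noteq> a @ [s, s] @ b" using * fc_wordD(2)[OF assms, of "p @ a" s "b @ q"] by auto
  show "v \<noteq> a @ [s, t, s] @ b" if "m s t = 3"
    using * fc_wordD(3)[OF assms that, of "p @ a" "b @ q"] by auto
  show "v \<noteq> a @ [s, t, s, t] @ b" if "m s t = 4"
    using * fc_wordD(4)[OF assms that, of "p @ a" "b @ q"] by auto
qed

text \<open>
  The exchange property replaces Matsumoto's theorem: two distinct initial letters \<open>s\<close>, \<open>t\<close> of
  an element produce a full braid in \<open>s\<close>, \<open>t\<close> in front of a shorter word, and the induction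
  hypothesis moves that braid into the commutation class.
\<close>

theorem fc_word_unique:
  "fc_word u \<Longrightarrow> v \<sim> u \<Longrightarrow> length v \<le> length u \<Longrightarrow> comm u v"
proof (induction "length u" arbitrary: u v rule: less_induct)
  case less
  show ?case
  proof (cases u)
    case Nil
    then show ?thesis using less.prems by simp
  next
    case (Cons s u')
    have uS: "u \<in> lists S" using less.prems(1) by (rule fc_wordD)
    then have S: "s \<in> S" "u' \<in> lists S" using Cons by auto
    have fc': "fc_word u'" using fc_word_factor[of "[s]" u' "[]"] less.prems(1) Cons by simp
    have IH: "comm u' w" if "w \<sim> u'" "length w \<le> length u'" for w
      using less.hyps[OF _ fc' that] Cons by simp
    have red': "reduced u'"
      unfolding reduced_def using S IH comm_length by (metis linorder_le_cases)
    \<comment> \<open>If \<open>u\<close> were not reduced, exchange would make \<open>u'\<close>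
      equal to s a b in the group, and the induction hypothesis for \<open>u'\<close> would bring a
      square of \<open>s\<close> into the commutation class of \<open>u\<close>.\<close>
    have red: "reduced u"
      unfolding reduced_def
    proof (intro conjI allI impI)
      fix w assume w: "w \<sim> u"
      show "length u \<le> length w"
      proof (rule ccontr)
        assume "\<not> length u \<le> length w"
        then have "length w \<le> length u'" using Cons by simp
        then obtain a x b where ab: "u' = a @ x # b" "s # u' \<sim> a @ b"
          using exchange[OF red' S(1), of w] w Cons by blast
        then have "comm u' (s # a @ b)"
            using IH[OF coxeter_eq.sym[OF cons_move[OF ab(2) S(1)]]] ab(1) by simp
        then have "comm u ([] @ [s, s] @ a @ b)" using comm_Cons[of u' _ s] Cons by simp
        then show False using fc_wordD(2) less.prems(1) by blast
      qed
    qed (rule uS)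
    have len: "length v = length u" using red less.prems by (simp add: reduced_def antisym)
    then obtain t v' where v: "v = t # v'" using Cons by (cases v) auto
    have vS: "t \<in> S" "v' \<in> lists S" using word_eq_lists1[OF less.prems(2)] v by auto
    show ?thesis
    proof (cases "t = s")
      case True
      then have "v' \<sim> u'" using less.prems(2) Cons v S by (simp add: cons_cancel)
      then show ?thesis using IH len Cons v True by (auto intro: comm_Cons)
    next
      case False
      note neq = short_words_neq[OF S(1) vS(1) False[symmetric]]
        short_words_neq[OF vS(1) S(1) False]
      \<comment> \<open>So \<open>t\<close> shortens \<open>u\<close>, and exchange deletes a letter
        of \<open>u\<close> when \<open>t\<close> is put in front.\<close>
      have tu: "v' \<sim> t # u" using less.prems(2) v vS cons_move by blast
      have reduced_eq: "reduced w" if "w \<sim> u" "length w = length u" for w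
        using that red unfolding reduced_def by (metis coxeter_eq.trans word_eq_lists1)
      obtain a x b where ab: "u = a @ x # b" "t # u \<sim> a @ b"
        using exchange[OF red vS(1) tu] len v by auto
      \<comment> \<open>The deleted letter is not the first one, as t s would then be
        trivial.\<close>
      obtain a' where a: "a = s # a'"
      proof (cases a)
        case Nil
        then have "[t, s] @ u' \<sim> [] @ u'" using ab Cons by simp
        then have "[t, s] \<sim> []" using S by (simp only: cancel_right)
        then show ?thesis using neq(1) vS cons_move by blast
      qed (use ab Cons that in auto)
      define w where "w = a' @ b"
      have wS: "w \<in> lists S" using ab a uS by (simp add: w_def)
      have lw: "length u' = Suc (length w)" using ab a Cons by (simp add: w_def)
      have u_tsw: "u \<sim> t # s # w" using cons_move[OF ab(2) vS(1)] a by (simp add: w_def)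
      have "m s t \<in> {2, 3, 4}" using m_range S vS False by auto
      then consider (2) "m s t = 2" | (34) "m s t = 3 \<or> m s t = 4" by auto
      then show ?thesis
      proof cases
        case 2
        have tsw: "[t, s] @ w \<sim> [s, t] @ w"
          using word_eq_braid(1)[OF S(1) vS(1) 2] wS
          by (intro word_eq_cong word_eq_refl) (auto intro: coxeter_eq.sym)
        then have "u' \<sim> t # w"
          using coxeter_eq.trans[of S m u "t # s # w" "s # t # w"] u_tsw Cons S
          by (simp add: cons_cancel)
        then have "comm u' (t # w)" using lw by (intro IH) (auto intro: coxeter_eq.sym)
        then have "comm u (s # t # w)" using Cons by (auto intro: comm_Cons)
        moreover have "comm (s # t # w) (t # s # w)"
          using comm_swap[OF S(1) vS(1) 2, of "[]" w] by simp
        ultimately have uc: "comm u (t # s # w)" by (rule rtranclp_trans)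
        then have "fc_word (s # w)"
          using fc_word_factor[of "[t]" "s # w" "[]"] fc_word_comm[OF less.prems(1)] by auto
        moreover have "v' \<sim> s # w"
          using coxeter_eq.trans[OF less.prems(2) u_tsw] v vS by (simp add: cons_cancel)
        ultimately have "comm (s # w) v'" using lw len v Cons by (intro less.hyps) auto
        then show ?thesis using uc v comm_Cons[of "s # w" v' t] by auto
      next
        \<comment> \<open>Exchange is applied again, with \<open>s\<close> in front. The deleted
          letter lies behind t s, so \<open>u\<close> equals s t s z in the group, and the induction
          hypothesis puts the braid s t s into the class of \<open>u\<close>. This excludes label
          3.\<close>
        case 34
        have red1: "reduced (t # s # w)"
          using u_tsw lw Cons by (intro reduced_eq) (auto intro: coxeter_eq.sym)
        have u': "u' \<sim> s # t # s # w" using u_tsw Cons S cons_move by blast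
        obtain a x b where ab: "t # s # w = a @ x # b" "s # t # s # w \<sim> a @ b"
          using exchange[OF red1 S(1) u'] lw by auto
        obtain a' where a: "a = t # s # a'"
        proof -
          have "a \<noteq> []"
          proof
            assume "a = []"
            then have "[s, t] @ (s # w) \<sim> [] @ (s # w)" using ab by simp
            then have "[s, t] \<sim> []" using S wS by (subst (asm) cancel_right) auto
            then show False using neq(5) S cons_move by blast
          qed
          moreover have "a \<noteq> [t]"
          proof
            assume "a = [t]"
            then have "[s, t, s] @ w \<sim> [t] @ w" using ab by simp
            then have "[s, t, s] \<sim> [t]" using wS by (simp only: cancel_right)
            then show False using neq(2) 34 by blast
          qed
          ultimately show ?thesis using ab(1) that by (auto simp: Cons_eq_append_conv)
        qed
        define z where "z = a' @ b"
        have lz: "length w = Suc (length z)" using ab a by (simp add: z_def)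
        have zS: "z \<in> lists S" using ab a wS by (simp add: z_def)
        have u'z: "u' \<sim> t # s # z" using coxeter_eq.trans[OF u' ab(2)] a by (simp add: z_def)
        then have "comm u' (t # s # z)" using lw lz by (intro IH) (auto intro: coxeter_eq.sym)
        then have "comm u ([] @ [s, t, s] @ z)" using comm_Cons[of u' _ s] Cons by simp
        then have m4: "m s t = 4" using 34 fc_wordD(3)[OF less.prems(1)] by blast
        have m4': "m t s = 4" using m4 m_sym S vS by simp
        have uz: "u \<sim> s # t # s # z" using u'z Cons S by (simp add: cons_cancel)
        have red2: "reduced (s # t # s # z)"
          using uz lw lz Cons by (intro reduced_eq) (auto intro: coxeter_eq.sym)
        \<comment> \<open>One more exchange, with \<open>t\<close> in front, lengthens the initial
          braid to t s t s. The braid relation turns it into s t s t, which is forbidden for label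
          4.\<close>
        have vt: "v' \<sim> t # s # t # s # z"
          using coxeter_eq.trans[OF tu word_eq_Cons[OF uz vS(1)]] .
        then obtain a x b where ab: "s # t # s # z = a @ x # b" "t # s # t # s # z \<sim> a @ b"
          using exchange[OF red2 vS(1) vt] lw lz len v Cons by auto
        obtain a' where a: "a = s # t # s # a'"
        proof -
          have "a \<noteq> []"
          proof
            assume "a = []"
            then have "[t, s] @ (t # s # z) \<sim> [] @ (t # s # z)" using ab by auto
            then have "[t, s] \<sim> []" using S vS zS by (subst (asm) cancel_right) auto
            then show False using neq(1) vS cons_move by blast
          qed
          moreover have "a \<noteq> [s]"
          proof
            assume "a = [s]"
            then have "[t, s, t, s] @ z \<sim> [s, s] @ z" using ab by auto
            then have "[t, s, t, s] \<sim> [s, s]" using zS by (simp only: cancel_right)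
            moreover have "[s, s] \<sim> []" using cons_move'[OF word_eq_refl] S by auto
            ultimately show False using neq(7) m4' by (blast intro: coxeter_eq.trans)
          qed
          moreover have "a \<noteq> [s, t]"
          proof
            assume "a = [s, t]"
            then have "[t, s, t, s] @ z \<sim> [s, t] @ z" using ab by auto
            then have "[t, s, t, s] \<sim> [s, t]" using zS by (simp only: cancel_right)
            then show False using neq(8) m4' by blast
          qed
          ultimately show ?thesis using ab(1) that by (auto simp: Cons_eq_append_conv)
        qed
        define y where "y = a' @ b"
        have ly: "length z = Suc (length y)" using ab a by (simp add: y_def)
        have yS: "y \<in> lists S" using ab a zS by (simp add: y_def)
        have "s # t # s # z \<sim> t # s # t # s # y" using cons_move[OF ab(2) vS(1)] a by (simp add: y_def)
        then have "s # u' \<sim> t # s # t # s # y" using coxeter_eq.trans[OF uz] Cons by simp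
        moreover have "[t, s, t, s] @ y \<sim> [s, t, s, t] @ y"
          using word_eq_braid(3)[OF vS(1) S(1) m4'] yS by (intro word_eq_cong word_eq_refl)
        ultimately have "s # u' \<sim> s # t # s # t # y" using coxeter_eq.trans by fastforce
        then have "comm u' (t # s # t # y)"
          using lw lz ly S by (intro IH) (auto simp: cons_cancel intro: coxeter_eq.sym)
        then have "comm u ([] @ [s, t, s, t] @ y)" using comm_Cons[of u' _ s] Cons by simp
        then show ?thesis using fc_wordD(4)[OF less.prems(1) m4] by blast
      qed
    qed
  qed
qed

section \<open>Group elements represented by fully commutative words\<close>

abbreviation cox_class :: "'a list \<Rightarrow> 'a list set" where
  "cox_class u \<equiv> coxeter_rel S m `` {u}"

lemma coxeter_rel_iff [simp]: "(u, v) \<in> coxeter_rel S m \<longleftrightarrow> u \<sim> v"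
  by (simp add: coxeter_rel_def)

lemma cox_class_eq_iff: "u \<in> lists S \<Longrightarrow> cox_class u = cox_class v \<longleftrightarrow> u \<sim> v"
  by (metis coxeter_eq.sym equiv_class_eq equiv_coxeter_rel coxeter_rel_iff
      Image_singleton_iff coxeter_eq.refl)

lemma cox_class_square_eq_one:
  assumes "u \<in> lists S"
  shows "cox_class u \<otimes>\<^bsub>coxeter_group S m\<^esub> cox_class u = \<one>\<^bsub>coxeter_group S m\<^esub> \<longleftrightarrow> u \<sim> rev u"
proof -
  have "cox_class u \<otimes>\<^bsub>coxeter_group S m\<^esub> cox_class u = \<one>\<^bsub>coxeter_group S m\<^esub>
      \<longleftrightarrow> cox_class (u @ u) = cox_class []"
    using coxeter_mult_class[OF assms assms] by (simp add: coxeter_group_def)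
  also have "\<dots> \<longleftrightarrow> u @ u \<sim> []" using assms by (subst cox_class_eq_iff) auto
  also have "\<dots> \<longleftrightarrow> u \<sim> rev u" using move_right[OF assms, of u "[]"] by simp
  finally show ?thesis .
qed

lemma fc_word_length_le: "fc_word u \<Longrightarrow> v \<sim> u \<Longrightarrow> length u \<le> length v"
  using fc_word_unique comm_length by (metis linorder_le_cases order_refl)

lemma coxeter_length_fc:
  assumes "fc_word u"
  shows "coxeter_length (cox_class u) = length u"
  unfolding coxeter_length_def
proof (rule Least_equality)
  show "\<exists>v\<in>cox_class u. length v = length u"
    using fc_wordD(1)[OF assms] by (intro bexI[of _ u]) (auto simp: coxeter_eq.refl)
qed (use fc_word_length_le[OF assms coxeter_eq.sym] in auto)

lemma reduced_words_fc:
  assumes "fc_word u"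
  shows "reduced_words (cox_class u) = {v. comm u v}"
  using coxeter_length_fc[OF assms] comm_word_eq[OF _ fc_wordD(1)[OF assms]] comm_length[of u]
  by (auto simp: reduced_words_def intro: fc_word_unique[OF assms] coxeter_eq.sym)

lemma fully_commutative_fc: "fc_word u \<Longrightarrow> fully_commutative S m (cox_class u)"
  unfolding fully_commutative_def by (auto simp: reduced_words_fc intro: rtranclp_trans comm_sym)

text \<open>A square could be cancelled, against minimality. A braid could be replaced by the
  opposite one, which gives a reduced word outside the commutation class: for label 3 the letter
  counts change, for label 4 the order of \<open>s\<close> and \<open>t\<close>.\<close>

lemma fully_commutative_imp_fc_word:
  assumes fc: "fully_commutative S m w" and u: "u \<in> reduced_words w" and w: "w = cox_class u0"
  shows "fc_word u"
  unfolding fc_word_def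
proof (intro conjI allI impI notI)
  have uw: "u0 \<sim> u" "length u = coxeter_length w" using u w by (auto simp: reduced_words_def)
  show uS: "u \<in> lists S" using uw word_eq_lists2 by blast
  have min: "length u \<le> length x" if "u \<sim> x" for x
    using that uw unfolding coxeter_length_def w
    by (auto intro!: Least_le bexI[of _ x] intro: coxeter_eq.trans)
  have same: "comm u x" if "u \<sim> x" "length x = length u" for x
    using fc u that uw unfolding fully_commutative_def w
    by (auto simp: reduced_words_def intro: coxeter_eq.trans)
  fix v a b s t
  assume v: "comm u v"
  have uv: "u \<sim> v" "length v = length u" "v \<in> lists S"
    using comm_word_eq[OF v uS] comm_length[OF v] comm_lists[OF v uS] by auto
  {
    assume "v = a @ [s, s] @ b"
    moreover from this have "s \<in> S" "a \<in> lists S" "b \<in> lists S" using uv by auto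
    ultimately have "v \<sim> a @ b"
      using word_eq_context[of "[s, s]" "[]" a b] append_rev_eq[of "[s]"] by simp
    then have "u \<sim> a @ b" using uv by (blast intro: coxeter_eq.trans)
    then show False using min[of "a @ b"] uv \<open>v = _\<close> by simp
  }
  {
    assume m3: "m s t = 3" and eq: "v = a @ [s, t, s] @ b"
    then have S: "s \<in> S" "t \<in> S" "a \<in> lists S" "b \<in> lists S" using uv by auto
    have neq: "s \<noteq> t" using m3 m_diag S by auto
    have "v \<sim> a @ [t, s, t] @ b"
      unfolding eq using S m3 by (intro word_eq_context word_eq_braid)
    then have "comm u (a @ [t, s, t] @ b)"
      using uv eq by (intro same) (auto intro: coxeter_eq.trans)
    then have "count_list v s = count_list (a @ [t, s, t] @ b) s"
      using comm_count v by metis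
    then show False using eq neq by simp
  }
  {
    assume m4: "m s t = 4" and eq: "v = a @ [s, t, s, t] @ b"
    then have S: "s \<in> S" "t \<in> S" "a \<in> lists S" "b \<in> lists S" using uv by auto
    have neq: "s \<noteq> t" using m4 m_diag S by auto
    have "v \<sim> a @ [t, s, t, s] @ b"
      unfolding eq using S m4 by (intro word_eq_context word_eq_braid)
    then have "comm u (a @ [t, s, t, s] @ b)"
      using uv eq by (intro same) (auto intro: coxeter_eq.trans)
    then have "comm v (a @ [t, s, t, s] @ b)"
      using comm_sym[OF v] by (rule rtranclp_trans[rotated])
    then have "filter (\<lambda>x. x = s \<or> x = t) v = filter (\<lambda>x. x = s \<or> x = t) (a @ [t, s, t, s] @ b)"
      by (rule comm_filter_noncommuting) (use m4 m_sym S m_diag in auto)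
    then show False using eq neq by simp
  }
qed

text \<open>Inverses are reversals, and since \<open>u\<close> and \<open>rev u\<close> have equal
  length, \<open>fc_word_unique\<close> turns their equality in the group into commutation
  equivalence.\<close>

lemma fc_involutions_eq:
  "fc_involutions S m = cox_class ` {u. fc_word u \<and> comm u (rev u)}"
proof (intro equalityI subsetI)
  fix w assume w: "w \<in> fc_involutions S m"
  then obtain u0 where u0: "u0 \<in> lists S" "w = cox_class u0"
    by (auto simp: fc_involutions_def coxeter_group_def elim!: quotientE)
  have "u0 \<in> w" using u0(2) word_eq_refl[OF u0(1)] by simp
  then have "\<exists>u\<in>w. length u = coxeter_length w"
    unfolding coxeter_length_def by (intro LeastI[of "\<lambda>k. \<exists>u\<in>w. length u = k" "length u0"]) blast
  then obtain u where u: "u \<in> w" "length u = coxeter_length w" by blast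
  have fc: "fc_word u"
    using w u u0 by (auto simp: fc_involutions_def reduced_words_def
        intro!: fully_commutative_imp_fc_word)
  have wu: "w = cox_class u" using u0 u cox_class_eq_iff by auto
  then have "u \<sim> rev u"
    using w cox_class_square_eq_one[OF fc_wordD(1)[OF fc]] by (auto simp: fc_involutions_def)
  then have "comm u (rev u)" using fc by (intro fc_word_unique) (auto intro: coxeter_eq.sym)
  then show "w \<in> cox_class ` {u. fc_word u \<and> comm u (rev u)}" using fc wu by blast
next
  fix w assume "w \<in> cox_class ` {u. fc_word u \<and> comm u (rev u)}"
  then obtain u where u: "fc_word u" "comm u (rev u)" "w = cox_class u" by blast
  have uS: "u \<in> lists S" using u fc_wordD by blast
  then have "w \<in> carrier (coxeter_group S m)" using u(3) by (simp add: coxeter_group_def quotientI)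
  then show "w \<in> fc_involutions S m"
    using cox_class_square_eq_one[OF uS] comm_word_eq[OF u(2) uS] fully_commutative_fc[OF u(1)] u(3)
    by (simp add: fc_involutions_def)
qed

text \<open>The counting scheme for all three types: \<open>D\<close> is a set of combinatorial
  data, and \<open>Spec d\<close> describes words of the class that \<open>d\<close> encodes. A
  relation avoids naming a canonical word in each class; the premises make the data correspond
  bijectively to the self-dual classes.\<close>

lemma fc_inv_poly_eq_sum:
  assumes ex: "\<And>d. d \<in> D \<Longrightarrow> \<exists>u. Spec d u"
    and Spec: "\<And>d u. d \<in> D \<Longrightarrow> Spec d u \<Longrightarrow> fc_word u \<and> comm u (rev u) \<and> length u = len d"
    and unique: "\<And>d u v. d \<in> D \<Longrightarrow> Spec d u \<Longrightarrow> Spec d v \<Longrightarrow> comm u v"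
    and disjoint: "\<And>d e u v. d \<in> D \<Longrightarrow> e \<in> D \<Longrightarrow> Spec d u \<Longrightarrow> Spec e v \<Longrightarrow> comm u v \<Longrightarrow> d = e"
    and all: "\<And>u. fc_word u \<Longrightarrow> comm u (rev u) \<Longrightarrow> \<exists>d\<in>D. Spec d u"
  shows "fc_inv_poly S m = (\<Sum>d\<in>D. monom 1 (len d))"
proof -
  obtain f where f: "\<And>d. d \<in> D \<Longrightarrow> Spec d (f d)" using ex by metis
  have same: "comm u v" if "fc_word u" "fc_word v" "cox_class u = cox_class v" for u v
  proof -
    have uv: "u \<sim> v" using that cox_class_eq_iff fc_wordD(1) by blast
    show ?thesis
      using fc_word_unique[OF that(1) coxeter_eq.sym[OF uv]] fc_word_unique[OF that(2) uv] comm_sym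
      by (metis linorder_le_cases)
  qed
  have "bij_betw (\<lambda>d. cox_class (f d)) D (fc_involutions S m)"
  proof (rule bij_betw_imageI)
    show "inj_on (\<lambda>d. cox_class (f d)) D"
      by (rule inj_onI) (meson same Spec f disjoint)
    show "(\<lambda>d. cox_class (f d)) ` D = fc_involutions S m"
    proof (intro equalityI subsetI)
      fix w assume "w \<in> fc_involutions S m"
      then obtain u where u: "fc_word u" "comm u (rev u)" "w = cox_class u"
        by (auto simp: fc_involutions_eq)
      then obtain d where d: "d \<in> D" "Spec d u" using all by blast
      then have "comm (f d) u" using unique f by blast
      then have "w = cox_class (f d)"
        using u Spec[OF d(1) f[OF d(1)]] comm_word_eq cox_class_eq_iff fc_wordD(1) by metis
      then show "w \<in> (\<lambda>d. cox_class (f d)) ` D" using d by blast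
    qed (use Spec f in \<open>auto simp: fc_involutions_eq\<close>)
  qed
  then have "fc_inv_poly S m = (\<Sum>d\<in>D. monom 1 (coxeter_length (cox_class (f d))))"
    unfolding fc_inv_poly_def by (rule sum.reindex_bij_betw[symmetric])
  also have "\<dots> = (\<Sum>d\<in>D. monom 1 (len d))"
    using Spec f coxeter_length_fc by (intro sum.cong) (auto)
  finally show ?thesis .
qed

end

section \<open>Words and their projections to two letters\<close>

definition proj :: "'a \<Rightarrow> 'a \<Rightarrow> 'a list \<Rightarrow> 'a list" where
  "proj x y u = filter (\<lambda>z. z = x \<or> z = y) u"

lemma proj_simps [simp]:
  "proj x y [] = []"
  "proj x y (z # u) = (if z = x \<or> z = y then z # proj x y u else proj x y u)"
  "proj x y (u @ v) = proj x y u @ proj x y v"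
  "proj x y (rev u) = rev (proj x y u)"
  "set (proj x y u) = set u \<inter> {x, y}"
  by (auto simp: proj_def rev_filter)

lemma proj_commute: "proj x y u = proj y x u"
  by (simp add: proj_def disj_commute)

lemma count_proj: "z = x \<or> z = y \<Longrightarrow> count_list (proj x y u) z = count_list u z"
  by (induction u) (auto simp: proj_def)

lemma proj_eq_Nil_iff: "proj x y u = [] \<longleftrightarrow> x \<notin> set u \<and> y \<notin> set u"
  by (auto simp: proj_def filter_empty_conv)

lemma proj_absent: "y \<notin> set u \<Longrightarrow> proj x y u = replicate (count_list u x) x"
  by (induction u) auto

lemma proj_same: "proj x x u = replicate (count_list u x) x"
  by (induction u) auto

definition separated :: "'a \<Rightarrow> 'a \<Rightarrow> 'a list \<Rightarrow> bool" where
  "separated y x u \<longleftrightarrow> (\<forall>a w b. u = a @ x # w @ x # b \<longrightarrow> y \<in> set w)"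

lemma separatedD: "separated y x (a @ x # w @ x # b) \<Longrightarrow> y \<in> set w"
  by (auto simp: separated_def)

lemma not_distinct_adjE:
  assumes "\<not> distinct_adj v"
  obtains p z q where "v = p @ z # z # q"
  using assms
proof (induction v arbitrary: thesis)
  case (Cons x v)
  show ?case
  proof (cases "distinct_adj v")
    case True
    then obtain w where "v = x # w"
      using Cons.prems(2) by (cases v) (auto simp: distinct_adj_Cons)
    then show ?thesis using Cons.prems(1)[of "[]" x w] by simp
  next
    case False
    then show ?thesis using Cons.IH Cons.prems(1) by (metis append_Cons)
  qed
qed simp

lemma distinct_adj_iff: "distinct_adj v \<longleftrightarrow> (\<forall>p z q. v \<noteq> p @ z # z # q)"
proof
  assume "\<forall>p z q. v \<noteq> p @ z # z # q"
  then show "distinct_adj v" by (metis not_distinct_adjE)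
qed (auto simp: distinct_adj_append_iff)

lemma filter_eq_appendE:
  assumes "filter P u = p @ q"
  obtains a b where "u = a @ b" "filter P a = p" "filter P b = q"
  using assms
proof (induction p arbitrary: u thesis)
  case Nil
  then show ?case by (metis append_Nil filter.simps(1))
next
  case (Cons x p)
  then obtain a' u' where u: "u = a' @ x # u'" "\<forall>z\<in>set a'. \<not> P z" "P x" "filter P u' = p @ q"
    by (auto simp: filter_eq_Cons_iff)
  then obtain a b where "u' = a @ b" "filter P a = p" "filter P b = q" using Cons.IH by blast
  then show ?case using u Cons.prems(1)[of "a' @ x # a" b] by simp
qed

text \<open>Connects conditions on factors of the word with conditions on a projection, which for
  non-commuting letters is invariant under commutations.\<close>

lemma separated_iff_proj:
  assumes "x \<noteq> y"
  shows "separated y x u \<longleftrightarrow> \<not> sublist [x, x] (proj x y u)"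
proof
  assume sep: "separated y x u"
  show "\<not> sublist [x, x] (proj x y u)"
  proof
    assume "sublist [x, x] (proj x y u)"
    then obtain p q where "filter (\<lambda>z. z = x \<or> z = y) u = p @ x # x # q"
      by (auto simp: sublist_def proj_def)
    then obtain a u' where u': "u = a @ u'" "filter (\<lambda>z. z = x \<or> z = y) u' = x # x # q"
      by (rule filter_eq_appendE)
    obtain a' u'' where u'': "u' = a' @ x # u''" "filter (\<lambda>z. z = x \<or> z = y) u'' = x # q"
      using filter_eq_ConsD[OF u'(2)] by metis
    obtain w b where "u'' = w @ x # b" "\<forall>z\<in>set w. z \<noteq> x \<and> z \<noteq> y"
      using filter_eq_ConsD[OF u''(2)] by metis
    then have "u = (a @ a') @ x # w @ x # b" "y \<notin> set w" using u' u'' by auto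
    then show False using sep unfolding separated_def by blast
  qed
next
  assume no: "\<not> sublist [x, x] (proj x y u)"
  show "separated y x u"
    unfolding separated_def
  proof (intro allI impI)
    fix a w b assume u: "u = a @ x # w @ x # b"
    show "y \<in> set w"
    proof (rule ccontr)
      assume "y \<notin> set w"
      then have "proj x y u = proj x y a @ x # replicate (count_list w x) x @ x # proj x y b"
        using u by (simp add: proj_absent)
      also have "\<dots> = proj x y a @ [x, x] @ replicate (count_list w x) x @ proj x y b"
        by (simp add: replicate_app_Cons_same)
      finally show False using no by (metis sublist_def)
    qed
  qed
qed

lemma distinct_adj_proj_iff:
  assumes "x \<noteq> y"
  shows "distinct_adj (proj x y u) \<longleftrightarrow> separated x y u \<and> separated y x u"
proof -
  have "distinct_adj (proj x y u) \<longleftrightarrow>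
      \<not> sublist [x, x] (proj x y u) \<and> \<not> sublist [y, y] (proj x y u)"
  proof -
    have "z = x \<or> z = y" if "proj x y u = p @ z # z # q" for p z q
      using arg_cong[OF that, of set] by auto
    then show ?thesis unfolding distinct_adj_iff sublist_def by (metis append_Cons append_Nil)
  qed
  then show ?thesis using assms by (auto simp: separated_iff_proj proj_commute[of x y])
qed

lemma separated_rev [simp]: "separated y x (rev u) \<longleftrightarrow> separated y x u"
proof -
  have "separated y x (rev u)" if "separated y x u" for u :: "'a list"
    unfolding separated_def
  proof (intro allI impI)
    fix a w b assume "rev u = a @ x # w @ x # b"
    then have "u = rev b @ x # rev w @ x # rev a" by (simp add: rev_swap)
    then show "y \<in> set w" using that separatedD[of y x "rev b" "rev w" "rev a"] by simp
  qed
  from this[of u] this[of "rev u"] show ?thesis by auto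
qed

text \<open>Two occurrences of \<open>x\<close> in \<open>w\<close> would enclose a
  \<open>y\<close>. This upper bound is played off against the lower bounds that full commutativity
  imposes on gaps.\<close>

lemma separated_count_le:
  assumes "separated y x u" "u = a @ w @ b" "y \<notin> set w"
  shows "count_list w x \<le> 1"
proof (rule ccontr)
  assume "\<not> count_list w x \<le> 1"
  then obtain n where n: "count_list w x = Suc (Suc n)"
    by (metis One_nat_def Suc_le_mono le0 not0_implies_Suc)
  then obtain p w' where 1: "w = p @ x # w'" "count_list w' x = Suc n"
    by (meson count_list_Suc_split_first)
  then obtain p' w'' where "w' = p' @ x # w''"
    by (meson count_list_Suc_split_first)
  then have "y \<in> set p'" using assms 1 separatedD[of y x "a @ p" p' "w'' @ b"] by auto
  then show False using assms 1 \<open>w' = _\<close> by auto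
qed

subsection \<open>Alternating words in two letters\<close>

lemma alternating_determined:
  assumes "distinct_adj v" "distinct_adj v'" "set v \<subseteq> {a, b}" "set v' \<subseteq> {a, b}"
    and "length v = length v'" "v \<noteq> [] \<Longrightarrow> hd v = hd v'"
  shows "v = v'"
  using assms
proof (induction v arbitrary: v')
  case (Cons x v)
  then obtain w where w: "v' = x # w" by (cases v') auto
  have "v = w"
  proof (rule Cons.IH)
    assume "v \<noteq> []"
    then show "hd v = hd w"
      using Cons.prems w by (cases v; cases w) auto
  qed (use Cons.prems w in \<open>auto simp: distinct_adj_Cons\<close>)
  then show ?case using w by simp
qed simp

lemma alternating_count:
  assumes "distinct_adj v" "set v \<subseteq> {a, b}" "a \<noteq> b" "v \<noteq> []" "hd v = a"
  shows "count_list v a = count_list v b + (if last v = a then 1 else 0)"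
  using assms
proof (induction v arbitrary: a b)
  case (Cons x v)
  show ?case
  proof (cases v)
    case (Cons y w)
    then have "count_list v b = count_list v a + (if last v = b then 1 else 0)"
      using Cons.prems by (intro Cons.IH) auto
    moreover have "last v \<in> {a, b}" using Cons.prems Cons by (metis last_in_set list.distinct(1)
          set_subset_Cons subset_iff)
    ultimately show ?thesis using Cons.prems Cons by auto
  qed (use Cons.prems in auto)
qed simp

text \<open>The possible letter counts of an alternating palindrome in two letters: it is empty, or
  its length is odd and one letter occurs once more than the other.\<close>

definition zstep :: "nat \<Rightarrow> nat \<Rightarrow> bool" where
  "zstep j k \<longleftrightarrow> j = Suc k \<or> k = Suc j \<or> j = 0 \<and> k = 0"

text \<open>The letter that occurs more often comes first, so the two counts fix both the length and
  the first letter.\<close>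

lemma alternating_eqI:
  assumes "distinct_adj v" "distinct_adj v'" "set v \<subseteq> {a, b}" "set v' \<subseteq> {a, b}" "a \<noteq> b"
    and "count_list v a = count_list v' a" "count_list v b = count_list v' b"
    and z: "zstep (count_list v a) (count_list v b)"
  shows "v = v'"
proof (cases "v = []")
  case True
  then have "\<forall>x\<in>{a, b}. x \<notin> set v'" using assms by (auto simp: count_list_0_iff dest: sym)
  then show ?thesis using True assms(4) by (cases v') auto
next
  case False
  have len: "length w = count_list w a + count_list w b" if "set w \<subseteq> {a, b}" for w
    using sum_count_set[OF that] assms(5) by simp
  have "v' \<noteq> []" using False assms len[of v] len[of v'] by auto
  have hd: "hd w = (if count_list w a > count_list w b then a else b)"
    if "w \<noteq> []" "distinct_adj w" "set w \<subseteq> {a, b}" "zstep (count_list w a) (count_list w b)" for w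
  proof -
    have "length w > 0" using that by simp
    moreover have "hd w \<in> {a, b}" using that by (meson hd_in_set subset_iff)
    ultimately show ?thesis
      using alternating_count[OF that(2), of a b] alternating_count[OF that(2), of b a] that assms(5)
        len[OF that(3)]
      by (auto simp: zstep_def insert_commute split: if_splits)
  qed
  show ?thesis
    using assms hd[of v] hd[of v'] False \<open>v' \<noteq> []\<close> len[of v] len[of v']
    by (intro alternating_determined) auto
qed

lemma alternating_palindrome_iff:
  assumes "distinct_adj v" "set v \<subseteq> {a, b}" "a \<noteq> b"
  shows "rev v = v \<longleftrightarrow> zstep (count_list v a) (count_list v b)"
proof
  assume "zstep (count_list v a) (count_list v b)"
  then show "rev v = v" using assms by (intro alternating_eqI[symmetric, of v "rev v" a b]) auto
next
  assume rev: "rev v = v"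
  show "zstep (count_list v a) (count_list v b)"
  proof (cases "v = []")
    case False
    then have "hd v = last v" using rev by (metis hd_rev)
    moreover have "hd v \<in> {a, b}" using assms False by (meson hd_in_set subset_iff)
    ultimately show ?thesis
      using alternating_count[OF assms(1), of a b] alternating_count[OF assms(1), of b a] assms False
      by (auto simp: zstep_def insert_commute)
  qed (simp add: zstep_def)
qed

lemma alternating_exists:
  assumes "a \<noteq> b" "zstep j k"
  shows "\<exists>v. distinct_adj v \<and> set v \<subseteq> {a, b} \<and> count_list v a = j \<and> count_list v b = k"
proof -
  have *: "\<exists>v. distinct_adj v \<and> v \<noteq> [] \<and> hd v = a \<and> set v \<subseteq> {a, b} \<and>
      count_list v a = Suc i \<and> count_list v b = i" if "a \<noteq> b" for a b :: 'a and i
  proof (induction i)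
    case 0
    show ?case using that by (intro exI[of _ "[a]"]) auto
  next
    case (Suc i)
    then obtain v where "distinct_adj v" "v \<noteq> []" "hd v = a" "set v \<subseteq> {a, b}"
      "count_list v a = Suc i" "count_list v b = i" by blast
    then show ?case using that by (intro exI[of _ "a # b # v"]) (auto simp: distinct_adj_Cons)
  qed
  consider "j = Suc k" | "k = Suc j" | "j = 0" "k = 0" using assms(2) by (auto simp: zstep_def)
  then show ?thesis
  proof cases
    case 1
    then show ?thesis using *[OF assms(1), of k] by blast
  next
    case 2
    then show ?thesis using *[OF assms(1)[symmetric], of j] by (metis insert_commute)
  next
    case 3
    then show ?thesis by (intro exI[of _ "[]"]) auto
  qed
qed

text \<open>The two words are synchronised at the occurrences of the shared letter \<open>a\<close>;
  between these the other letters can be interleaved freely.\<close>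

lemma merge_exists:
  assumes "filter (\<lambda>x. x = a) u = filter (\<lambda>x. x = a) v"
    and "set u \<subseteq> A" "set v \<subseteq> B" "A \<inter> B \<subseteq> {a}" "a \<in> A" "a \<in> B"
  shows "\<exists>w. filter (\<lambda>x. x \<in> A) w = u \<and> filter (\<lambda>x. x \<in> B) w = v \<and> set w \<subseteq> A \<union> B"
  using assms
proof (induction "length u + length v" arbitrary: u v rule: less_induct)
  case less
  consider "u = []" "v = []" | x u' where "u = x # u'" "x \<noteq> a" | y v' where "v = y # v'" "y \<noteq> a"
    | u' v' where "u = a # u'" "v = a # v'"
    using less.prems(1) by (cases u; cases v) (auto split: if_splits)
  then show ?case
  proof cases
    case 1
    then show ?thesis by (intro exI[of _ "[]"]) simp
  next
    case (2 x u')
    then obtain w where "filter (\<lambda>x. x \<in> A) w = u'" "filter (\<lambda>x. x \<in> B) w = v" "set w \<subseteq> A \<union> B"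
      using less.hyps[of u' v] less.prems by auto
    moreover have "x \<in> A" "x \<notin> B" using 2 less.prems by auto
    ultimately show ?thesis using 2 by (intro exI[of _ "x # w"]) auto
  next
    case (3 y v')
    then obtain w where "filter (\<lambda>x. x \<in> A) w = u" "filter (\<lambda>x. x \<in> B) w = v'" "set w \<subseteq> A \<union> B"
      using less.hyps[of u v'] less.prems by auto
    moreover have "y \<in> B" "y \<notin> A" using 3 less.prems by auto
    ultimately show ?thesis using 3 by (intro exI[of _ "y # w"]) auto
  next
    case (4 u' v')
    then obtain w where "filter (\<lambda>x. x \<in> A) w = u'" "filter (\<lambda>x. x \<in> B) w = v'" "set w \<subseteq> A \<union> B"
      using less.hyps[of u' v'] less.prems by auto
    then show ?thesis using 4 less.prems by (intro exI[of _ "a # w"]) auto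
  qed
qed

subsection \<open>Projections and commutation classes\<close>

context small_coxeter
begin

lemma comm_move_right:
  "\<lbrakk>s \<in> S; set w \<subseteq> S; \<forall>t\<in>set w. m s t = 2\<rbrakk> \<Longrightarrow> comm (s # w) (w @ [s])"
proof (induction w)
  case (Cons t w)
  then have "comm ([] @ [s, t] @ w) ([] @ [t, s] @ w)" by (intro comm_swap) auto
  moreover have "comm ([t] @ (s # w)) ([t] @ (w @ [s]))" using Cons by (intro comm_cong) auto
  ultimately show ?case by (auto intro: rtranclp_trans)
qed simp

lemma comm_proj: "comm u v \<Longrightarrow> s \<in> S \<Longrightarrow> t \<in> S \<Longrightarrow> m s t \<noteq> 2 \<Longrightarrow> proj s t u = proj s t v"
  unfolding proj_def by (rule comm_filter_noncommuting) (use m_sym m_diag in auto)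

text \<open>In \<open>v\<close>, everything before the first \<open>s\<close> commutes with
  \<open>s\<close>: a non-commuting letter there would come first in its projection with
  \<open>s\<close>, which begins with \<open>s\<close> for the other word. So \<open>s\<close> can
  be moved to the front. The pairs of equal letters supply the letter counts.\<close>

lemma comm_if_proj_eq:
  assumes "u \<in> lists S" "v \<in> lists S"
    and "\<And>s t. s \<in> S \<Longrightarrow> t \<in> S \<Longrightarrow> m s t \<noteq> 2 \<Longrightarrow> proj s t u = proj s t v"
  shows "comm u v"
  using assms
proof (induction u arbitrary: v rule: list.induct)
  case Nil
  have "x \<notin> set v" for x
  proof
    assume "x \<in> set v"
    then have "proj x x v = []"
      using Nil.prems(3)[of x x] Nil.prems(2) m_diag[of x] by fastforce
    then show False using \<open>x \<in> set v\<close> by (simp add: proj_eq_Nil_iff)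
  qed
  then show ?case by (cases v) auto
next
  case (Cons s u)
  have s: "s \<in> S" using Cons.prems by simp
  have "s # proj s s u = proj s s v" using Cons.prems(3)[OF s s] m_diag[OF s] by simp
  then have "s \<in> set (proj s s v)" by (metis list.set_intros(1))
  then obtain v1 v2 where v: "v = v1 @ s # v2" "s \<notin> set v1" using split_list_first[of s v] by auto
  have v1: "m s t = 2" if "t \<in> set v1" for t
  proof (rule ccontr)
    assume m: "m s t \<noteq> 2"
    have "t \<in> S" using that v Cons.prems by auto
    then have eq: "s # proj s t u = proj s t v1 @ proj s t (s # v2)"
      using Cons.prems(3)[OF s _ m] v by simp
    have "proj s t v1 \<noteq> []" using that by (simp add: proj_eq_Nil_iff)
    then have "s \<in> set (proj s t v1)" using eq by (cases "proj s t v1") auto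
    then show False using v by auto
  qed
  have "comm u (v1 @ v2)"
  proof (rule Cons.IH)
    fix s' t' assume st: "s' \<in> S" "t' \<in> S" "m s' t' \<noteq> 2"
    show "proj s' t' u = proj s' t' (v1 @ v2)"
    proof (cases "s = s' \<or> s = t'")
      case True
      then have "s' \<notin> set v1" "t' \<notin> set v1" using v1 v(2) st m_sym by metis+
      then have "proj s' t' v1 = []" by (simp add: proj_eq_Nil_iff)
      then show ?thesis using Cons.prems(3)[OF st] True v by auto
    qed (use Cons.prems(3)[OF st] v in auto)
  qed (use Cons.prems v in auto)
  then have "comm (s # u) ((s # v1) @ v2)" using comm_Cons by simp
  moreover have "comm ((s # v1) @ v2) ((v1 @ [s]) @ v2)"
    using s v v1 Cons.prems by (intro comm_cong comm_move_right) auto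
  ultimately show ?case using v by (auto intro: rtranclp_trans)
qed

text \<open>Letters commuting with \<open>i\<close> can be moved out of the gap. If nothing else is
  left a square arises; if a single \<open>t\<close> is left, a factor \<open>[i, t, i]\<close>,
  which only label 4 tolerates.\<close>

lemma fc_word_gap:
  assumes fc: "fc_word u" and u: "u = a @ i # w @ i # b" and i: "i \<notin> set w"
  shows "length (filter (\<lambda>x. m i x \<noteq> 2) w) \<ge> 2 \<or> (\<exists>t. filter (\<lambda>x. m i x \<noteq> 2) w = [t] \<and> m i t = 4)"
proof -
  have S: "i \<in> S" "set w \<subseteq> S" using fc_wordD(1)[OF fc] u by auto
  consider "filter (\<lambda>x. m i x \<noteq> 2) w = []" | t where "filter (\<lambda>x. m i x \<noteq> 2) w = [t]"
    | "length (filter (\<lambda>x. m i x \<noteq> 2) w) \<ge> 2"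
    by (cases "filter (\<lambda>x. m i x \<noteq> 2) w" rule: remdups_adj.cases) auto
  then show ?thesis
  proof cases
    case 1
    then have "comm (i # w) (w @ [i])"
      using S by (intro comm_move_right) (auto simp: filter_empty_conv)
    then have "comm u ((a @ w) @ [i, i] @ b)"
      using comm_context[of "i # w" "w @ [i]" a "i # b"] u by simp
    then show ?thesis using fc_wordD(2)[OF fc] by blast
  next
    case (2 t)
    then obtain w1 w2 where w': "w = w1 @ t # w2" "\<forall>x\<in>set w1. \<not> m i x \<noteq> 2" "m i t \<noteq> 2"
      "[] = filter (\<lambda>x. m i x \<noteq> 2) w2"
      using filter_eq_ConsD[OF 2] by blast
    have "\<forall>x\<in>set w2. m i x = 2" using w'(4)[symmetric] by (simp add: filter_empty_conv)
    with w' have w: "w = w1 @ t # w2" "\<forall>x\<in>set w1. m i x = 2" "\<forall>x\<in>set w2. m i x = 2"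
      "m i t \<noteq> 2"
      by auto
    have "comm (i # w1) (w1 @ [i])" using S w by (intro comm_move_right) auto
    moreover have "comm (w2 @ [i]) (i # w2)" using S w by (intro comm_sym[OF comm_move_right]) auto
    ultimately have "comm (a @ (i # w1) @ [t] @ (w2 @ [i]) @ b) (a @ (w1 @ [i]) @ [t] @ (i # w2) @ b)"
      by (intro comm_cong) auto
    then have "comm u ((a @ w1) @ [i, t, i] @ w2 @ b)" using u w by simp
    then have "m i t \<noteq> 3" using fc_wordD(3)[OF fc] by blast
    moreover have "t \<noteq> i" "t \<in> S" using w i S by auto
    ultimately have "m i t = 4" using m_range[of i t] S w by auto
    then show ?thesis using 2 by blast
  qed simp
qed

text \<open>If a square or braid occurs in some word of the class, two occurrences of
  \<open>s\<close> have at most \<open>t\<close> between them, so \<open>[s, s]\<close> shows in the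
  projection to any other non-commuting letter. That letter may be \<open>s\<close> itself, whose
  projection detects whether \<open>s\<close> occurs twice; this serves the ends of the diagram. The
  last alternative in \<open>braid3\<close> is for the fork of type D, where no projection to a
  single edge suffices.\<close>

lemma fc_wordI_general:
  assumes uS: "u \<in> lists S"
    and sq: "\<And>s. s \<in> S \<Longrightarrow> \<exists>t\<in>S. m s t \<noteq> 2 \<and> \<not> sublist [s, s] (proj s t u)"
    and braid3: "\<And>s t. \<lbrakk>s \<in> S; t \<in> S; m s t = 3\<rbrakk> \<Longrightarrow> \<not> sublist [s, t, s] (proj s t u) \<or>
      (\<exists>t'\<in>S. t' \<noteq> t \<and> m s t' \<noteq> 2 \<and> \<not> sublist [s, s] (proj s t' u)) \<or>
      (\<forall>v a b. comm u v \<longrightarrow> v \<noteq> a @ [s, t, s] @ b)"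
    and braid4: "\<And>s t. \<lbrakk>s \<in> S; t \<in> S; m s t = 4\<rbrakk> \<Longrightarrow>
      (\<exists>t'\<in>S. t' \<noteq> t \<and> m s t' \<noteq> 2 \<and> \<not> sublist [s, s] (proj s t' u)) \<or>
      (\<exists>s'\<in>S. s' \<noteq> s \<and> m t s' \<noteq> 2 \<and> \<not> sublist [t, t] (proj t s' u))"
  shows "fc_word u"
  unfolding fc_word_def
proof (intro conjI allI impI notI)
  show "u \<in> lists S" by fact
  fix v a b s t assume v: "comm u v"
  have vS: "v \<in> lists S" using comm_lists[OF v uS] .
  have factor: "sublist [x, x] (proj x y u)"
    if "v = p @ x # w @ x # q" "x \<in> S" "y \<in> S" "m x y \<noteq> 2" "x \<notin> set w" "y \<notin> set w" for p x w q y
  proof -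
    have "proj x y u = proj x y v" using that by (intro comm_proj[OF v])
    also have "\<dots> = proj x y p @ [x, x] @ proj x y q"
      using that by (simp add: proj_eq_Nil_iff[THEN iffD2])
    finally show ?thesis by (metis sublist_def)
  qed
  {
    assume eq: "v = a @ [s, s] @ b"
    then have "s \<in> S" using vS by simp
    then obtain t' where "t' \<in> S" "m s t' \<noteq> 2" "\<not> sublist [s, s] (proj s t' u)" using sq by blast
    then show False using factor[of a s "[]" b t'] eq \<open>s \<in> S\<close> by simp
  }
  {
    assume m: "m s t = 3" and eq: "v = a @ [s, t, s] @ b"
    then have S: "s \<in> S" "t \<in> S" "s \<noteq> t" using vS m_diag[of s] by auto
    have "proj s t u = proj s t v" using S m by (intro comm_proj[OF v]) auto
    then have "sublist [s, t, s] (proj s t u)" using eq by (auto simp: sublist_def)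
    then obtain t' where "t' \<in> S" "t' \<noteq> t" "m s t' \<noteq> 2" "\<not> sublist [s, s] (proj s t' u)"
      using braid3[OF S(1,2) m] v eq by blast
    then show False using factor[of a s "[t]" b t'] eq S by simp
  }
  {
    assume m: "m s t = 4" and eq: "v = a @ [s, t, s, t] @ b"
    then have S: "s \<in> S" "t \<in> S" "s \<noteq> t" using vS m_diag[of s] by auto
    from braid4[OF S(1,2) m] show False
    proof
      assume "\<exists>t'\<in>S. t' \<noteq> t \<and> m s t' \<noteq> 2 \<and> \<not> sublist [s, s] (proj s t' u)"
      then show False using factor[of a s "[t]" "t # b"] eq S by auto
    next
      assume "\<exists>s'\<in>S. s' \<noteq> s \<and> m t s' \<noteq> 2 \<and> \<not> sublist [t, t] (proj t s' u)"
      then show False using factor[of "a @ [s]" t "[s]" b] eq S by auto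
    qed
  }
qed

lemma fc_wordI:
  assumes uS: "u \<in> lists S"
    and sq: "\<And>s. s \<in> S \<Longrightarrow> \<exists>t\<in>S. m s t \<noteq> 2 \<and> \<not> sublist [s, s] (proj s t u)"
    and braid3: "\<And>s t. \<lbrakk>s \<in> S; t \<in> S; m s t = 3\<rbrakk> \<Longrightarrow> \<not> sublist [s, t, s] (proj s t u) \<or>
      (\<exists>t'\<in>S. t' \<noteq> t \<and> m s t' \<noteq> 2 \<and> \<not> sublist [s, s] (proj s t' u))"
    and braid4: "\<And>s t. \<lbrakk>s \<in> S; t \<in> S; m s t = 4\<rbrakk> \<Longrightarrow>
      (\<exists>t'\<in>S. t' \<noteq> t \<and> m s t' \<noteq> 2 \<and> \<not> sublist [s, s] (proj s t' u)) \<or>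
      (\<exists>s'\<in>S. s' \<noteq> s \<and> m t s' \<noteq> 2 \<and> \<not> sublist [t, t] (proj t s' u))"
  shows "fc_word u"
  using assms by (intro fc_wordI_general) blast+

lemma comm_rev_if_palindromes:
  assumes "u \<in> lists S"
    and "\<And>s t. s \<in> S \<Longrightarrow> t \<in> S \<Longrightarrow> m s t \<noteq> 2 \<Longrightarrow> s < t \<Longrightarrow> rev (proj s t u) = proj s t u"
  shows "comm u (rev u)"
proof (rule comm_if_proj_eq)
  fix s t assume st: "s \<in> S" "t \<in> S" "m s t \<noteq> 2"
  consider "s = t" | "s < t" | "t < s" by fastforce
  then show "proj s t u = proj s t (rev u)"
  proof cases
    case 1
    then show ?thesis by (simp add: proj_same)
  next
    case 2
    then show ?thesis using assms(2)[of s t] st by simp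
  next
    case 3
    then show ?thesis using assms(2)[of t s] st m_sym[of s t] by (simp add: proj_commute[of s])
  qed
qed (use assms in auto)

lemma palindrome_proj:
  "comm u (rev u) \<Longrightarrow> s \<in> S \<Longrightarrow> t \<in> S \<Longrightarrow> m s t \<noteq> 2 \<Longrightarrow> rev (proj s t u) = proj s t u"
  using comm_proj[of u "rev u" s t] by simp

end

section \<open>Alternating words over a path\<close>

lemma separatedI:
  assumes "\<And>a w b. u = a @ x # w @ x # b \<Longrightarrow> x \<notin> set w \<Longrightarrow> y \<in> set w"
  shows "separated y x u"
  unfolding separated_def
proof (intro allI impI)
  fix a w b assume u: "u = a @ x # w @ x # b"
  show "y \<in> set w"
  proof (cases "x \<in> set w")
    case True
    then obtain w1 w2 where "w = w1 @ x # w2" "x \<notin> set w1" by (meson split_list_first)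
    then show ?thesis using assms[of a w1 "w2 @ x # b"] u by auto
  qed (use assms u in blast)
qed

lemma separated_absent: "x \<notin> set u \<Longrightarrow> separated y x u"
  by (auto simp: separated_def)

text \<open>What \<open>fc_word_gap\<close> leaves for a node of a path whose bonds are labelled
  3.\<close>

definition crowded :: "nat \<Rightarrow> nat list \<Rightarrow> bool" where
  "crowded i u \<longleftrightarrow> (\<forall>a w b. u = a @ i # w @ i # b \<longrightarrow> i \<notin> set w \<longrightarrow>
     2 \<le> count_list w (i - 1) + count_list w (i + 1))"

text \<open>If no \<open>i + 2\<close> lay between two consecutive \<open>i + 1\<close>, two
  \<open>i\<close> would, and by induction an \<open>i + 1\<close> would lie between these. The
  induction starts with the absent generator 0.\<close>

lemma chain_left:
  assumes "0 \<notin> set u"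
    and gap: "\<And>i a w b. \<lbrakk>1 \<le> i; i \<le> k; u = a @ i # w @ i # b; i \<notin> set w; Suc i \<notin> set w\<rbrakk> \<Longrightarrow>
      2 \<le> count_list w (i - 1)"
  shows "i \<le> k \<Longrightarrow> separated (Suc i) i u"
proof (induction i)
  case 0
  then show ?case using assms(1) by (simp add: separated_absent)
next
  case (Suc i)
  show ?case
  proof (rule separatedI, rule ccontr)
    fix a w b
    assume u: "u = a @ Suc i # w @ Suc i # b" "Suc i \<notin> set w" "Suc (Suc i) \<notin> set w"
    then have "2 \<le> count_list w i" using gap[of "Suc i" a w b] Suc.prems by simp
    moreover have "count_list w i \<le> 1"
      using Suc u by (intro separated_count_le[of "Suc i" i u "a @ [Suc i]" w "Suc i # b"]) auto
    ultimately show False by simp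
  qed
qed

text \<open>Mirror image of \<open>chain_left\<close>. The right ends of the diagrams differ, so
  alternation at the starting edge is a hypothesis.\<close>

lemma chain_right:
  assumes "i \<le> k" "separated k (Suc k) u" "\<And>i. 1 \<le> i \<Longrightarrow> i \<le> k \<Longrightarrow> crowded i u"
  shows "separated i (Suc i) u"
  using assms(1)
proof (induction rule: inc_induct)
  case (step i)
  show ?case
  proof (rule separatedI, rule ccontr)
    fix a w b
    assume u: "u = a @ Suc i # w @ Suc i # b" "Suc i \<notin> set w" "i \<notin> set w"
    then have "2 \<le> count_list w (Suc (Suc i))"
      using assms(3)[of "Suc i"] step.hyps by (fastforce simp: crowded_def)
    moreover have "count_list w (Suc (Suc i)) \<le> 1"
      using step u
      by (intro separated_count_le[of "Suc i" "Suc (Suc i)" u "a @ [Suc i]" w "Suc i # b"]) auto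
    ultimately show False by simp
  qed
qed (rule assms(2))

text \<open>Entry 0 belongs to a phantom generator that never occurs. A flat step at height 0 means
  that two adjacent generators are both absent.\<close>

definition zwalks :: "nat \<Rightarrow> nat list set" where
  "zwalks n = {c. length c = Suc n \<and> c ! 0 = 0 \<and> (\<forall>i<n. zstep (c ! i) (c ! Suc i))}"

text \<open>Alternation at the edge from the phantom 0 to 1 says that the generator 1 occurs at most
  once.\<close>

definition alt_spec :: "nat \<Rightarrow> nat list \<Rightarrow> nat list \<Rightarrow> bool" where
  "alt_spec n c u \<longleftrightarrow> set u \<subseteq> {1..n} \<and> (\<forall>i\<le>n. count_list u i = c ! i) \<and>
     (\<forall>i<n. distinct_adj (proj i (Suc i) u))"

lemma alt_spec_proj_eq:
  assumes "alt_spec n c u" "alt_spec n c v" "i < n" "c \<in> zwalks n"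
  shows "proj i (Suc i) u = proj i (Suc i) v"
  using assms unfolding alt_spec_def zwalks_def
  by (intro alternating_eqI[of _ _ i "Suc i"]) (auto simp: count_proj)

lemma alt_spec_palindrome:
  assumes "alt_spec n c u" "i < n" "c \<in> zwalks n"
  shows "rev (proj i (Suc i) u) = proj i (Suc i) u"
  using assms unfolding alt_spec_def zwalks_def
  by (subst alternating_palindrome_iff[of _ i "Suc i"]) (auto simp: count_proj)

lemma alt_spec_length:
  assumes "alt_spec n c u" "length c = Suc n"
  shows "length u = sum_list c"
proof -
  have "length u = (\<Sum>i\<in>{0..<Suc n}. count_list u i)"
    using assms by (intro sum_count_set[symmetric]) (auto simp: alt_spec_def)
  also have "\<dots> = (\<Sum>i\<in>{0..<Suc n}. c ! i)"
    using assms by (intro sum.cong) (auto simp: alt_spec_def)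
  finally show ?thesis using assms by (simp add: sum_list_sum_nth)
qed

lemma alt_spec_counts:
  assumes "alt_spec n c u" "length c = Suc n"
  shows "c = map (count_list u) [0..<Suc n]"
  using assms by (intro nth_equalityI) (auto simp: alt_spec_def simp del: upt_Suc)

lemma alt_spec_of_word:
  assumes "set u \<subseteq> {1..n}"
    and "\<And>i. i < n \<Longrightarrow> separated i (Suc i) u \<and> separated (Suc i) i u"
    and "\<And>i. 0 < i \<Longrightarrow> i < n \<Longrightarrow> rev (proj i (Suc i) u) = proj i (Suc i) u"
  shows "map (count_list u) [0..<Suc n] \<in> zwalks n"
    and "alt_spec n (map (count_list u) [0..<Suc n]) u"
proof -
  define c where "c = map (count_list u) [0..<Suc n]"
  have alt: "distinct_adj (proj i (Suc i) u)" if "i < n" for i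
    using assms(2)[OF that] by (simp add: distinct_adj_proj_iff)
  have nth: "c ! i = count_list u i" if "i \<le> n" for i
    unfolding c_def using that
    by (metis add_0 le_imp_less_Suc length_upt minus_nat.diff_0 nth_map nth_upt)
  have spec: "alt_spec n c u"
    unfolding alt_spec_def using assms(1) alt nth by simp
  have pal: "rev (proj i (Suc i) u) = proj i (Suc i) u" if "i < n" for i
  proof (cases "i = 0")
    case True
    have "0 \<notin> set u" using assms(1) by auto
    then show ?thesis using True by (simp add: proj_commute[of 0] proj_absent)
  qed (use assms(3) that in auto)
  have "zstep (count_list u i) (count_list u (Suc i))" if "i < n" for i
    using pal[OF that] alt[OF that] alternating_palindrome_iff[of "proj i (Suc i) u" i "Suc i"]
    by (simp add: count_proj)
  moreover have "count_list u 0 = 0" using assms(1) by (auto simp: count_list_0_iff)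
  ultimately have walk: "c \<in> zwalks n" unfolding zwalks_def by (simp add: nth) (simp add: c_def)
  show "map (count_list u) [0..<Suc n] \<in> zwalks n" using walk unfolding c_def .
  show "alt_spec n (map (count_list u) [0..<Suc n]) u" using spec unfolding c_def .
qed

text \<open>The word grows by one generator at a time: a word over \<open>{..k}\<close> is merged
  with an alternating word in \<open>k\<close> and \<open>Suc k\<close> along the common letter
  \<open>k\<close>.\<close>

lemma alt_spec_exists:
  assumes "c \<in> zwalks n"
  shows "\<exists>u. alt_spec n c u"
proof -
  have "\<exists>u. alt_spec k c u" if "k \<le> n" for k
    using that
  proof (induction k)
    case 0
    then show ?case using assms by (intro exI[of _ "[]"]) (auto simp: alt_spec_def zwalks_def)
  next
    case (Suc k)
    then obtain u where u: "alt_spec k c u" by auto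
    have "zstep (c ! k) (c ! Suc k)" using assms Suc.prems by (auto simp: zwalks_def)
    then obtain v where v: "distinct_adj v" "set v \<subseteq> {k, Suc k}"
      "count_list v k = c ! k" "count_list v (Suc k) = c ! Suc k"
      using alternating_exists[of k "Suc k"] by fastforce
    have "filter (\<lambda>x. x = k) u = filter (\<lambda>x. x = k) v"
      using u v by (simp add: alt_spec_def proj_def[symmetric, of k k, simplified] proj_same)
    then obtain w where w: "filter (\<lambda>x. x \<in> {..k}) w = u" "filter (\<lambda>x. x \<in> {k, Suc k}) w = v"
      "set w \<subseteq> {..k} \<union> {k, Suc k}"
      using merge_exists[of k u v "{..k}" "{k, Suc k}"] u v by (fastforce simp: alt_spec_def)
    have proj_w: "proj i j w = proj i j u" if "i \<le> k" "j \<le> k" for i j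
      unfolding w(1)[symmetric] using that by (auto simp: proj_def intro!: filter_cong)
    have "proj k (Suc k) w = v" using w(2) by (simp add: proj_def)
    moreover have count: "count_list w i = count_list u i" if "i \<le> k" for i
      using proj_w[OF that that] count_proj[of i i i] by metis
    moreover have "count_list w (Suc k) = c ! Suc k"
      using v calculation(1) count_proj[of "Suc k" k "Suc k" w] by simp
    moreover have "set w \<subseteq> {1..Suc k}"
    proof
      fix x assume "x \<in> set w"
      then have "count_list w x \<noteq> 0" by (simp add: count_list_0_iff)
      moreover have "count_list w 0 = 0"
        using count[of 0] u assms by (auto simp: alt_spec_def zwalks_def)
      ultimately show "x \<in> {1..Suc k}" using w(3) \<open>x \<in> set w\<close> by (cases x) auto
    qed
    ultimately have "alt_spec (Suc k) c w"
      using u v proj_w unfolding alt_spec_def by (auto simp: less_Suc_eq le_Suc_eq)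
    then show ?case by blast
  qed
  then show ?thesis by blast
qed

lemma alternating_no_square:
  assumes "distinct_adj (proj x y u)"
  shows "\<not> sublist [z, z] (proj x y u)" "\<not> sublist [z, z] (proj y x u)"
  using assms by (auto simp: sublist_def distinct_adj_append_iff proj_commute[of y x])

lemma sublist_square_same: "sublist [x, x] (proj x x u) \<Longrightarrow> 2 \<le> count_list u x"
  by (auto simp: proj_same sublist_def dest!: arg_cong[where f = length])

text \<open>Alternation with \<open>s - 1\<close> prevents a square of \<open>s\<close>. The
  generator 1 has no lower neighbour but occurs at most once, hence the possibility that
  \<open>t\<close> is \<open>s\<close>.\<close>

lemma alt_spec_below:
  assumes "alt_spec n c u" "c \<in> zwalks n" "s \<in> {1..n}"
  shows "\<exists>t\<in>{1..s}. (Suc t = s \<or> t = s) \<and> \<not> sublist [s, s] (proj s t u)"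
proof (cases "s = 1")
  case True
  have "c ! 1 \<le> 1" using assms True by (auto simp: zwalks_def zstep_def)
  then have "count_list u 1 \<le> 1" using assms True by (auto simp: alt_spec_def)
  then show ?thesis using True sublist_square_same[of 1 u] by auto
next
  case False
  then have "distinct_adj (proj (s - 1) s u)"
    using assms by (auto simp: alt_spec_def dest!: spec[of _ "s - 1"])
  then have "\<not> sublist [s, s] (proj s (s - 1) u)" by (rule alternating_no_square(2))
  then show ?thesis using False assms by (intro bexI[of _ "s - 1"]) auto
qed

lemma alt_spec_above:
  assumes "alt_spec n c u" "s < n"
  shows "\<not> sublist [s, s] (proj s (Suc s) u)"
  using assms by (intro alternating_no_square(1)) (simp add: alt_spec_def)

lemma length_filter_two:
  "p \<noteq> q \<Longrightarrow> length (filter (\<lambda>x. x = p \<or> x = q) w) = count_list w p + count_list w q"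
  by (induction w) auto

section \<open>Type A\<close>

lemma matrix_A_simps:
  "matrix_A s t = 2 \<longleftrightarrow> t \<noteq> s \<and> t \<noteq> Suc s \<and> s \<noteq> Suc t"
  "matrix_A s t = 3 \<longleftrightarrow> t = Suc s \<or> s = Suc t"
  "matrix_A s t \<noteq> 4"
  by (auto simp: matrix_A_def)

lemma small_coxeter_A: "small_coxeter S matrix_A"
  by unfold_locales (auto simp: matrix_A_def)

text \<open>The diagram gets phantom nodes 0 and \<open>Suc k\<close> at its two ends, so the walks
  have length \<open>Suc k\<close> and return to 0.\<close>

lemma fc_inv_poly_A:
  "fc_inv_poly {1..k} matrix_A = (\<Sum>c | c \<in> zwalks (Suc k) \<and> c ! Suc k = 0. monom 1 (sum_list c))"
proof -
  interpret small_coxeter "{1..k}" matrix_A by (rule small_coxeter_A)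
  show ?thesis
  proof (rule fc_inv_poly_eq_sum[where Spec = "alt_spec (Suc k)"])
    fix c assume "c \<in> {c \<in> zwalks (Suc k). c ! Suc k = 0}"
    then show "\<exists>u. alt_spec (Suc k) c u" using alt_spec_exists by blast
  next
    fix c u assume c: "c \<in> {c \<in> zwalks (Suc k). c ! Suc k = 0}" and u: "alt_spec (Suc k) c u"
    have "Suc k \<notin> set u" using c u by (auto simp: alt_spec_def count_list_0_iff[symmetric])
    then have uS: "u \<in> lists {1..k}" using u by (fastforce simp: alt_spec_def le_Suc_eq)
    have below: "\<exists>t\<in>{1..k}. (Suc t = s \<or> t = s) \<and> \<not> sublist [s, s] (proj s t u)"
      if "s \<in> {1..k}" for s
      using alt_spec_below[OF u, of s] c that by fastforce
    \<comment> \<open>At the last generator the walk is one step away from its end at height 0, so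
      \<open>k\<close> occurs at most once.\<close>
    have above: "\<exists>t\<in>{1..k}. (t = Suc s \<or> t = s) \<and> \<not> sublist [s, s] (proj s t u)"
      if "s \<in> {1..k}" for s
    proof (cases "s = k")
      case True
      have "zstep (c ! k) (c ! Suc k)" using c by (auto simp: zwalks_def)
      then have "count_list u k \<le> 1" using c u by (auto simp: zstep_def alt_spec_def)
      then show ?thesis using True that sublist_square_same[of k u] by (intro bexI[of _ k]) auto
    next
      case False
      then show ?thesis using alt_spec_above[OF u, of s] that by (intro bexI[of _ "Suc s"]) auto
    qed
    have "fc_word u"
    proof (rule fc_wordI[OF uS])
      fix s assume "s \<in> {1..k}"
      then show "\<exists>t\<in>{1..k}. matrix_A s t \<noteq> 2 \<and> \<not> sublist [s, s] (proj s t u)"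
        using below[of s] by (fastforce simp: matrix_A_simps)
    next
      fix s t assume st: "s \<in> {1..k}" "t \<in> {1..k}" "matrix_A s t = 3"
      have "\<exists>t'\<in>{1..k}. t' \<noteq> t \<and> matrix_A s t' \<noteq> 2 \<and> \<not> sublist [s, s] (proj s t' u)"
      proof (cases "t = Suc s")
        case True
        obtain t' where "t' \<in> {1..k}" "Suc t' = s \<or> t' = s" "\<not> sublist [s, s] (proj s t' u)"
          using below[OF st(1)] by blast
        then show ?thesis using True by (intro bexI[of _ t']) (auto simp: matrix_A_simps)
      next
        case False
        then have "s = Suc t" using st by (simp add: matrix_A_simps)
        obtain t' where "t' \<in> {1..k}" "t' = Suc s \<or> t' = s" "\<not> sublist [s, s] (proj s t' u)"
          using above[OF st(1)] by blast
        then show ?thesis using \<open>s = Suc t\<close> by (intro bexI[of _ t']) (auto simp: matrix_A_simps)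
      qed
      then show "\<not> sublist [s, t, s] (proj s t u) \<or>
        (\<exists>t'\<in>{1..k}. t' \<noteq> t \<and> matrix_A s t' \<noteq> 2 \<and> \<not> sublist [s, s] (proj s t' u))" ..
    qed (simp add: matrix_A_simps)
    moreover have "comm u (rev u)"
    proof (rule comm_rev_if_palindromes[OF uS])
      fix s t assume "s \<in> {1..k}" "t \<in> {1..k}" "matrix_A s t \<noteq> 2" "s < t"
      then have "t = Suc s" "s < Suc k" by (auto simp: matrix_A_simps)
      then show "rev (proj s t u) = proj s t u" using alt_spec_palindrome[OF u, of s] c by simp
    qed
    ultimately show "fc_word u \<and> comm u (rev u) \<and> length u = sum_list c"
      using alt_spec_length[OF u] c by (simp add: zwalks_def)
  next
    fix c u v
    assume c: "c \<in> {c \<in> zwalks (Suc k). c ! Suc k = 0}"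
      and u: "alt_spec (Suc k) c u" and v: "alt_spec (Suc k) c v"
    have "w \<in> lists {1..k}" if "alt_spec (Suc k) c w" for w
    proof -
      have "Suc k \<notin> set w" using c that by (auto simp: alt_spec_def count_list_0_iff[symmetric])
      then show ?thesis using that by (fastforce simp: alt_spec_def le_Suc_eq)
    qed
    moreover have "proj s t u = proj s t v"
      if "s \<in> {1..k}" "t \<in> {1..k}" "matrix_A s t \<noteq> 2" for s t
    proof -
      have "t = s \<or> t = Suc s \<or> s = Suc t" using that by (auto simp: matrix_A_simps)
      then show ?thesis
        using alt_spec_proj_eq[OF u v, of s] alt_spec_proj_eq[OF u v, of t] c u v that
        by (auto simp: proj_same alt_spec_def proj_commute[of "Suc t"])
    qed
    ultimately show "comm u v" using u v by (intro comm_if_proj_eq) auto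
  next
    fix c d u v
    assume "c \<in> {c \<in> zwalks (Suc k). c ! Suc k = 0}" "d \<in> {c \<in> zwalks (Suc k). c ! Suc k = 0}"
      and "alt_spec (Suc k) c u" "alt_spec (Suc k) d v" "comm u v"
    then show "c = d"
      using alt_spec_counts[of "Suc k" c u] alt_spec_counts[of "Suc k" d v] comm_count[of u v]
      by (auto simp: zwalks_def)
  next
    fix u assume fc: "fc_word u" and self_dual: "comm u (rev u)"
    have set: "set u \<subseteq> {1..k}" using fc_wordD(1)[OF fc] by auto
    have crowded: "crowded i u" if "1 \<le> i" for i
      unfolding crowded_def
    proof (intro allI impI)
      fix a w b assume gap: "u = a @ i # w @ i # b" "i \<notin> set w"
      have "filter (\<lambda>x. matrix_A i x \<noteq> 2) w = filter (\<lambda>x. x = i - 1 \<or> x = i + 1) w"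
        using gap(2) that by (intro filter_cong) (auto simp: matrix_A_simps)
      moreover have "matrix_A i t \<noteq> 4" for t by (simp add: matrix_A_simps)
      ultimately show "2 \<le> count_list w (i - 1) + count_list w (i + 1)"
        using fc_word_gap[OF fc gap] by (simp add: length_filter_two)
    qed
    have left: "separated (Suc i) i u" if "i \<le> k" for i
      using that set
      by (intro chain_left[of u k])
        (use crowded in \<open>fastforce simp: crowded_def count_list_0_iff[THEN iffD2]\<close>)+
    have right: "separated i (Suc i) u" if "i \<le> k" for i
      using that set crowded by (intro chain_right[of i k]) (auto intro!: separated_absent)
    let ?c = "map (count_list u) [0..<Suc (Suc k)]"
    have pal: "rev (proj i (Suc i) u) = proj i (Suc i) u" if "0 < i" "i < Suc k" for i
    proof (cases "i = k")
      case True
      have "Suc k \<notin> set u" using set by auto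
      then show ?thesis using True by (simp add: proj_absent)
    qed (use palindrome_proj[OF self_dual, of i "Suc i"] that in \<open>auto simp: matrix_A_simps\<close>)
    have "?c \<in> zwalks (Suc k)" "alt_spec (Suc k) ?c u"
      using set left right pal by (intro alt_spec_of_word; fastforce)+
    moreover have "?c ! Suc k = 0"
      using set by (auto simp: nth_append count_list_0_iff)
    ultimately show "\<exists>c\<in>{c \<in> zwalks (Suc k). c ! Suc k = 0}. alt_spec (Suc k) c u" by blast
  qed
qed

section \<open>Zigzags\<close>

text \<open>
  A self-dual fully commutative word that is not alternating consists of an alternating word
  whose last letter \<open>p\<close> occurs once and is expanded into \<open>p, p + 1, \<dots>, N, \<dots>, N, \<dots>, p + 1, p\<close>,
  with the end of the diagram in the middle.
\<close>

definition zig_spec :: "nat \<Rightarrow> nat \<Rightarrow> nat list \<Rightarrow> nat list \<Rightarrow> bool" where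
  "zig_spec N p c u \<longleftrightarrow> (\<forall>i<p. count_list u i = c ! i) \<and>
     (\<forall>i. Suc i < p \<longrightarrow> distinct_adj (proj i (Suc i) u)) \<and>
     proj (p - 1) p u = (if c ! (p - 1) = 0 then [p, p] else [p - 1, p, p, p - 1]) \<and>
     (\<forall>i. p \<le> i \<longrightarrow> i < N \<longrightarrow> proj i (Suc i) u = [i, Suc i, Suc i, i])"

lemma not_separatedE:
  assumes "\<not> separated y x u"
  obtains a w b where "u = a @ x # w @ x # b" "x \<notin> set w" "y \<notin> set w"
  using assms separatedI[of u x y] by blast

lemma crowdedD:
  "crowded i (a @ i # w @ i # b) \<Longrightarrow> i \<notin> set w \<Longrightarrow> 2 \<le> count_list w (i - 1) + count_list w (i + 1)"
  by (auto simp: crowded_def)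

lemma zstep_of_proj:
  assumes "separated i (Suc i) u" "separated (Suc i) i u" "rev (proj i (Suc i) u) = proj i (Suc i) u"
  shows "zstep (count_list u i) (count_list u (Suc i))"
  using assms alternating_palindrome_iff[of "proj i (Suc i) u" i "Suc i"]
  by (simp add: distinct_adj_proj_iff count_proj)

text \<open>The turning point is the lower end of the maximal run of letters up to \<open>N\<close>
  that are not separated by their lower neighbour. Along the run each letter occurs exactly twice;
  below it the word alternates.\<close>

lemma zig_spec_of_word:
  assumes u0: "0 \<notin> set u" and N: "1 \<le> N" and cN: "count_list u N = 2"
    and turn: "\<not> separated (N - 1) N u"
    and crowded: "\<And>i. 1 \<le> i \<Longrightarrow> i < N \<Longrightarrow> crowded i u"
    and left: "\<And>i. i < N \<Longrightarrow> separated (Suc i) i u"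
    and pal: "\<And>i. 1 \<le> i \<Longrightarrow> i < N \<Longrightarrow> rev (proj i (Suc i) u) = proj i (Suc i) u"
  shows "\<exists>p\<in>{1..N}. \<exists>c\<in>zwalks p. c ! p = 1 \<and> zig_spec N p c u"
proof -
  define Q where "Q p \<longleftrightarrow> 1 \<le> p \<and> (\<forall>i. p \<le> i \<and> i \<le> N \<longrightarrow> \<not> separated (i - 1) i u)" for p
  have "Q N" using N turn by (auto simp: Q_def)
  define p where "p = (LEAST p. Q p)"
  have Qp: "Q p" and pN: "p \<le> N" and least: "\<And>q. q < p \<Longrightarrow> \<not> Q q"
    unfolding p_def using \<open>Q N\<close> by (auto intro: LeastI Least_le dest: not_less_Least)
  have p1: "1 \<le> p" and turns: "\<And>i. p \<le> i \<Longrightarrow> i \<le> N \<Longrightarrow> \<not> separated (i - 1) i u"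
    using Qp by (auto simp: Q_def)
  \<comment> \<open>No \<open>i - 1\<close> lies between two consecutive \<open>i\<close>, so two
    \<open>Suc i\<close> do. These are all occurrences of \<open>Suc i\<close>, and since
    \<open>Suc i\<close> separates the \<open>i\<close>, there is no further \<open>i\<close>
    outside.\<close>
  have turn_step: "count_list u i = 2 \<and> proj i (Suc i) u = [i, Suc i, Suc i, i]"
    if i: "p \<le> i" "i < N" and c: "count_list u (Suc i) = 2" for i
  proof -
    obtain a w b where u: "u = a @ i # w @ i # b" "i \<notin> set w" "i - 1 \<notin> set w"
      using turns[of i] i by (auto elim: not_separatedE)
    have "2 \<le> count_list w (Suc i)"
      using crowdedD[of i a w b] crowded[of i] i p1 u count_list_0_iff[of w "i - 1"] by simp
    then have w: "count_list w (Suc i) = 2" and ab: "Suc i \<notin> set a" "Suc i \<notin> set b"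
      using c u count_list_0_iff[of a "Suc i"] count_list_0_iff[of b "Suc i"] by auto
    have "count_list (a @ [i]) i \<le> 1" "count_list (i # b) i \<le> 1"
      using separated_count_le[OF left[OF i(2)], of "[]" "a @ [i]" "w @ i # b"]
        separated_count_le[OF left[OF i(2)], of "a @ i # w" "i # b" "[]"] u ab by auto
    then have "i \<notin> set a" "i \<notin> set b" by (auto simp: count_list_0_iff[symmetric])
    then show ?thesis
      using u ab w proj_absent[of i w "Suc i"]
      by (auto simp: proj_eq_Nil_iff[THEN iffD2] proj_commute[of i] count_list_0_iff[THEN iffD2]
          numeral_2_eq_2)
  qed
  have count2: "count_list u i = 2" if "p \<le> i" "i \<le> N" for i
    using that(2,1)
  proof (induction rule: inc_induct)
    case (step i)
    then show ?case using turn_step[of i] by simp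
  qed (rule cN)
  obtain a w b where u: "u = a @ p # w @ p # b" "p \<notin> set w" "p - 1 \<notin> set w"
    using turns[of p] pN by (auto elim: not_separatedE)
  have "count_list u p = count_list a p + count_list b p + 2"
    using u(1,2) by (simp add: count_list_0_iff[THEN iffD2])
  then have ab: "p \<notin> set a" "p \<notin> set b"
    using count2[of p] pN by (simp_all add: count_list_0_iff[symmetric])
  have "separated p (p - 1) u" using left[of "p - 1"] pN p1 by auto
  then have le: "count_list a (p - 1) \<le> 1" "count_list b (p - 1) \<le> 1"
    using separated_count_le[of p "p - 1" u "[]" a "p # w @ p # b"]
      separated_count_le[of p "p - 1" u "a @ p # w @ [p]" b "[]"] u ab by auto
  have proj_p: "proj (p - 1) p u =
      replicate (count_list a (p - 1)) (p - 1) @ [p, p] @ replicate (count_list b (p - 1)) (p - 1)"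
    using u ab by (simp add: proj_absent proj_eq_Nil_iff[THEN iffD2])
  have rev_p: "rev (proj (p - 1) p u) = proj (p - 1) p u"
  proof (cases "p = 1")
    case True
    have "0 \<notin> set a" "0 \<notin> set b" using u0 u by auto
    then show ?thesis using proj_p True by (simp add: count_list_0_iff[THEN iffD2])
  qed (use pal[of "p - 1"] p1 pN in auto)
  have "count_list u (p - 1) = count_list a (p - 1) + count_list b (p - 1)"
    using u p1 count_list_0_iff[of w "p - 1"] by auto
  \<comment> \<open>By symmetry \<open>p - 1\<close> occurs on both sides of the two
    \<open>p\<close> or on neither.\<close>
  then have p_cases: "count_list u (p - 1) = 0 \<and> proj (p - 1) p u = [p, p] \<or>
      count_list u (p - 1) = 2 \<and> proj (p - 1) p u = [p - 1, p, p, p - 1]"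
    using rev_p le p1 unfolding proj_p
    by (cases "count_list a (p - 1)"; cases "count_list b (p - 1)") auto
  have right: "separated i (Suc i) u" if i: "Suc i < p" for i
  proof -
    \<comment> \<open>By minimality the run does not extend to \<open>p - 1\<close>, so
      \<open>p - 1\<close> is separated by \<open>p - 2\<close>, and \<open>chain_right\<close>
      starts there.\<close>
    have "\<not> Q (p - 1)" using least p1 by simp
    then obtain j where j: "p - 1 \<le> j" "j \<le> N" "separated (j - 1) j u"
      using i by (auto simp: Q_def)
    then have "j = p - 1" using turns[of j] by (cases "p \<le> j") auto
    then have "separated (p - 2) (Suc (p - 2)) u"
      using j(3) i by (simp add: numeral_2_eq_2 Suc_diff_Suc)
    then show ?thesis
      using i pN by (intro chain_right[of i "p - 2"] crowded) auto
  qed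
  have zs: "zstep (count_list u i) (count_list u (Suc i))" if "Suc i < p" for i
  proof (rule zstep_of_proj[OF right[OF that] left])
    show "i < N" using that pN by simp
    show "rev (proj i (Suc i) u) = proj i (Suc i) u"
      using u0 pal[of i] that pN by (cases "i = 0") (auto simp: proj_commute[of 0] proj_absent)
  qed
  \<comment> \<open>The doubled letter \<open>p\<close> is recorded with height 1, a legal step from
    0 or 2 occurrences of \<open>p - 1\<close>.\<close>
  define c where "c = map (count_list u) [0..<p] @ [1]"
  have c_nth: "c ! i = count_list u i" if "i < p" for i
    using that by (simp add: c_def nth_append)
  have "c ! p = 1" by (simp add: c_def nth_append)
  moreover have "c \<in> zwalks p"
    unfolding zwalks_def
  proof (intro CollectI conjI allI impI)
    show "length c = Suc p" by (simp add: c_def)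
    show "c ! 0 = 0" using c_nth[of 0] p1 u0 by (simp add: count_list_0_iff)
    fix i assume "i < p"
    then consider "Suc i < p" | "i = p - 1" "Suc i = p" by linarith
    then show "zstep (c ! i) (c ! Suc i)"
    proof cases
      case 2
      then show ?thesis
        using c_nth[OF \<open>i < p\<close>] \<open>c ! p = 1\<close> p_cases by (auto simp: zstep_def)
    qed (use zs c_nth in auto)
  qed
  moreover have "zig_spec N p c u"
    unfolding zig_spec_def
  proof (intro conjI allI impI)
    fix i assume "Suc i < p"
    then show "distinct_adj (proj i (Suc i) u)"
      using right left[of i] pN by (simp add: distinct_adj_proj_iff)
  next
    show "proj (p - 1) p u = (if c ! (p - 1) = 0 then [p, p] else [p - 1, p, p, p - 1])"
      using p_cases c_nth[of "p - 1"] p1 by auto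
  next
    fix i assume "p \<le> i" "i < N"
    then show "proj i (Suc i) u = [i, Suc i, Suc i, i]" using turn_step count2[of "Suc i"] by simp
  qed (simp add: c_nth)
  ultimately show ?thesis using p1 pN by auto
qed

lemma zig_spec_no_square:
  assumes "zig_spec N p c u" "1 \<le> s" "s < N"
  shows "\<not> sublist [s, s] (proj s (Suc s) u)"
proof -
  consider "Suc s < p" | "Suc s = p" | "p \<le> s" by linarith
  then show ?thesis
  proof cases
    case 1
    then show ?thesis using assms by (intro alternating_no_square) (auto simp: zig_spec_def)
  next
    case 2
    then have "proj s (Suc s) u = [p, p] \<or> proj s (Suc s) u = [p - 1, p, p, p - 1]"
      using assms unfolding zig_spec_def by (metis diff_Suc_1)
    then show ?thesis using 2 by (auto simp: sublist_Cons_right)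
  next
    case 3
    then show ?thesis using assms by (auto simp: zig_spec_def sublist_Cons_right)
  qed
qed

lemma zig_spec_no_braid:
  assumes "zig_spec N p c u" "p \<le> s" "s < N"
  shows "\<not> sublist [s, Suc s, s] (proj s (Suc s) u)"
  using assms by (auto simp: zig_spec_def sublist_Cons_right)

lemma zig_spec_below:
  assumes "zig_spec N p c u" "c \<in> zwalks p" "1 \<le> s" "s < p"
  shows "\<exists>t\<in>{1..s}. (Suc t = s \<or> t = s) \<and> \<not> sublist [s, s] (proj s t u)"
proof (cases "s = 1")
  case True
  have "count_list u 1 \<le> 1"
    using assms True by (auto simp: zwalks_def zstep_def zig_spec_def dest!: spec[of _ 0])
  then show ?thesis using True sublist_square_same[of 1 u] by auto
next
  case False
  then have "distinct_adj (proj (s - 1) s u)"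
    using assms by (auto simp: zig_spec_def dest!: spec[of _ "s - 1"])
  then have "\<not> sublist [s, s] (proj s (s - 1) u)" by (rule alternating_no_square(2))
  then show ?thesis using False assms by (intro bexI[of _ "s - 1"]) auto
qed

lemma zig_spec_proj_eq:
  assumes u: "zig_spec N p c u" and v: "zig_spec N p c v" and c: "c \<in> zwalks p" and i: "i < N"
  shows "proj i (Suc i) u = proj i (Suc i) v"
proof -
  consider "Suc i < p" | "Suc i = p" | "p \<le> i" by linarith
  then show ?thesis
  proof cases
    case 1
    then show ?thesis
      using u v c unfolding zig_spec_def zwalks_def
      by (intro alternating_eqI[of _ _ i "Suc i"]) (auto simp: count_proj)
  next
    case 2
    then show ?thesis using u v unfolding zig_spec_def by (metis diff_Suc_1)
  next
    case 3
    then show ?thesis using u v i by (simp add: zig_spec_def)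
  qed
qed

lemma zig_spec_palindrome:
  assumes u: "zig_spec N p c u" and c: "c \<in> zwalks p" and i: "i < N"
  shows "rev (proj i (Suc i) u) = proj i (Suc i) u"
proof -
  consider "Suc i < p" | "Suc i = p" | "p \<le> i" by linarith
  then show ?thesis
  proof cases
    case 1
    then show ?thesis
      using u c unfolding zig_spec_def zwalks_def
      by (subst alternating_palindrome_iff[of _ i "Suc i"]) (auto simp: count_proj)
  next
    case 2
    then have "proj i (Suc i) u = [p, p] \<or> proj i (Suc i) u = [p - 1, p, p, p - 1]"
      using u unfolding zig_spec_def by (metis diff_Suc_1)
    then show ?thesis by auto
  next
    case 3
    then show ?thesis using u i by (simp add: zig_spec_def)
  qed
qed

text \<open>This square distinguishes zigzags from alternating words, and zigzags with different
  turning points from one another.\<close>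

lemma zig_spec_square: "zig_spec N p c u \<Longrightarrow> sublist [p, p] (proj (p - 1) p u)"
  by (auto simp: zig_spec_def sublist_Cons_right)

lemma proj_upt:
  assumes "p \<le> i" "Suc i < n"
  shows "proj i (Suc i) [p..<n] = [i, Suc i]"
proof -
  have "[p..<n] = [p..<i] @ i # Suc i # [Suc (Suc i)..<n]"
    using assms upt_add_eq_append[of p i "n - i"] upt_conv_Cons[of i n] upt_conv_Cons[of "Suc i" n]
    by simp
  then show ?thesis by (simp add: proj_eq_Nil_iff[THEN iffD2])
qed

text \<open>Alternation allows at most one \<open>p - 1\<close> on each side of the only
  \<open>p\<close>, and a step to height 1 starts from 0 or 2, so the two sides agree.\<close>

lemma alt_spec_split_last:
  assumes "alt_spec p c u" "c ! p = 1" "c \<in> zwalks p" "1 \<le> p"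
  obtains a b where "u = a @ p # b" "set a \<subseteq> {1..<p}" "set b \<subseteq> {1..<p}"
    "proj (p - 1) p a = proj (p - 1) p b"
    "proj (p - 1) p a = (if c ! (p - 1) = 0 then [] else [p - 1])"
proof -
  have count: "count_list u p = Suc 0" using assms by (simp add: alt_spec_def)
  then obtain a b where u: "u = a @ p # b" "p \<notin> set a" "count_list b p = 0"
    by (meson count_list_Suc_split_first)
  have ab: "p \<notin> set b" using u by (simp add: count_list_0_iff)
  have p: "p - 1 < p" "Suc (p - 1) = p" using assms(4) by auto
  have "set a \<union> set b \<subseteq> {1..p} - {p}" using assms(1) u(1,2) ab unfolding alt_spec_def by auto
  also have "\<dots> = {1..<p}" by auto
  finally have sub: "set a \<subseteq> {1..<p}" "set b \<subseteq> {1..<p}" by auto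
  have dist: "distinct_adj (proj (p - 1) p u)"
    using assms(1) p unfolding alt_spec_def by metis
  have proj_u: "proj (p - 1) p u =
      replicate (count_list a (p - 1)) (p - 1) @ [p] @ replicate (count_list b (p - 1)) (p - 1)"
    using u ab by (simp add: proj_absent)
  have "count_list a (p - 1) \<le> 1" "count_list b (p - 1) \<le> 1"
  proof -
    have *: "k \<le> 1" if "distinct_adj (replicate k (p - 1))" for k
    proof (rule ccontr)
      assume "\<not> k \<le> 1"
      then obtain j where "k = Suc (Suc j)" by (metis One_nat_def Suc_le_mono le0 not0_implies_Suc)
      then show False using that by simp
    qed
    show "count_list a (p - 1) \<le> 1" "count_list b (p - 1) \<le> 1"
      using dist unfolding proj_u distinct_adj_append_iff by (blast intro: *)+
  qed
  moreover have "c ! (p - 1) = count_list a (p - 1) + count_list b (p - 1)"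
  proof -
    have "c ! (p - 1) = count_list u (p - 1)"
      using assms(1) p unfolding alt_spec_def by (metis less_imp_le)
    then show ?thesis using u(1) p by simp
  qed
  moreover have "zstep (c ! (p - 1)) 1"
    using assms(2,3) p unfolding zwalks_def by (metis (mono_tags, lifting) mem_Collect_eq)
  ultimately have "proj (p - 1) p a = proj (p - 1) p b"
    "proj (p - 1) p a = (if c ! (p - 1) = 0 then [] else [p - 1])"
    using u ab by (auto simp: proj_absent zstep_def le_Suc_eq)
  then show thesis using that u sub by blast
qed

text \<open>The single \<open>p\<close> is replaced by a run up to \<open>n - 1\<close>, the letters
  \<open>X\<close> and the run back. Here \<open>X\<close> is the end of the diagram,
  \<open>[n]\<close> in type B and \<open>[n, Suc n]\<close> in type D.\<close>

lemma zig_spec_expand: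
  assumes u0: "alt_spec p c (a @ p # b)" and c: "c \<in> zwalks p"
    and ab: "set a \<subseteq> {1..<p}" "set b \<subseteq> {1..<p}" "proj (p - 1) p a = proj (p - 1) p b"
    "proj (p - 1) p a = (if c ! (p - 1) = 0 then [] else [p - 1])"
    and p: "1 \<le> p" "p < n" and X: "set X \<inter> {..<n} = {}"
  shows "zig_spec (n - 1) p c (a @ ([p..<n] @ X @ rev [p..<n]) @ b)" (is "zig_spec _ _ _ ?u")
  unfolding zig_spec_def
proof (intro conjI allI impI)
  fix i assume i: "i < p"
  then have "i \<notin> set X" using X p by auto
  then have "count_list ?u i = count_list (a @ p # b) i"
    using i by (simp add: count_list_0_iff[THEN iffD2])
  also have "\<dots> = c ! i" using u0 i unfolding alt_spec_def by (meson less_imp_le)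
  finally show "count_list ?u i = c ! i" .
next
  fix i assume i: "Suc i < p"
  then have "i \<notin> set X" "Suc i \<notin> set X" using X p by auto
  then have "proj i (Suc i) ?u = proj i (Suc i) (a @ p # b)"
    using i by (simp add: proj_eq_Nil_iff[THEN iffD2])
  moreover have "distinct_adj (proj i (Suc i) (a @ p # b))"
    using u0 i unfolding alt_spec_def by (meson Suc_lessD)
  ultimately show "distinct_adj (proj i (Suc i) ?u)" by (simp only:)
next
  have "p \<notin> set X" "p - 1 \<notin> set X" using X p by auto
  moreover have "proj (p - 1) p [p..<n] = [p]"
    using p by (subst upt_conv_Cons) (auto simp: proj_eq_Nil_iff)
  ultimately show "proj (p - 1) p ?u = (if c ! (p - 1) = 0 then [p, p] else [p - 1, p, p, p - 1])"
    using ab by (simp add: proj_eq_Nil_iff[THEN iffD2])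
next
  fix i assume i: "p \<le> i" "i < n - 1"
  then have "i \<notin> set X" "Suc i \<notin> set X" using X p by auto
  moreover have "i \<notin> set a" "Suc i \<notin> set a" "i \<notin> set b" "Suc i \<notin> set b" using ab i by auto
  ultimately show "proj i (Suc i) ?u = [i, Suc i, Suc i, i]"
    using proj_upt[of p i n] i by (simp add: proj_eq_Nil_iff[THEN iffD2])
qed

section \<open>Type B\<close>

lemma separated_betweenD: "separated y x u \<Longrightarrow> u = a @ x # w @ x # b \<Longrightarrow> y \<in> set w"
  by (auto simp: separated_def)

lemma small_coxeter_B: "small_coxeter S (matrix_B n)"
  by unfold_locales (auto simp: matrix_B_def)

lemma matrix_B_simps:
  assumes "s \<in> {1..n}" "t \<in> {1..n}"
  shows "matrix_B n s t = 2 \<longleftrightarrow> t \<noteq> s \<and> t \<noteq> Suc s \<and> s \<noteq> Suc t"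
    and "matrix_B n s t = 3 \<longleftrightarrow> t = Suc s \<and> t < n \<or> s = Suc t \<and> s < n"
    and "matrix_B n s t = 4 \<longleftrightarrow> t = Suc s \<and> t = n \<or> s = Suc t \<and> s = n"
  using assms by (auto simp: matrix_B_def)

lemma finite_zwalks: "finite (zwalks n)"
proof -
  have bound: "c ! i \<le> i" if "c \<in> zwalks n" "i \<le> n" for c i
    using that(2)
  proof (induction i)
    case (Suc i)
    then have "zstep (c ! i) (c ! Suc i)" using that(1) by (simp add: zwalks_def)
    then show ?case using Suc by (auto simp: zstep_def)
  qed (use that(1) in \<open>simp add: zwalks_def\<close>)
  have "zwalks n \<subseteq> {c. set c \<subseteq> {..n} \<and> length c = Suc n}"
  proof (intro subsetI CollectI conjI)
    fix c x assume c: "c \<in> zwalks n" and "x \<in> set c"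
    then obtain i where "i < length c" "x = c ! i" by (auto simp: in_set_conv_nth)
    then show "x \<in> {..n}" using bound[OF c, of i] c by (auto simp: zwalks_def)
  qed (simp add: zwalks_def)
  then show ?thesis by (rule finite_subset) (rule finite_lists_length_eq, simp)
qed

lemma sum_short_zwalks:
  assumes "finite P"
  shows "(\<Sum>c\<in>(\<Union>p\<in>P. {c \<in> zwalks p. c ! p = 1}). f (length c - 1) c) =
    (\<Sum>p\<in>P. \<Sum>c | c \<in> zwalks p \<and> c ! p = 1. f p c)"
proof -
  have "(\<Sum>c\<in>(\<Union>p\<in>P. {c \<in> zwalks p. c ! p = 1}). f (length c - 1) c) =
      (\<Sum>p\<in>P. \<Sum>c\<in>{c \<in> zwalks p. c ! p = 1}. f (length c - 1) c)"
  proof (intro sum.UNION_disjoint ballI impI assms)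
    show "finite {c \<in> zwalks p. c ! p = 1}" for p using finite_zwalks by simp
  qed (auto simp: zwalks_def)
  also have "\<dots> = (\<Sum>p\<in>P. \<Sum>c | c \<in> zwalks p \<and> c ! p = 1. f p c)"
    by (intro sum.cong) (auto simp: zwalks_def)
  finally show ?thesis .
qed

text \<open>The two \<open>N\<close> around \<open>w\<close> can be moved next to the only
  \<open>Suc N\<close> inside \<open>w\<close>. A later \<open>Suc N\<close> could then be moved up
  to them, completing the braid of length 4.\<close>

lemma no_end_letter_after_turn:
  assumes fc: "small_coxeter.fc_word {1..Suc N} (matrix_B (Suc N)) u"
    and left: "separated (Suc N) N u" and last: "separated N (Suc N) u"
    and N: "1 \<le> N"
    and u: "u = a @ N # w @ N # b" "N \<notin> set w" "N - 1 \<notin> set w"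
  shows "Suc N \<notin> set b"
proof
  interpret small_coxeter "{1..Suc N}" "matrix_B (Suc N)" by (rule small_coxeter_B)
  let ?n = "Suc N"
  assume "?n \<in> set b"
  then obtain b1 b2 where b: "b = b1 @ ?n # b2" "?n \<notin> set b1" by (meson split_list_first)
  have "?n \<in> set w" by (rule separated_betweenD[OF left u(1)])
  then obtain w1 w2 where w: "w = w1 @ ?n # w2" "?n \<notin> set w1" by (meson split_list_first)
  have w2: "?n \<notin> set w2"
  proof
    assume "?n \<in> set w2"
    then obtain x y where "w2 = x @ ?n # y" by (meson split_list)
    then have "u = (a @ N # w1) @ ?n # x @ ?n # (y @ N # b)" using u w by simp
    then have "N \<in> set x" by (rule separated_betweenD[OF last])
    then show False using u w \<open>w2 = _\<close> by auto
  qed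
  have b1: "N \<notin> set b1"
  proof
    assume "N \<in> set b1"
    then obtain x y where xy: "b1 = x @ N # y" by (meson split_list)
    then have "u = (a @ N # w) @ N # x @ N # (y @ ?n # b2)" using u b by simp
    then have "?n \<in> set x" by (rule separated_betweenD[OF left])
    then show False using b xy by auto
  qed
  have S: "set u \<subseteq> {1..?n}" using fc_wordD(1)[OF fc] by auto
  have S': "set w1 \<subseteq> {1..?n}" "set w2 \<subseteq> {1..?n}" "set b1 \<subseteq> {1..?n}"
    using S u(1) w(1) b(1) by auto
  have N_comm: "matrix_B ?n N t = 2" if "t \<in> set w1 \<union> set w2" for t
  proof -
    have "t \<noteq> N" "t \<noteq> Suc N" "N \<noteq> Suc t" "t \<in> {1..?n}" using that u(2,3) w w2 S' by auto
    then show ?thesis using N by (subst matrix_B_simps) auto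
  qed
  have n_comm: "matrix_B ?n ?n t = 2" if "t \<in> set w2 \<union> set b1" for t
  proof -
    have "t \<noteq> N" "t \<noteq> Suc N" "t \<in> {1..?n}" using that u(2) w w2 b b1 S' by auto
    then show ?thesis using N by (subst matrix_B_simps) auto
  qed
  have "comm (N # w1) (w1 @ [N])" using N S' N_comm by (intro comm_move_right) auto
  moreover have "comm (w2 @ [N]) (N # w2)"
    using N S' N_comm by (intro comm_sym[OF comm_move_right]) auto
  ultimately have "comm (a @ (N # w1) @ [?n] @ (w2 @ [N]) @ b1 @ [?n] @ b2)
      (a @ (w1 @ [N]) @ [?n] @ (N # w2) @ b1 @ [?n] @ b2)"
    by (intro comm_cong) auto
  moreover have "comm ((w2 @ b1) @ [?n]) (?n # w2 @ b1)"
    using S' n_comm by (intro comm_sym[OF comm_move_right]) auto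
  then have "comm ((a @ w1 @ [N, ?n, N]) @ ((w2 @ b1) @ [?n]) @ b2)
      ((a @ w1 @ [N, ?n, N]) @ (?n # w2 @ b1) @ b2)"
    by (intro comm_cong) auto
  ultimately have "comm u ((a @ w1) @ [N, ?n, N, ?n] @ (w2 @ b1 @ b2))"
    using u w b by (auto intro: rtranclp_trans)
  moreover have "matrix_B ?n N ?n = 4" by (simp add: matrix_B_def)
  ultimately show False using fc_wordD(4)[OF fc] by blast
qed

section \<open>Encoding of the fully commutative involutions of type B\<close>

definition B_spec :: "nat \<Rightarrow> nat list + nat list \<Rightarrow> nat list \<Rightarrow> bool" where
  "B_spec n d u \<longleftrightarrow> set u \<subseteq> {1..n} \<and> (case d of
     Inl c \<Rightarrow> alt_spec n c u
   | Inr c \<Rightarrow> zig_spec (n - 1) (length c - 1) c u \<and> proj (n - 1) n u = [n - 1, n, n - 1])"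

text \<open>The turning point \<open>n\<close> is left out: the expansion of a single
  \<open>n\<close> is \<open>n\<close> itself, so the word is already an alternating one.\<close>

definition B_data :: "nat \<Rightarrow> (nat list + nat list) set" where
  "B_data n = Inl ` zwalks n \<union> Inr ` (\<Union>p\<in>{1..<n}. {c \<in> zwalks p. c ! p = 1})"

text \<open>The letter \<open>p\<close> of the alternating word is replaced by p, ..., n, ..., p,
  which has 2 (n - p) letters more.\<close>

definition B_weight :: "nat \<Rightarrow> nat list + nat list \<Rightarrow> nat" where
  "B_weight n d = (case d of Inl c \<Rightarrow> sum_list c
    | Inr c \<Rightarrow> sum_list c + 2 * (n - (length c - 1)))"

lemma B_data_cases:
  assumes "d \<in> B_data n"
  obtains (alt) c where "d = Inl c" "c \<in> zwalks n"
    | (zig) p c where "d = Inr c" "1 \<le> p" "p < n" "c \<in> zwalks p" "c ! p = 1" "length c - 1 = p"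
  using assms by (auto simp: B_data_def zwalks_def)

lemma B_spec_exists:
  assumes "d \<in> B_data n"
  shows "\<exists>u. B_spec n d u \<and> length u = B_weight n d"
  using assms
proof (cases rule: B_data_cases)
  case (alt c)
  then obtain u where u: "alt_spec n c u" using alt_spec_exists by blast
  moreover have "length u = sum_list c"
    using alt_spec_length[OF u] alt by (simp add: zwalks_def)
  moreover have "set u \<subseteq> {1..n}" using u by (simp add: alt_spec_def)
  ultimately show ?thesis using alt by (auto simp: B_spec_def B_weight_def)
next
  case (zig p c)
  then obtain u0 where u0: "alt_spec p c u0" using alt_spec_exists by blast
  then obtain a b where ab: "u0 = a @ p # b" "set a \<subseteq> {1..<p}" "set b \<subseteq> {1..<p}"
    "proj (p - 1) p a = proj (p - 1) p b"
    "proj (p - 1) p a = (if c ! (p - 1) = 0 then [] else [p - 1])"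
    using alt_spec_split_last zig by metis
  let ?u = "a @ ([p..<n] @ [n] @ rev [p..<n]) @ b"
  have "zig_spec (n - 1) p c ?u"
    using u0 ab zig by (intro zig_spec_expand) auto
  moreover have "proj (n - 1) n ?u = [n - 1, n, n - 1]"
  proof -
    have "proj (n - 1) n [p..<n] = [n - 1]"
      using zig upt_Suc_append[of p "n - 1"] by (simp add: proj_eq_Nil_iff[THEN iffD2])
    moreover have "proj (n - 1) n a = []" "proj (n - 1) n b = []"
      using ab(2,3) zig(3) by (force simp: proj_eq_Nil_iff)+
    ultimately show ?thesis by simp
  qed
  moreover have "set ?u \<subseteq> {1..n}" using ab zig by auto
  moreover have "length ?u = sum_list c + 2 * (n - p)"
    using alt_spec_length[OF u0] ab zig by (simp add: zwalks_def)
  ultimately show ?thesis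
    using zig by (intro exI[of _ ?u]) (auto simp: B_spec_def B_weight_def)
qed

lemma B_spec_proj_eq:
  assumes d: "d \<in> B_data n" and u: "B_spec n d u" and v: "B_spec n d v" and i: "1 \<le> i" "i < n"
  shows "proj i (Suc i) u = proj i (Suc i) v"
  using d
proof (cases rule: B_data_cases)
  case (alt c)
  then show ?thesis using u v i alt_spec_proj_eq[of n c u v i] by (simp add: B_spec_def)
next
  case (zig p c)
  show ?thesis
  proof (cases "Suc i = n")
    case True
    then show ?thesis using u v zig by (auto simp: B_spec_def)
  next
    case False
    then show ?thesis
      using u v zig i zig_spec_proj_eq[of "n - 1" p c u v i] by (simp add: B_spec_def)
  qed
qed

lemma B_spec_palindrome:
  assumes d: "d \<in> B_data n" and u: "B_spec n d u" and i: "i < n"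
  shows "rev (proj i (Suc i) u) = proj i (Suc i) u"
  using d
proof (cases rule: B_data_cases)
  case (alt c)
  then show ?thesis using u i alt_spec_palindrome[of n c u i] by (simp add: B_spec_def)
next
  case (zig p c)
  show ?thesis
  proof (cases "Suc i = n")
    case True
    then show ?thesis using u zig by (auto simp: B_spec_def)
  next
    case False
    then show ?thesis
      using u zig i zig_spec_palindrome[of "n - 1" p c u i] by (simp add: B_spec_def)
  qed
qed

lemma B_spec_no_square_above:
  assumes d: "d \<in> B_data n" and u: "B_spec n d u" and s: "1 \<le> s" "s < n"
  shows "\<not> sublist [s, s] (proj s (Suc s) u)"
  using d
proof (cases rule: B_data_cases)
  case (alt c)
  then show ?thesis using u s alt_spec_above[of n c u s] by (simp add: B_spec_def)
next
  case (zig p c)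
  show ?thesis
  proof (cases "Suc s = n")
    case True
    then have "proj s (Suc s) u = [s, Suc s, s]" using u zig by (auto simp: B_spec_def)
    then show ?thesis by (simp add: sublist_Cons_right)
  next
    case False
    then show ?thesis
      using u zig s zig_spec_no_square[of "n - 1" p c u s] by (simp add: B_spec_def)
  qed
qed

lemma B_spec_no_square_last:
  assumes d: "d \<in> B_data n" and u: "B_spec n d u" and n: "1 \<le> n"
  shows "\<exists>t\<in>{1..n}. (Suc t = n \<or> t = n) \<and> \<not> sublist [n, n] (proj n t u)"
  using d
proof (cases rule: B_data_cases)
  case (alt c)
  then show ?thesis using u n alt_spec_below[of n c u n] by (simp add: B_spec_def)
next
  case (zig p c)
  then have "proj n (n - 1) u = [n - 1, n, n - 1]"
    using u by (simp add: B_spec_def proj_commute[of n])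
  then have "\<not> sublist [n, n] (proj n (n - 1) u)" using n by (auto simp: sublist_Cons_right)
  then show ?thesis using zig by (intro bexI[of _ "n - 1"]) auto
qed

text \<open>In the zigzag the upper neighbour occurs as a pair between the two \<open>s\<close>, so
  no braid forms; elsewhere the lower neighbour keeps the \<open>s\<close> apart.\<close>

lemma B_spec_braid_above:
  assumes d: "d \<in> B_data n" and u: "B_spec n d u" and s: "1 \<le> s" "Suc s < n"
  shows "\<not> sublist [s, Suc s, s] (proj s (Suc s) u) \<or>
    (\<exists>t\<in>{1..s}. (Suc t = s \<or> t = s) \<and> \<not> sublist [s, s] (proj s t u))"
  using d
proof (cases rule: B_data_cases)
  case (alt c)
  then show ?thesis using u s alt_spec_below[of n c u s] by (simp add: B_spec_def)
next
  case (zig p c)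
  then have z: "zig_spec (n - 1) p c u" using u by (simp add: B_spec_def)
  show ?thesis
    using zig_spec_no_braid[OF z, of s] zig_spec_below[OF z, of s] zig s by (cases "p \<le> s") auto
qed

lemma B_spec_braid_end:
  assumes d: "d \<in> B_data n" and u: "B_spec n d u" and n: "2 \<le> n"
  shows "(\<exists>t\<in>{1..n}. (Suc t = n - 1 \<or> t = n - 1) \<and> \<not> sublist [n - 1, n - 1] (proj (n - 1) t u)) \<or>
    \<not> sublist [n, n] (proj n n u)"
  using d
proof (cases rule: B_data_cases)
  case (alt c)
  then show ?thesis using u n alt_spec_below[of n c u "n - 1"] by (fastforce simp: B_spec_def)
next
  case (zig p c)
  then have "proj (n - 1) n u = [n - 1, n, n - 1]" using u by (simp add: B_spec_def)
  moreover have "n - 1 \<noteq> n" using n by simp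
  ultimately have "count_list u n = 1" using count_proj[of n "n - 1" n u] by simp
  then show ?thesis using sublist_square_same[of n u] by auto
qed

text \<open>A zigzag has a square at the edge below its turning point, where alternating words and
  zigzags with a larger turning point alternate. For equal turning points the counts and the last
  height 1 give back the walk.\<close>

lemma B_spec_disjoint:
  assumes d: "d \<in> B_data n" "e \<in> B_data n" and u: "B_spec n d u" and v: "B_spec n e v"
    and count: "\<And>x. count_list u x = count_list v x"
    and proj: "\<And>i. i < n \<Longrightarrow> proj i (Suc i) u = proj i (Suc i) v"
  shows "d = e"
proof -
  have alt_zig: False
    if "alt_spec n c u" "zig_spec (n - 1) p c' v" "1 \<le> p" "p < n"
      "\<And>i. i < n \<Longrightarrow> proj i (Suc i) u = proj i (Suc i) v" for c c' p u v
  proof -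
    have "sublist [p, p] (proj (p - 1) p u)" using zig_spec_square[OF that(2)] that(3,4) that(5)[of "p - 1"] by simp
    moreover have "distinct_adj (proj (p - 1) p u)"
      using that(1,3,4) by (auto simp: alt_spec_def dest!: spec[of _ "p - 1"])
    ultimately show False using alternating_no_square(1)[of "p - 1" p u p] by blast
  qed
  have zig_zig: "\<not> p < q"
    if "zig_spec (n - 1) p c u" "zig_spec (n - 1) q c' v" "1 \<le> p" "q < n"
      "\<And>i. i < n \<Longrightarrow> proj i (Suc i) u = proj i (Suc i) v" for c c' p q u v
  proof
    assume "p < q"
    have "sublist [p, p] (proj (p - 1) p v)"
      using zig_spec_square[OF that(1)] that(3,4) that(5)[of "p - 1"] \<open>p < q\<close> by simp
    moreover have "distinct_adj (proj (p - 1) p v)"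
      using that(2,3) \<open>p < q\<close> by (auto simp: zig_spec_def dest!: spec[of _ "p - 1"])
    ultimately show False using alternating_no_square(1)[of "p - 1" p v p] by blast
  qed
  show ?thesis
    using d(1)
  proof (cases rule: B_data_cases)
    case alt: (alt c)
    show ?thesis
      using d(2)
    proof (cases rule: B_data_cases)
      case alt': (alt c')
      then show ?thesis
        using alt u v alt_spec_counts[of n c u] alt_spec_counts[of n c' v] count
        by (auto simp: B_spec_def zwalks_def)
    next
      case (zig p c')
      then show ?thesis using alt alt_zig[of c u p c' v] u v proj by (auto simp: B_spec_def)
    qed
  next
    case zig: (zig p c)
    show ?thesis
      using d(2)
    proof (cases rule: B_data_cases)
      case (alt c')
      then show ?thesis using zig alt_zig[of c' v p c u] u v proj by (auto simp: B_spec_def)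
    next
      case zig': (zig q c')
      have z: "zig_spec (n - 1) p c u" "zig_spec (n - 1) q c' v"
        using zig zig' u v by (auto simp: B_spec_def)
      then have pq: "p = q"
        using zig_zig[of p c u q c' v] zig_zig[of q c' v p c u] zig zig' proj
        by (metis linorder_neqE_nat)
      have "c = c'"
      proof (rule nth_equalityI)
        fix i assume "i < length c"
        then have "i < p \<or> i = p" using zig by auto
        then show "c ! i = c' ! i"
          using z zig zig' pq count[of i] by (auto simp: zig_spec_def)
      qed (use zig zig' pq in \<open>auto simp: zwalks_def\<close>)
      then show ?thesis using zig zig' by simp
    qed
  qed
qed

text \<open>The bond labelled 4 allows a single \<open>n\<close> between two \<open>n - 1\<close>,
  and only this can break the alternation coming from the right. The main case distinction is
  whether it does.\<close>

lemma B_spec_of_fc_word: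
  assumes fc: "small_coxeter.fc_word {1..n} (matrix_B n) u"
    and self_dual: "(commutation_step {1..n} (matrix_B n))\<^sup>*\<^sup>* u (rev u)"
  shows "\<exists>d\<in>B_data n. B_spec n d u"
proof -
  interpret small_coxeter "{1..n}" "matrix_B n" by (rule small_coxeter_B)
  have set: "set u \<subseteq> {1..n}" using fc_wordD(1)[OF fc] by auto
  \<comment> \<open>The premise \<open>no\<close> keeps out the one gap that label 4 permits, a
    single \<open>n\<close> between two \<open>n - 1\<close>.\<close>
  have gap: "2 \<le> count_list w (i - 1) + count_list w (i + 1)"
    if gap: "u = a @ i # w @ i # b" "i \<notin> set w" and i: "i < n" and no: "Suc i \<noteq> n \<or> n \<notin> set w"
    for i a w b
  proof -
    have S: "i \<in> {1..n}" "set w \<subseteq> {1..n}" using gap(1) set by auto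
    have eq: "filter (\<lambda>x. matrix_B n i x \<noteq> 2) w = filter (\<lambda>x. x = i - 1 \<or> x = i + 1) w"
    proof (rule filter_cong[OF HOL.refl])
      fix x assume "x \<in> set w"
      then have "x \<in> {1..n}" "x \<noteq> i" using S gap(2) by auto
      then show "(matrix_B n i x \<noteq> 2) = (x = i - 1 \<or> x = i + 1)"
        using S(1) by (auto simp: matrix_B_simps)
    qed
    have "matrix_B n i t \<noteq> 4" if "filter (\<lambda>x. matrix_B n i x \<noteq> 2) w = [t]" for t
    proof
      assume m4: "matrix_B n i t = 4"
      have "t \<in> set (filter (\<lambda>x. matrix_B n i x \<noteq> 2) w)" using that by simp
      then have "t \<in> set w" by simp
      then show False using m4 S i no by (auto simp: matrix_B_simps)
    qed
    then show ?thesis using fc_word_gap[OF fc gap] eq by (auto simp: length_filter_two)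
  qed
  have crowded: "crowded i u" if "Suc i < n" for i
    unfolding crowded_def using gap that by auto
  have left: "separated (Suc i) i u" if "i < n" for i
  proof (rule chain_left[of u "n - 1"])
    show "0 \<notin> set u" using set by auto
    show "i \<le> n - 1" using that by simp
    fix i a w b
    assume *: "1 \<le> i" "i \<le> n - 1" "u = a @ i # w @ i # b" "i \<notin> set w" "Suc i \<notin> set w"
    then have "2 \<le> count_list w (i - 1) + count_list w (i + 1)" by (intro gap[of a i w b]) auto
    then show "2 \<le> count_list w (i - 1)" using * by (simp add: count_list_0_iff[THEN iffD2])
  qed
  have last: "separated (n - 1) n u"
  proof (rule separatedI)
    fix a w b assume gap: "u = a @ n # w @ n # b" "n \<notin> set w"
    have S: "n \<in> {1..n}" "set w \<subseteq> {1..n}" using gap(1) set by auto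
    have "filter (\<lambda>x. matrix_B n n x \<noteq> 2) w \<noteq> []" using fc_word_gap[OF fc gap] by auto
    then obtain x where x: "x \<in> set w" "matrix_B n n x \<noteq> 2" by (auto simp: filter_empty_conv)
    have "x \<in> {1..n}" "x \<noteq> n" using x(1) S gap(2) by auto
    then have "x = n - 1" using x(2) S(1) by (auto simp: matrix_B_simps)
    then show "n - 1 \<in> set w" using x by simp
  qed
  have pal: "rev (proj i (Suc i) u) = proj i (Suc i) u" if "0 < i" "i < n" for i
    using that by (intro palindrome_proj[OF self_dual]) (auto simp: matrix_B_simps)
  show ?thesis
  proof (cases "n \<le> 1 \<or> separated (n - 2) (n - 1) u")
    case True
    have right: "separated i (Suc i) u" if "i < n" for i
    proof (cases "Suc i = n")
      case False
      then have "separated (n - 2) (Suc (n - 2)) u"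
        using True that by (auto simp: numeral_2_eq_2 Suc_diff_Suc)
      then show ?thesis
        using that False by (intro chain_right[of i "n - 2"] crowded) auto
    qed (use last in auto)
    let ?c = "map (count_list u) [0..<Suc n]"
    have "?c \<in> zwalks n" "alt_spec n ?c u"
      using set left right pal by (intro alt_spec_of_word; blast)+
    then show ?thesis
      using set by (intro bexI[of _ "Inl ?c"]) (auto simp: B_spec_def B_data_def)
  next
    case False
    define N where "N = n - 1"
    have n: "n = Suc N" and N: "1 \<le> N" using False by (auto simp: N_def)
    have turn: "\<not> separated (N - 1) N u" using False by (simp add: N_def numeral_2_eq_2)
    obtain a w b where u: "u = a @ N # w @ N # b" "N \<notin> set w" "N - 1 \<notin> set w"
      using turn by (auto elim: not_separatedE)
    have sep: "separated (Suc N) N u" "separated N (Suc N) u" using left[of N] last n by auto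
    have fc': "fc_word (rev u)" using fc_word_comm[OF fc self_dual] .
    \<comment> \<open>No end letter follows the turn and, by the same lemma for the reversed word,
      none precedes it.\<close>
    have b: "Suc N \<notin> set b"
      using no_end_letter_after_turn[OF _ sep N u] fc n by simp
    have "separated (Suc N) N (rev u)" "separated N (Suc N) (rev u)" using sep by simp_all
    moreover have "rev u = rev b @ N # rev w @ N # rev a" using u(1) by simp
    ultimately have "Suc N \<notin> set (rev a)"
      using fc' n N u(2,3)
      by (intro no_end_letter_after_turn[of N "rev u" "rev b" "rev w" "rev a"]) simp_all
    then have a: "Suc N \<notin> set a" by simp
    have "N \<notin> set b"
    proof
      assume "N \<in> set b"
      then obtain x y where xy: "b = x @ N # y" by (meson split_list)
      then have "u = (a @ N # w) @ N # x @ N # y" using u by simp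
      then have "Suc N \<in> set x" by (rule separated_betweenD[OF sep(1)])
      then show False using b xy by auto
    qed
    moreover have "N \<notin> set a"
    proof
      assume "N \<in> set a"
      then obtain x y where xy: "a = x @ N # y" by (meson split_list)
      then have "u = x @ N # y @ N # (w @ N # b)" using u by simp
      then have "Suc N \<in> set y" by (rule separated_betweenD[OF sep(1)])
      then show False using a xy by auto
    qed
    ultimately have countN: "count_list u N = 2"
      using u by (simp add: count_list_0_iff[THEN iffD2])
    have "Suc N \<in> set w" by (rule separated_betweenD[OF sep(1) u(1)])
    then have "count_list w (Suc N) = 1"
      using separated_count_le[OF sep(2), of "a @ [N]" w "N # b"] u
      by (simp add: le_Suc_eq count_list_0_iff)
    then have end_proj: "proj N (Suc N) u = [N, Suc N, N]"
      using u a b \<open>N \<notin> set a\<close> \<open>N \<notin> set b\<close> proj_absent[of N w "Suc N"]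
      by (simp add: proj_eq_Nil_iff[THEN iffD2] proj_commute[of N])
    have "\<exists>p\<in>{1..N}. \<exists>c\<in>zwalks p. c ! p = 1 \<and> zig_spec N p c u"
      using set N countN turn crowded left pal n by (intro zig_spec_of_word) auto
    then obtain p c where pc: "1 \<le> p" "p \<le> N" "c \<in> zwalks p" "c ! p = 1" "zig_spec N p c u"
      by auto
    have "c \<in> (\<Union>p\<in>{1..<n}. {c \<in> zwalks p. c ! p = 1})" using pc n by auto
    then have "Inr c \<in> B_data n" unfolding B_data_def by blast
    moreover have "B_spec n (Inr c) u"
      using set pc end_proj n by (auto simp: B_spec_def zwalks_def)
    ultimately show ?thesis by blast
  qed
qed

lemma fc_inv_poly_B:
  "fc_inv_poly {1..n} (matrix_B n) = (\<Sum>c\<in>zwalks n. monom 1 (sum_list c)) +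
    (\<Sum>p\<in>{1..<n}. \<Sum>c | c \<in> zwalks p \<and> c ! p = 1. monom 1 (sum_list c + 2 * (n - p)))"
proof -
  interpret small_coxeter "{1..n}" "matrix_B n" by (rule small_coxeter_B)
  have S: "u \<in> lists {1..n}" if "B_spec n d u" for d u using that by (auto simp: B_spec_def)
  have unique: "comm u v" if "d \<in> B_data n" "B_spec n d u" "B_spec n d v" for d u v
  proof (rule comm_if_proj_eq[OF S[OF that(2)] S[OF that(3)]])
    fix s t assume st: "s \<in> {1..n}" "t \<in> {1..n}" "matrix_B n s t \<noteq> 2"
    consider "t = s" | "t = Suc s" | "s = Suc t" using st by (auto simp: matrix_B_simps)
    then show "proj s t u = proj s t v"
    proof cases
      case 1
      have "count_list u s = count_list v s"
      \<comment> \<open>A single generator has no edge whose projection would give its count; but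
        then there are no zigzags, and the walk gives the count.\<close>
      proof (cases "n = 1")
        case True
        then have "d \<in> Inl ` zwalks n" using that(1) by (auto simp: B_data_def)
        then show ?thesis using that st True by (auto simp: B_spec_def alt_spec_def)
      next
        case False
        then have "1 \<le> s \<and> s < n \<or> 1 \<le> s - 1 \<and> s - 1 < n \<and> Suc (s - 1) = s" using st by auto
        then show ?thesis
          using B_spec_proj_eq[OF that, of s] B_spec_proj_eq[OF that, of "s - 1"]
            count_proj[of s s "Suc s"] count_proj[of s "s - 1" s] by metis
      qed
      then show ?thesis using 1 by (simp add: proj_same)
    next
      case 2
      then show ?thesis using B_spec_proj_eq[OF that, of s] st by simp
    next
      case 3
      then show ?thesis using B_spec_proj_eq[OF that, of t] st by (simp add: proj_commute[of "Suc t" t])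
    qed
  qed
  have "fc_inv_poly {1..n} (matrix_B n) = (\<Sum>d\<in>B_data n. monom 1 (B_weight n d))"
  proof (rule fc_inv_poly_eq_sum[where Spec = "B_spec n"])
    show "\<exists>u. B_spec n d u" if "d \<in> B_data n" for d using B_spec_exists[OF that] by blast
  next
    fix d u assume d: "d \<in> B_data n" and u: "B_spec n d u"
    have no_square: "\<exists>t\<in>{1..n}. (t = Suc s \<or> Suc t = s \<or> t = s) \<and> \<not> sublist [s, s] (proj s t u)"
      if "s \<in> {1..n}" for s
    proof (cases "s = n")
      case True
      then show ?thesis using B_spec_no_square_last[OF d u] that by auto
    next
      case False
      then show ?thesis
        using B_spec_no_square_above[OF d u, of s] that by (intro bexI[of _ "Suc s"]) auto
    qed
    have "fc_word u"
    proof (rule fc_wordI[OF S[OF u]])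
      fix s assume s: "s \<in> {1..n}"
      then obtain t where "t \<in> {1..n}" "t = Suc s \<or> Suc t = s \<or> t = s" "\<not> sublist [s, s] (proj s t u)"
        using no_square by blast
      then show "\<exists>t\<in>{1..n}. matrix_B n s t \<noteq> 2 \<and> \<not> sublist [s, s] (proj s t u)"
        using s by (intro bexI[of _ t]) (auto simp: matrix_B_simps)
    next
      fix s t assume st: "s \<in> {1..n}" "t \<in> {1..n}" "matrix_B n s t = 3"
      then consider "t = Suc s" "t < n" | "s = Suc t" "s < n" by (auto simp: matrix_B_simps)
      then show "\<not> sublist [s, t, s] (proj s t u) \<or>
        (\<exists>t'\<in>{1..n}. t' \<noteq> t \<and> matrix_B n s t' \<noteq> 2 \<and> \<not> sublist [s, s] (proj s t' u))"
      proof cases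
        case 1
        have "1 \<le> s" "Suc s < n" using 1 st by auto
        from B_spec_braid_above[OF d u this]
        consider "\<not> sublist [s, Suc s, s] (proj s (Suc s) u)"
          | t' where "t' \<in> {1..s}" "Suc t' = s \<or> t' = s" "\<not> sublist [s, s] (proj s t' u)" by blast
        then show ?thesis
        proof cases
          case (2 t')
          then have "t' \<in> {1..n}" using st by auto
          with 2 show ?thesis
            using st 1 by (intro disjI2 bexI[of _ t']) (auto simp: matrix_B_simps)
        qed (simp add: 1)
      next
        case 2
        then show ?thesis
          using B_spec_no_square_above[OF d u, of s] st
          by (intro disjI2 bexI[of _ "Suc s"]) (auto simp: matrix_B_simps)
      qed
    next
      fix s t assume st: "s \<in> {1..n}" "t \<in> {1..n}" "matrix_B n s t = 4"
      have ends: "(\<exists>t\<in>{1..n}. t \<noteq> n \<and> matrix_B n (n - 1) t \<noteq> 2 \<and>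
          \<not> sublist [n - 1, n - 1] (proj (n - 1) t u)) \<or> \<not> sublist [n, n] (proj n n u)"
        if n: "2 \<le> n"
        using B_spec_braid_end[OF d u n]
      proof
        assume "\<exists>t\<in>{1..n}. (Suc t = n - 1 \<or> t = n - 1) \<and>
          \<not> sublist [n - 1, n - 1] (proj (n - 1) t u)"
        then obtain t where "t \<in> {1..n}" "Suc t = n - 1 \<or> t = n - 1"
          "\<not> sublist [n - 1, n - 1] (proj (n - 1) t u)" by blast
        then show ?thesis using n by (intro disjI1 bexI[of _ t]) (auto simp: matrix_B_simps)
      qed simp
      have diag: "matrix_B n n n \<noteq> 2" by (simp add: matrix_B_def)
      from st consider "t = Suc s" "t = n" | "s = Suc t" "s = n" by (auto simp: matrix_B_simps)
      then show "(\<exists>t'\<in>{1..n}. t' \<noteq> t \<and> matrix_B n s t' \<noteq> 2 \<and> \<not> sublist [s, s] (proj s t' u)) \<or>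
        (\<exists>s'\<in>{1..n}. s' \<noteq> s \<and> matrix_B n t s' \<noteq> 2 \<and> \<not> sublist [t, t] (proj t s' u))"
      proof cases
        case 1
        then have n: "2 \<le> n" "n - 1 = s" "s \<noteq> n" using st by auto
        from ends[OF n(1), unfolded n(2)] show ?thesis
        proof
          assume "\<not> sublist [n, n] (proj n n u)"
          then show ?thesis using 1 st diag n by (intro disjI2 bexI[of _ n]) auto
        qed (use 1 in blast)
      next
        case 2
        then have n: "2 \<le> n" "n - 1 = t" "t \<noteq> n" using st by auto
        from ends[OF n(1), unfolded n(2)] show ?thesis
        proof
          assume "\<not> sublist [n, n] (proj n n u)"
          then show ?thesis using 2 st diag n by (intro disjI1 bexI[of _ n]) auto
        qed (use 2 in blast)
      qed
    qed
    moreover have "comm u (rev u)"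
    proof (rule comm_rev_if_palindromes[OF S[OF u]])
      fix s t assume "s \<in> {1..n}" "t \<in> {1..n}" "matrix_B n s t \<noteq> 2" "s < t"
      then have "t = Suc s" "s < n" by (auto simp: matrix_B_simps)
      then show "rev (proj s t u) = proj s t u" using B_spec_palindrome[OF d u, of s] by simp
    qed
    \<comment> \<open>The length is known for one word of the class and carries over to
      \<open>u\<close> by uniqueness.\<close>
    moreover obtain u' where "B_spec n d u'" "length u' = B_weight n d"
      using B_spec_exists[OF d] by blast
    ultimately show "fc_word u \<and> comm u (rev u) \<and> length u = B_weight n d"
      using comm_length[OF unique[OF d u]] by metis
  next
    fix d e u v
    assume d: "d \<in> B_data n" "e \<in> B_data n" and u: "B_spec n d u" and v: "B_spec n e v"
      and uv: "comm u v"
    show "d = e"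
    proof (rule B_spec_disjoint[OF d u v comm_count[OF uv]])
      fix i assume i: "i < n"
      show "proj i (Suc i) u = proj i (Suc i) v"
      proof (cases "i = 0")
        case True
        have "0 \<notin> set u" "0 \<notin> set v" using u v by (auto simp: B_spec_def)
        then show ?thesis using True comm_count[OF uv] by (simp add: proj_commute[of 0] proj_absent)
      qed (use i in \<open>auto intro!: comm_proj[OF uv] simp: matrix_B_simps\<close>)
    qed
  qed (use unique B_spec_of_fc_word in auto)
  also have "\<dots> = (\<Sum>c\<in>zwalks n. monom 1 (sum_list c)) +
      (\<Sum>c\<in>(\<Union>p\<in>{1..<n}. {c \<in> zwalks p. c ! p = 1}).
        monom 1 (sum_list c + 2 * (n - (length c - 1))))"
    unfolding B_data_def
    by (subst sum.union_disjoint)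
      (auto simp: finite_zwalks sum.reindex B_weight_def simp del: UN_simps)
  also have "(\<Sum>c\<in>(\<Union>p\<in>{1..<n}. {c \<in> zwalks p. c ! p = 1}).
        monom 1 (sum_list c + 2 * (n - (length c - 1)))) =
      (\<Sum>p\<in>{1..<n}. \<Sum>c | c \<in> zwalks p \<and> c ! p = 1. monom 1 (sum_list c + 2 * (n - p)))"
    by (rule sum_short_zwalks) simp
  finally show ?thesis .
qed

section \<open>Type D\<close>

definition adj_D :: "nat \<Rightarrow> nat \<Rightarrow> nat \<Rightarrow> bool" where
  "adj_D n s t \<longleftrightarrow> t = Suc s \<and> t \<le> n \<or> s = Suc t \<and> s \<le> n \<or>
     Suc s = n \<and> t = Suc n \<or> Suc t = n \<and> s = Suc n"

lemma matrix_D_simps: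
  "matrix_D n s t = 2 \<longleftrightarrow> s \<noteq> t \<and> \<not> adj_D n s t"
  "matrix_D n s t = 3 \<longleftrightarrow> adj_D n s t"
  "matrix_D n s t \<noteq> 4"
  by (auto simp: matrix_D_def edge_D_def adj_D_def)

lemma small_coxeter_D: "small_coxeter S (matrix_D n)"
  by unfold_locales (auto simp: matrix_D_def)

text \<open>Identifying the two end nodes of the fork turns words of type D into words over a path.\<close>

definition fold_end :: "nat \<Rightarrow> nat \<Rightarrow> nat" where
  "fold_end n x = (if x = Suc n then n else x)"

abbreviation fold_word :: "nat \<Rightarrow> nat list \<Rightarrow> nat list" where
  "fold_word n \<equiv> map (fold_end n)"

lemma proj_fold_word:
  assumes "i < n" "j < n"
  shows "proj i j (fold_word n u) = proj i j u"
  using assms by (induction u) (auto simp: fold_end_def)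

lemma count_fold_word: "i < n \<Longrightarrow> count_list (fold_word n u) i = count_list u i"
  by (induction u) (auto simp: fold_end_def)

lemma count_fold_word_end:
  "count_list (fold_word n u) n = count_list u n + count_list u (Suc n)"
  by (induction u) (auto simp: fold_end_def)

lemma length_proj: "x \<noteq> y \<Longrightarrow> length (proj x y u) = count_list u x + count_list u y"
  by (simp add: proj_def length_filter_two)

text \<open>Folding only forgets which end letter stands at each end position, and this is what the
  second projection records.\<close>

lemma fold_word_determined:
  assumes "fold_word n v = fold_word n v'" "proj n (Suc n) v = proj n (Suc n) v'"
  shows "v = v'"
  using assms
proof (induction v arbitrary: v')
  case (Cons x v)
  then obtain x' w where w: "v' = x' # w" "fold_end n x = fold_end n x'" "fold_word n v = fold_word n w"
    by auto
  have "x = x'" "proj n (Suc n) v = proj n (Suc n) w"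
    using w(2) Cons.prems(2) unfolding w(1) by (auto simp: fold_end_def split: if_splits)
  then show ?case using Cons.IH w by simp
qed simp

lemma unfold_exists:
  assumes "set v \<subseteq> {n, Suc n}" "length v = count_list u n" "Suc n \<notin> set u"
  shows "\<exists>w. fold_word n w = u \<and> proj n (Suc n) w = v"
  using assms
proof (induction u arbitrary: v)
  case (Cons x u)
  show ?case
  proof (cases "x = n")
    case True
    then obtain y v' where v: "v = y # v'" using Cons.prems by (cases v) auto
    then obtain w where "fold_word n w = u" "proj n (Suc n) w = v'"
      using Cons True by fastforce
    then show ?thesis
      using v True Cons.prems by (intro exI[of _ "y # w"]) (auto simp: fold_end_def)
  next
    case False
    then obtain w where "fold_word n w = u" "proj n (Suc n) w = v"
      using Cons by fastforce
    then show ?thesis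
      using False Cons.prems by (intro exI[of _ "x # w"]) (auto simp: fold_end_def)
  qed
qed simp

lemma alternating_from:
  assumes "a \<noteq> b"
  shows "\<exists>v. distinct_adj v \<and> set v \<subseteq> {a, b} \<and> length v = k \<and> (k \<noteq> 0 \<longrightarrow> hd v = a)"
  using assms
proof (induction k arbitrary: a b)
  case (Suc k)
  then obtain v where "distinct_adj v" "set v \<subseteq> {b, a}" "length v = k" "k \<noteq> 0 \<longrightarrow> hd v = b"
    by metis
  then show ?case using Suc.prems by (intro exI[of _ "a # v"]) (auto simp: distinct_adj_Cons)
qed auto

text \<open>The end letters alternate, so the first of them, \<open>x\<close>, fixes their sequence.
  For \<open>Inr c\<close> the turning point is \<open>length c - 1\<close>; if it equals
  \<open>n\<close>, the zigzag shrinks to the commuting pair of end letters at the place of a single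
  \<open>n\<close>.\<close>

definition D_spec :: "nat \<Rightarrow> (nat list \<times> nat) + nat list \<Rightarrow> nat list \<Rightarrow> bool" where
  "D_spec n d u \<longleftrightarrow> set u \<subseteq> {1..Suc n} \<and> (case d of
     Inl (c, x) \<Rightarrow> alt_spec n c (fold_word n u) \<and> distinct_adj (proj n (Suc n) u) \<and>
       (c ! n \<noteq> 0 \<longrightarrow> hd (proj n (Suc n) u) = x)
   | Inr c \<Rightarrow>
       (if length c - 1 < n then zig_spec (n - 1) (length c - 1) c u
        else (\<forall>i<n. count_list u i = c ! i) \<and>
          (\<forall>i. Suc i < n \<longrightarrow> distinct_adj (proj i (Suc i) u))) \<and>
       (\<forall>y\<in>{n, Suc n}. proj (n - 1) y u =
          (if length c - 1 = n \<and> c ! (n - 1) = 0 then [y] else [n - 1, y, n - 1])))"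

text \<open>Without end letters there is no first one, and 0 is a dummy; an odd height leaves two
  choices, the origin of the factor 2. Unlike in type B the turning point \<open>n\<close> is
  included, since a pair of end letters does not alternate after folding.\<close>

definition D_data :: "nat \<Rightarrow> ((nat list \<times> nat) + nat list) set" where
  "D_data n = Inl ` ({c \<in> zwalks n. c ! n = 0} \<times> {0} \<union> {c \<in> zwalks n. odd (c ! n)} \<times> {n, Suc n}) \<union>
     Inr ` (\<Union>p\<in>{1..n}. {c \<in> zwalks p. c ! p = 1})"

text \<open>The middle of the zigzag consists of two end letters, one letter more than in type
  B.\<close>

definition D_weight :: "nat \<Rightarrow> (nat list \<times> nat) + nat list \<Rightarrow> nat" where
  "D_weight n d = (case d of Inl (c, x) \<Rightarrow> sum_list c
    | Inr c \<Rightarrow> sum_list c + 2 * (n - (length c - 1)) + 1)"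

lemma D_data_cases:
  assumes "d \<in> D_data n"
  obtains (none) c where "d = Inl (c, 0)" "c \<in> zwalks n" "c ! n = 0"
    | (odd) c x where "d = Inl (c, x)" "c \<in> zwalks n" "odd (c ! n)" "x \<in> {n, Suc n}"
    | (zig) p c where "d = Inr c" "1 \<le> p" "p < n" "c \<in> zwalks p" "c ! p = 1" "length c - 1 = p"
    | (fork) c where "d = Inr c" "c \<in> zwalks n" "c ! n = 1" "length c - 1 = n"
proof -
  from assms consider (1) c where "d = Inl (c, 0)" "c \<in> zwalks n" "c ! n = 0"
    | (2) c x where "d = Inl (c, x)" "c \<in> zwalks n" "odd (c ! n)" "x \<in> {n, Suc n}"
    | (3) p c where "d = Inr c" "p \<in> {1..n}" "c \<in> zwalks p" "c ! p = 1"
    unfolding D_data_def by blast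
  then show thesis
  proof cases
    case (3 p c)
    then have "length c - 1 = p" by (simp add: zwalks_def)
    then show thesis using 3 zig[of c p] fork[of c] by (cases "p = n") auto
  qed (use none odd in blast)+
qed

lemma D_spec_exists_alt:
  assumes c: "c \<in> zwalks n" and x: "c ! n \<noteq> 0 \<Longrightarrow> x \<in> {n, Suc n}" and n: "1 \<le> n"
  shows "\<exists>u. D_spec n (Inl (c, x)) u \<and> length u = sum_list c"
proof -
  obtain u0 where u0: "alt_spec n c u0" using alt_spec_exists[OF c] by blast
  \<comment> \<open>Turns the dummy into a genuine label; it occurs only with an empty sequence of
    end letters.\<close>
  define x' where "x' = (if x = Suc n then Suc n else n)"
  define y where "y = (if x = Suc n then n else Suc n)"
  have "x' \<noteq> y" "{x', y} = {n, Suc n}" by (auto simp: x'_def y_def)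
  then obtain v where v: "distinct_adj v" "set v \<subseteq> {n, Suc n}" "length v = c ! n"
    "c ! n \<noteq> 0 \<longrightarrow> hd v = x'"
    using alternating_from[of x' y "c ! n"] by metis
  have "Suc n \<notin> set u0" "set u0 \<subseteq> {1..n}" "count_list u0 n = c ! n"
    using u0 by (auto simp: alt_spec_def)
  then obtain w where w: "fold_word n w = u0" "proj n (Suc n) w = v"
    using unfold_exists[of v n u0] v by auto
  have "set w \<subseteq> {1..Suc n}"
  proof
    fix z assume "z \<in> set w"
    then have "fold_end n z \<in> set u0" using w(1) by (metis imageI list.set_map)
    then have "fold_end n z \<in> {1..n}" using \<open>set u0 \<subseteq> {1..n}\<close> by blast
    then show "z \<in> {1..Suc n}" by (auto simp: fold_end_def split: if_splits)
  qed
  moreover have "length w = sum_list c"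
    using alt_spec_length[OF u0] c w(1) by (auto simp: zwalks_def dest: arg_cong[where f = length])
  moreover have "c ! n \<noteq> 0 \<longrightarrow> hd v = x" using v(4) x by (auto simp: x'_def)
  ultimately show ?thesis using w u0 v by (intro exI[of _ w]) (auto simp: D_spec_def)
qed

lemma D_spec_exists:
  assumes "d \<in> D_data n" "1 \<le> n"
  shows "\<exists>u. D_spec n d u \<and> length u = D_weight n d"
  using assms(1)
proof (cases rule: D_data_cases)
  case (none c)
  then show ?thesis using D_spec_exists_alt[of c n 0] assms(2) by (simp add: D_weight_def)
next
  case (odd c x)
  then show ?thesis using D_spec_exists_alt[of c n x] assms(2) by (simp add: D_weight_def)
next
  case (zig p c)
  then obtain u0 where u0: "alt_spec p c u0" using alt_spec_exists by blast
  then obtain a b where ab: "u0 = a @ p # b" "set a \<subseteq> {1..<p}" "set b \<subseteq> {1..<p}"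
    "proj (p - 1) p a = proj (p - 1) p b"
    "proj (p - 1) p a = (if c ! (p - 1) = 0 then [] else [p - 1])"
    using alt_spec_split_last zig by metis
  let ?u = "a @ ([p..<n] @ [n, Suc n] @ rev [p..<n]) @ b"
  have "zig_spec (n - 1) p c ?u"
    using u0 ab zig by (intro zig_spec_expand) auto
  moreover have "proj (n - 1) y ?u = [n - 1, y, n - 1]" if "y \<in> {n, Suc n}" for y
  proof -
    have "proj (n - 1) y [p..<n] = [n - 1]"
      using zig that upt_Suc_append[of p "n - 1"] by (auto simp: proj_eq_Nil_iff[THEN iffD2])
    moreover have "proj (n - 1) y a = []" "proj (n - 1) y b = []"
      using ab(2,3) zig(3) that by (force simp: proj_eq_Nil_iff)+
    ultimately show ?thesis using that zig(3) by auto
  qed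
  moreover have "set ?u \<subseteq> {1..Suc n}" using ab(2,3) zig(2,3) by auto
  moreover have "length ?u = sum_list c + 2 * (n - p) + 1"
    using alt_spec_length[OF u0] ab(1) zig(3,4) by (simp add: zwalks_def)
  ultimately show ?thesis
    using zig by (intro exI[of _ ?u]) (simp add: D_spec_def D_weight_def)
next
  case (fork c)
  then obtain u0 where u0: "alt_spec n c u0" using alt_spec_exists by blast
  then obtain a b where ab: "u0 = a @ n # b" "set a \<subseteq> {1..<n}" "set b \<subseteq> {1..<n}"
    "proj (n - 1) n a = proj (n - 1) n b"
    "proj (n - 1) n a = (if c ! (n - 1) = 0 then [] else [n - 1])"
    using alt_spec_split_last fork assms(2) by metis
  let ?u = "a @ [n, Suc n] @ b"
  have nin: "n \<notin> set a" "n \<notin> set b" "Suc n \<notin> set a" "Suc n \<notin> set b" using ab(2,3) by auto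
  have "count_list ?u i = c ! i" if "i < n" for i
  proof -
    have "count_list u0 i = c ! i" using u0 that by (simp add: alt_spec_def)
    then show ?thesis using that ab(1) by simp
  qed
  moreover have "distinct_adj (proj i (Suc i) ?u)" if "Suc i < n" for i
  proof -
    have "distinct_adj (proj i (Suc i) u0)" using u0 that by (simp add: alt_spec_def)
    then show ?thesis using that ab(1) by simp
  qed
  moreover have "proj (n - 1) y ?u = (if c ! (n - 1) = 0 then [y] else [n - 1, y, n - 1])"
    if "y \<in> {n, Suc n}" for y
  proof -
    have "proj (n - 1) y z = proj (n - 1) n z" if "z = a \<or> z = b" for z
      using that \<open>y \<in> {n, Suc n}\<close> nin by (auto simp: proj_absent)
    then show ?thesis using ab(4,5) that assms(2) by auto
  qed
  moreover have "set ?u \<subseteq> {1..Suc n}" using ab(2,3) assms(2) by auto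
  moreover have "length ?u = sum_list c + 1"
    using alt_spec_length[OF u0] ab(1) fork(2) by (simp add: zwalks_def)
  ultimately show ?thesis
    using fork by (intro exI[of _ ?u]) (simp add: D_spec_def D_weight_def)
qed

lemma D_spec_proj_eq:
  assumes d: "d \<in> D_data n" and u: "D_spec n d u" and v: "D_spec n d v" and n: "1 \<le> n"
  shows "1 \<le> i \<Longrightarrow> Suc i < n \<Longrightarrow> proj i (Suc i) u = proj i (Suc i) v"
    and "y \<in> {n, Suc n} \<Longrightarrow> proj (n - 1) y u = proj (n - 1) y v"
proof -
  have alt: "(Suc i < n \<longrightarrow> proj i (Suc i) u = proj i (Suc i) v) \<and>
      (y \<in> {n, Suc n} \<longrightarrow> proj (n - 1) y u = proj (n - 1) y v)"
    if d: "d = Inl (c, x)" "c \<in> zwalks n" for c x i y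
  proof -
    have spec: "alt_spec n c (fold_word n u)" "alt_spec n c (fold_word n v)"
      "distinct_adj (proj n (Suc n) u)" "distinct_adj (proj n (Suc n) v)"
      "c ! n \<noteq> 0 \<Longrightarrow> hd (proj n (Suc n) u) = hd (proj n (Suc n) v)"
      using u v d by (auto simp: D_spec_def)
    have len: "length (proj n (Suc n) w) = c ! n" if "alt_spec n c (fold_word n w)" for w
      using that count_fold_word_end[of n w] by (simp add: alt_spec_def length_proj)
    have labels: "proj n (Suc n) u = proj n (Suc n) v"
    proof (rule alternating_determined[OF spec(3,4)])
      show "length (proj n (Suc n) u) = length (proj n (Suc n) v)"
        using len[OF spec(1)] len[OF spec(2)] by simp
      assume "proj n (Suc n) u \<noteq> []"
      then show "hd (proj n (Suc n) u) = hd (proj n (Suc n) v)"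
        using len[OF spec(1)] by (intro spec(5)) (metis length_0_conv)
    qed auto
    \<comment> \<open>The projection to the three letters at the fork is determined by its folded
      form, which alternates, and by the sequence of end letters. The projections to the two edges
      at the fork are then read off from it.\<close>
    define P where "P = (\<lambda>z. z = n - 1 \<or> z = n \<or> z = Suc n)"
    have fold: "fold_word n (filter P w) = proj (n - 1) n (fold_word n w)" for w
      using n by (induction w) (auto simp: P_def fold_end_def)
    have "filter P u = filter P v"
    proof (rule fold_word_determined)
      show "fold_word n (filter P u) = fold_word n (filter P v)"
        unfolding fold using alt_spec_proj_eq[OF spec(1,2), of "n - 1"] d n by simp
      have "proj n (Suc n) (filter P w) = proj n (Suc n) w" for w
        by (induction w) (auto simp: P_def)
      then show "proj n (Suc n) (filter P u) = proj n (Suc n) (filter P v)" using labels by simp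
    qed
    moreover have "proj (n - 1) y w = proj (n - 1) y (filter P w)" if "y \<in> {n, Suc n}" for w y
      using that by (induction w) (auto simp: P_def)
    moreover have "proj i (Suc i) u = proj i (Suc i) v" if "Suc i < n" for i
      using alt_spec_proj_eq[OF spec(1,2), of i] that d by (simp add: proj_fold_word)
    ultimately show ?thesis by metis
  qed
  show "proj i (Suc i) u = proj i (Suc i) v" if i: "1 \<le> i" "Suc i < n"
    using d
  proof (cases rule: D_data_cases)
    case (zig p c)
    then have "zig_spec (n - 1) p c u" "zig_spec (n - 1) p c v" using u v by (auto simp: D_spec_def)
    then show ?thesis using zig_spec_proj_eq[of "n - 1" p c u v i] i zig(4) by simp
  next
    case (fork c)
    then show ?thesis
      using u v i unfolding D_spec_def zwalks_def
      by (intro alternating_eqI[of _ _ i "Suc i"]) (auto simp: count_proj)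
  qed (use alt i in blast)+
  show "proj (n - 1) y u = proj (n - 1) y v" if y: "y \<in> {n, Suc n}"
    using d
  proof (cases rule: D_data_cases)
    case (zig p c)
    then show ?thesis using u v y by (auto simp: D_spec_def)
  next
    case (fork c)
    then show ?thesis using u v y by (auto simp: D_spec_def)
  qed (use alt y in blast)+
qed

text \<open>The sequence of end letters alternates and is empty or of odd length, so it ends with
  the letter it begins with. Self-duality then follows from uniqueness.\<close>

lemma D_spec_rev:
  assumes d: "d \<in> D_data n" and u: "D_spec n d u" and n: "1 \<le> n"
  shows "D_spec n d (rev u)"
proof -
  have alt: "D_spec n d (rev u)"
    if d: "d = Inl (c, x)" "c ! n = 0 \<or> odd (c ! n)" for c x
  proof -
    have spec: "alt_spec n c (fold_word n u)" "distinct_adj (proj n (Suc n) u)"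
      "c ! n \<noteq> 0 \<Longrightarrow> hd (proj n (Suc n) u) = x" "set u \<subseteq> {1..Suc n}"
      using u d by (auto simp: D_spec_def)
    have "alt_spec n c (fold_word n (rev u))"
      using spec(1) by (simp add: alt_spec_def rev_map[symmetric])
    moreover have "hd (proj n (Suc n) (rev u)) = x" if "c ! n \<noteq> 0"
    proof -
      let ?v = "proj n (Suc n) u"
      have len: "length ?v = c ! n"
        using spec(1) count_fold_word_end[of n u] by (simp add: alt_spec_def length_proj)
      then have v: "?v \<noteq> []" "odd (length ?v)" using that d by auto
      have "set ?v \<subseteq> {n, Suc n}" by auto
      then have x: "x \<in> {n, Suc n}" using hd_in_set[OF v(1)] spec(3)[OF that] by blast
      define y where "y = (if x = n then Suc n else n)"
      have xy: "{x, y} = {n, Suc n}" "x \<noteq> y" using x by (auto simp: y_def)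
      have sv: "set ?v \<subseteq> {x, y}" using \<open>set ?v \<subseteq> {n, Suc n}\<close> xy(1) by simp
      have "length ?v = count_list ?v x + count_list ?v y"
        using sum_count_set[OF sv] xy(2) by simp
      moreover have "count_list ?v x = count_list ?v y + (if last ?v = x then 1 else 0)"
        by (rule alternating_count[OF spec(2) sv xy(2) v(1) spec(3)[OF that]])
      ultimately have "last ?v = x" using v(2) by (metis add_0_right even_add)
      then show ?thesis using v by (simp add: hd_rev)
    qed
    ultimately show ?thesis using spec d by (simp add: D_spec_def)
  qed
  show ?thesis
    using d
  proof (cases rule: D_data_cases)
    case (zig p c)
    then have z: "zig_spec (n - 1) p c u" using u by (simp add: D_spec_def)
    then have "zig_spec (n - 1) p c (rev u)" unfolding zig_spec_def by simp
    then show ?thesis using u zig by (simp add: D_spec_def)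
  next
    case (fork c)
    then show ?thesis using u by (simp add: D_spec_def)
  qed (use alt in blast)+
qed

lemma D_spec_disjoint:
  assumes d: "d \<in> D_data n" "e \<in> D_data n" and u: "D_spec n d u" and v: "D_spec n e v"
    and n: "1 \<le> n"
    and count: "\<And>x. count_list u x = count_list v x"
    and proj: "\<And>i. Suc i < n \<Longrightarrow> proj i (Suc i) u = proj i (Suc i) v"
  shows "d = e"
proof -
  have inl: "count_list w n + count_list w (Suc n) = c ! n" "\<forall>i<n. count_list w i = c ! i"
    if "D_spec n (Inl (c, x)) w" for c x w
    using that count_fold_word_end[of n w] count_fold_word[of _ n w]
    by (auto simp: D_spec_def alt_spec_def)
  have inr: "count_list w n = 1" "count_list w (Suc n) = 1" if "D_spec n (Inr c) w" for c w
  proof -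
    have "count_list w y = 1" if "y \<in> {n, Suc n}" for y
    proof -
      have "proj (n - 1) y w = [y] \<or> proj (n - 1) y w = [n - 1, y, n - 1]"
        using \<open>D_spec n (Inr c) w\<close> that by (auto simp: D_spec_def split: if_splits)
      moreover have "n - 1 \<noteq> y" using that n by auto
      ultimately show ?thesis using count_proj[of y "n - 1" y w] by auto
    qed
    then show "count_list w n = 1" "count_list w (Suc n) = 1" by auto
  qed
  \<comment> \<open>An alternating sequence of odd length starts with the letter that occurs more
    often, so the counts reveal \<open>x\<close>.\<close>
  have label: "x = (if count_list w (Suc n) < count_list w n then n else Suc n)"
    if "D_spec n (Inl (c, x)) w" "odd (c ! n)" "x \<in> {n, Suc n}" for c x w
  proof -
    let ?v = "proj n (Suc n) w"
    have c: "c ! n = count_list w n + count_list w (Suc n)" using inl(1)[OF that(1)] by simp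
    have nz: "c ! n \<noteq> 0" using that(2) by (metis even_zero)
    then have v: "?v \<noteq> []" using c length_proj[of n "Suc n" w] by auto
    have d: "distinct_adj ?v" "hd ?v = x" using that(1) nz by (auto simp: D_spec_def)
    have sv: "set ?v \<subseteq> {n, Suc n}" "set ?v \<subseteq> {Suc n, n}" by auto
    have cv: "count_list ?v n = count_list w n" "count_list ?v (Suc n) = count_list w (Suc n)"
      by (simp_all add: count_proj)
    have ne: "count_list w n \<noteq> count_list w (Suc n)" using that(2) c by (metis even_add)
    show ?thesis
    proof (cases "x = n")
      case True
      have "count_list ?v n = count_list ?v (Suc n) + (if last ?v = n then 1 else 0)"
        using alternating_count[OF d(1) sv(1) _ v] d(2) True by simp
      then have "count_list ?v (Suc n) \<le> count_list ?v n" by (rule ssubst) (rule le_add1)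
      then show ?thesis using ne True cv by simp
    next
      case False
      then have "x = Suc n" using that(3) by blast
      have "count_list ?v (Suc n) = count_list ?v n + (if last ?v = Suc n then 1 else 0)"
        using alternating_count[OF d(1) sv(2) _ v] d(2) \<open>x = Suc n\<close> by simp
      then have "count_list ?v n \<le> count_list ?v (Suc n)" by (rule ssubst) (rule le_add1)
      then show ?thesis using ne \<open>x = Suc n\<close> cv by simp
    qed
  qed
  have walk_eq: "c = c'" if "c \<in> zwalks p" "c' \<in> zwalks p" "\<forall>i<p. c ! i = c' ! i" "c ! p = c' ! p" for c c' p
    using that by (intro nth_equalityI) (auto simp: zwalks_def less_Suc_eq)
  have zig: "\<not> p < length c' - 1"
    if z: "zig_spec (n - 1) p c u" "1 \<le> p" "p < n" and w: "D_spec n (Inr c') v" "c' \<in> zwalks q"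
      and proj: "\<And>i. Suc i < n \<Longrightarrow> proj i (Suc i) u = proj i (Suc i) v"
    for p c u c' q v
  proof
    assume "p < length c' - 1"
    then have "p < q" using w(2) by (simp add: zwalks_def)
    then have "distinct_adj (proj (p - 1) p v)"
      using w z(2,3) by (auto simp: D_spec_def zig_spec_def zwalks_def split: if_splits
          dest!: spec[of _ "p - 1"])
    moreover have "sublist [p, p] (proj (p - 1) p v)"
      using zig_spec_square[OF z(1)] z(2,3) proj[of "p - 1"] by simp
    ultimately show False using alternating_no_square(1)[of "p - 1" p v p] by blast
  qed
  have inr_data: "\<exists>p. 1 \<le> p \<and> p \<le> n \<and> c \<in> zwalks p \<and> c ! p = 1 \<and> length c - 1 = p"
    if "Inr c \<in> D_data n" for c
    using that by (auto simp: D_data_def zwalks_def)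
  have inr_inr: "c = c'"
    if D: "Inr c \<in> D_data n" "Inr c' \<in> D_data n" "D_spec n (Inr c) u" "D_spec n (Inr c') v" for c c'
  proof -
    obtain p where p: "1 \<le> p" "p \<le> n" "c \<in> zwalks p" "c ! p = 1" "length c - 1 = p"
      using inr_data[OF D(1)] by blast
    obtain q where q: "1 \<le> q" "q \<le> n" "c' \<in> zwalks q" "c' ! q = 1" "length c' - 1 = q"
      using inr_data[OF D(2)] by blast
    have "\<not> p < q"
    proof
      assume "p < q"
      then have "zig_spec (n - 1) p c u" using D(3) p q by (simp add: D_spec_def)
      then show False using zig[of p c u c' v q] \<open>p < q\<close> p q D(4) proj by auto
    qed
    moreover have "\<not> q < p"
    proof
      assume "q < p"
      then have "zig_spec (n - 1) q c' v" using D(4) p q by (simp add: D_spec_def)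
      then show False using zig[of q c' v c u p] \<open>q < p\<close> p q D(3) proj by auto
    qed
    ultimately have "p = q" by simp
    have counts: "\<forall>i<p. count_list w i = b ! i"
      if "D_spec n (Inr b) w" "length b - 1 = p" for b w
      using that p(2) by (auto simp: D_spec_def zig_spec_def split: if_splits)
    show ?thesis
      using counts[OF D(3) p(5)] counts[OF D(4)] q p \<open>p = q\<close> count by (intro walk_eq[of c p c']) auto
  qed
  \<comment> \<open>There are exactly two end letters in one case, none or an odd number in the
    other.\<close>
  have inl_inr: False if "Inl (c, x) \<in> D_data n" "D_spec n (Inl (c, x)) w" "D_spec n (Inr c') w'"
    "count_list w n = count_list w' n" "count_list w (Suc n) = count_list w' (Suc n)" for c x w c' w'
  proof -
    have "c ! n = 0 \<or> odd (c ! n)" using that(1) by (auto simp: D_data_def)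
    moreover have "c ! n = 2" using inl(1)[OF that(2)] inr[OF that(3)] that(4,5) by simp
    ultimately show False by simp
  qed
  have inl_inl: "c = c' \<and> x = x'"
    if "Inl (c, x) \<in> D_data n" "Inl (c', x') \<in> D_data n" "D_spec n (Inl (c, x)) u"
      "D_spec n (Inl (c', x')) v" for c x c' x'
  proof -
    have "c = c'"
      using inl[OF that(3)] inl[OF that(4)] that(1,2) count
      by (intro walk_eq[of c n c']) (auto simp: D_data_def)
    moreover have "x = x'"
    proof (cases "c ! n = 0")
      case True
      then show ?thesis using that(1,2) \<open>c = c'\<close> by (auto simp: D_data_def)
    next
      case False
      then have "odd (c ! n)" "x \<in> {n, Suc n}" "x' \<in> {n, Suc n}"
        using that(1,2) \<open>c = c'\<close> by (auto simp: D_data_def)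
      then show ?thesis using label[OF that(3)] label[OF that(4)] \<open>c = c'\<close> count by simp
    qed
    ultimately show ?thesis by simp
  qed
  show ?thesis
  proof (cases d)
    case (Inl cx)
    obtain c x where [simp]: "cx = (c, x)" by (cases cx)
    show ?thesis
    proof (cases e)
      case (Inl cx')
      then show ?thesis using inl_inl d u v \<open>d = _\<close> by (cases cx') auto
    next
      case (Inr c')
      then show ?thesis using inl_inr[of c x u c' v] d u v count \<open>d = _\<close> by auto
    qed
  next
    case (Inr c)
    show ?thesis
    proof (cases e)
      case (Inl cx')
      then show ?thesis using inl_inr[of _ _ v c u] d u v count Inr by (cases cx') auto
    next
      case (Inr c')
      then show ?thesis using inr_inr d u v \<open>d = _\<close> by auto
    qed
  qed
qed

section \<open>Full commutativity of the encoded words of type D\<close>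

lemma separated_fold_wordD:
  assumes "separated (n - 1) n (fold_word n u)" "1 \<le> n" "u = a @ y # w @ y' # b"
    "y \<in> {n, Suc n}" "y' \<in> {n, Suc n}"
  shows "n - 1 \<in> set w"
proof -
  have "fold_word n u = fold_word n a @ n # fold_word n w @ n # fold_word n b"
    using assms(3-5) by (auto simp: fold_end_def)
  then have "n - 1 \<in> set (fold_word n w)" by (rule separated_betweenD[OF assms(1)])
  then show ?thesis using assms(2) by (auto simp: fold_end_def split: if_splits)
qed

lemma sublist_braidE:
  assumes "sublist [x, z, x] (proj x z u)"
  obtains A w1 w2 B where "u = A @ x # w1 @ z # w2 @ x # B" "x \<notin> set w1" "z \<notin> set w1"
    "x \<notin> set w2" "z \<notin> set w2"
proof -
  let ?P = "\<lambda>y. y = x \<or> y = z"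
  obtain p q where "filter ?P u = p @ x # z # x # q"
    using assms by (auto simp: sublist_def proj_def)
  then obtain A0 u' where u': "u = A0 @ u'" "filter ?P u' = x # z # x # q"
    by (rule filter_eq_appendE)
  obtain A u'' where u'': "u' = A @ x # u''" "filter ?P u'' = z # x # q"
    using filter_eq_ConsD[OF u'(2)] by metis
  obtain w1 v where w1: "u'' = w1 @ z # v" "\<forall>y\<in>set w1. \<not> ?P y" "filter ?P v = x # q"
    using filter_eq_ConsD[OF u''(2)] by metis
  obtain w2 B where w2: "v = w2 @ x # B" "\<forall>y\<in>set w2. \<not> ?P y"
    using filter_eq_ConsD[OF w1(3)] by metis
  have "u = (A0 @ A) @ x # w1 @ z # w2 @ x # B" using u' u'' w1 w2 by simp
  then show thesis using that w1(2) w2(2) by blast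
qed

text \<open>Any two end letters have an \<open>n - 1\<close> between them. With just one
  \<open>n - 1\<close> between two \<open>y\<close>, no other end letter fits in, and the end
  letters would contain \<open>y\<close> twice in a row.\<close>

lemma no_end_braid:
  assumes sep: "separated (n - 1) n (fold_word n u)" and alt: "distinct_adj (proj n (Suc n) u)"
    and n: "1 \<le> n" and y: "y \<in> {n, Suc n}"
  shows "\<not> sublist [y, n - 1, y] (proj y (n - 1) u)"
proof
  assume "sublist [y, n - 1, y] (proj y (n - 1) u)"
  then obtain A w1 w2 B where u: "u = A @ y # w1 @ (n - 1) # w2 @ y # B"
    and w: "y \<notin> set w1" "n - 1 \<notin> set w1" "y \<notin> set w2" "n - 1 \<notin> set w2"
    by (rule sublist_braidE)
  have "z \<notin> set w1" if z: "z \<in> {n, Suc n}" for z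
  proof
    assume "z \<in> set w1"
    then obtain c d where cd: "w1 = c @ z # d" by (meson split_list)
    then have "u = A @ y # c @ z # (d @ (n - 1) # w2 @ y # B)" using u by simp
    then have "n - 1 \<in> set c" using separated_fold_wordD[OF sep n _ y z] by blast
    then show False using w(2) cd by simp
  qed
  moreover have "z \<notin> set w2" if z: "z \<in> {n, Suc n}" for z
  proof
    assume "z \<in> set w2"
    then obtain c d where cd: "w2 = c @ z # d" by (meson split_list)
    then have "u = (A @ y # w1 @ (n - 1) # c) @ z # d @ y # B" using u by simp
    then have "n - 1 \<in> set d" using separated_fold_wordD[OF sep n _ z y] by blast
    then show False using w(4) cd by simp
  qed
  ultimately have "proj n (Suc n) u = proj n (Suc n) A @ y # y # proj n (Suc n) B"
    using u y n by (auto simp: proj_eq_Nil_iff[THEN iffD2])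
  then show False using alt by (simp add: distinct_adj_append_iff)
qed

text \<open>The commuting end letters both fold to \<open>n\<close>, so swapping them leaves the
  folded word unchanged; the other swaps involve at most one letter of the projection.\<close>

lemma comm_fold_word:
  assumes "(commutation_step {1..Suc n} (matrix_D n))\<^sup>*\<^sup>* u v" "1 \<le> n"
  shows "proj (n - 1) n (fold_word n u) = proj (n - 1) n (fold_word n v)"
  using assms(1)
proof (induction rule: rtranclp_induct)
  case (step v w)
  from step(2) have "proj (n - 1) n (fold_word n v) = proj (n - 1) n (fold_word n w)"
  proof cases
    case (1 s t a b)
    then have "\<not> (s = n - 1 \<and> (t = n \<or> t = Suc n))" "\<not> (t = n - 1 \<and> (s = n \<or> s = Suc n))"
      using assms(2) by (auto simp: matrix_D_simps adj_D_def)
    then show ?thesis using 1 assms(2) by (auto simp: fold_end_def)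
  qed
  then show ?case using step by simp
qed simp

lemma fc_word_D_alternating:
  assumes n: "1 \<le> n" and c: "c \<in> zwalks n" and u: "set u \<subseteq> {1..Suc n}"
    and alt: "alt_spec n c (fold_word n u)" and labels: "distinct_adj (proj n (Suc n) u)"
  shows "small_coxeter.fc_word {1..Suc n} (matrix_D n) u"
proof -
  interpret small_coxeter "{1..Suc n}" "matrix_D n" by (rule small_coxeter_D)
  have end_alt: "distinct_adj (proj (n - 1) n (fold_word n u))"
    using alt n by (auto simp: alt_spec_def dest!: spec[of _ "n - 1"])
  then have sep: "separated (n - 1) n (fold_word n u)"
    using n by (subst (asm) distinct_adj_proj_iff) auto
  have below: "\<exists>t\<in>{1..s}. (Suc t = s \<or> t = s) \<and> \<not> sublist [s, s] (proj s t u)"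
    if s: "1 \<le> s" "s < n" for s
  proof -
    obtain t where "t \<in> {1..s}" "Suc t = s \<or> t = s" "\<not> sublist [s, s] (proj s t (fold_word n u))"
      using alt_spec_below[OF alt c, of s] s by (metis atLeastAtMost_iff less_imp_le)
    then show ?thesis using s proj_fold_word[of s n t u] by auto
  qed
  have above: "\<not> sublist [s, s] (proj s (Suc s) u)" if "Suc s < n" for s
    using alt_spec_above[OF alt, of s] that by (simp add: proj_fold_word)
  have end_square: "\<not> sublist [y, y] (proj y (n - 1) u)" if y: "y \<in> {n, Suc n}" for y
  proof -
    have "separated (n - 1) y u"
      unfolding separated_def using separated_fold_wordD[OF sep n _ y y] by blast
    moreover have "y \<noteq> n - 1" using y n by auto
    ultimately show ?thesis by (simp add: separated_iff_proj)
  qed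
  show ?thesis
  proof (rule fc_wordI_general)
    show "u \<in> lists {1..Suc n}" using u by auto
  next
    fix s assume s: "s \<in> {1..Suc n}"
    show "\<exists>t\<in>{1..Suc n}. matrix_D n s t \<noteq> 2 \<and> \<not> sublist [s, s] (proj s t u)"
    proof (cases "s < n")
      case True
      then obtain t where "t \<in> {1..s}" "Suc t = s \<or> t = s" "\<not> sublist [s, s] (proj s t u)"
        using below[of s] s True by (metis atLeastAtMost_iff)
      then show ?thesis
        using True by (intro bexI[of _ t]) (auto simp: matrix_D_simps adj_D_def)
    next
      case False
      then have y: "s \<in> {n, Suc n}" using s by auto
      show ?thesis
      \<comment> \<open>Here \<open>n - 1\<close> is the phantom generator 0, so the projection to
        it merely counts \<open>s\<close>.\<close>
      proof (cases "n = 1")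
        case True
        have "0 \<notin> set u" using u by auto
        then have "proj s s u = proj s (n - 1) u" using True by (simp add: proj_same proj_absent)
        then show ?thesis using end_square[OF y] s by (intro bexI[of _ s]) (auto simp: matrix_D_simps)
      next
        case False
        then show ?thesis
          using end_square[OF y] y n by (intro bexI[of _ "n - 1"]) (auto simp: matrix_D_simps adj_D_def)
      qed
    qed
  next
    fix s t assume st: "s \<in> {1..Suc n}" "t \<in> {1..Suc n}" "matrix_D n s t = 3"
    then have "adj_D n s t" by (simp add: matrix_D_simps)
    then consider "s < n" "s < t" | "s = Suc t" "Suc s < n" | "s = Suc t" "Suc s = n"
      | "s \<in> {n, Suc n}" "t = n - 1"
      unfolding adj_D_def by force
    then show "\<not> sublist [s, t, s] (proj s t u) \<or>
      (\<exists>t'\<in>{1..Suc n}. t' \<noteq> t \<and> matrix_D n s t' \<noteq> 2 \<and> \<not> sublist [s, s] (proj s t' u)) \<or>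
      (\<forall>v a b. comm u v \<longrightarrow> v \<noteq> a @ [s, t, s] @ b)"
    proof cases
      case 1
      then obtain t' where "t' \<in> {1..s}" "Suc t' = s \<or> t' = s" "\<not> sublist [s, s] (proj s t' u)"
        using below[of s] st(1) 1(1) by (metis atLeastAtMost_iff)
      then show ?thesis
        using 1 by (intro disjI2 disjI1 bexI[of _ t']) (auto simp: matrix_D_simps adj_D_def)
    next
      case 2
      then show ?thesis
        using above[of s] st
        by (intro disjI2 disjI1 bexI[of _ "Suc s"]) (auto simp: matrix_D_simps adj_D_def)
    next
      \<comment> \<open>The braid is n - 1, n - 2, n - 1. Each edge at the fork may show a square of
        \<open>n - 1\<close>, since either end letter can be the separating one; only the folded
        projection alternates, and it is invariant under commutations.\<close>
      case 3
      have "v \<noteq> a @ [s, t, s] @ b" if v: "comm u v" for v a b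
      proof
        assume "v = a @ [s, t, s] @ b"
        then have "proj (n - 1) n (fold_word n v) = proj (n - 1) n (fold_word n a) @
            s # s # proj (n - 1) n (fold_word n b)"
          using 3 by (auto simp: fold_end_def)
        then show False
          using end_alt comm_fold_word[OF v n] by (simp add: distinct_adj_append_iff)
      qed
      then show ?thesis by blast
    next
      case 4
      then show ?thesis using no_end_braid[OF sep labels n 4(1)] by simp
    qed
  qed (simp add: matrix_D_simps)
qed

lemma fc_word_D_zigzag:
  assumes n: "1 \<le> n" and u: "set u \<subseteq> {1..Suc n}"
    and above: "\<And>s. 1 \<le> s \<Longrightarrow> Suc s < n \<Longrightarrow> \<not> sublist [s, s] (proj s (Suc s) u)"
    and braid: "\<And>s. 1 \<le> s \<Longrightarrow> Suc s < n \<Longrightarrow> \<not> sublist [s, Suc s, s] (proj s (Suc s) u) \<or>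
      (\<exists>t\<in>{1..s}. (Suc t = s \<or> t = s) \<and> \<not> sublist [s, s] (proj s t u))"
    and ends: "\<And>y. y \<in> {n, Suc n} \<Longrightarrow> proj (n - 1) y u = [y] \<or> proj (n - 1) y u = [n - 1, y, n - 1]"
  shows "small_coxeter.fc_word {1..Suc n} (matrix_D n) u"
proof -
  interpret small_coxeter "{1..Suc n}" "matrix_D n" by (rule small_coxeter_D)
  have end_square: "\<not> sublist [n - 1, n - 1] (proj (n - 1) y u)" if "y \<in> {n, Suc n}" for y
  proof -
    have "y \<noteq> n - 1" using that n by auto
    then show ?thesis using ends[OF that] by (auto simp: sublist_Cons_right)
  qed
  have once: "\<not> sublist [y, y] (proj y y u)" if "y \<in> {n, Suc n}" for y
  proof -
    have "y \<noteq> n - 1" using that n by auto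
    then have "count_list u y = 1" using ends[OF that] count_proj[of y "n - 1" y u] by auto
    then show ?thesis using sublist_square_same[of y u] by auto
  qed
  show ?thesis
  proof (rule fc_wordI)
    show "u \<in> lists {1..Suc n}" using u by auto
  next
    fix s assume s: "s \<in> {1..Suc n}"
    then consider "Suc s < n" | "Suc s = n" | "s \<in> {n, Suc n}" by force
    then show "\<exists>t\<in>{1..Suc n}. matrix_D n s t \<noteq> 2 \<and> \<not> sublist [s, s] (proj s t u)"
    proof cases
      case 1
      then show ?thesis
        using above[of s] s by (intro bexI[of _ "Suc s"]) (auto simp: matrix_D_simps adj_D_def)
    next
      case 2
      then show ?thesis
        using end_square[of n] by (intro bexI[of _ n]) (auto simp: matrix_D_simps adj_D_def)
    next
      case 3
      then show ?thesis using once[of s] s by (intro bexI[of _ s]) (auto simp: matrix_D_simps)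
    qed
  next
    fix s t assume st: "s \<in> {1..Suc n}" "t \<in> {1..Suc n}" "matrix_D n s t = 3"
    then have "adj_D n s t" by (simp add: matrix_D_simps)
    then consider "t = Suc s" "t < n" | "Suc s = n" "t \<in> {n, Suc n}" | "s = Suc t" "Suc s < n"
      | "s = Suc t" "Suc s = n" | "s \<in> {n, Suc n}" "t = n - 1"
      unfolding adj_D_def by force
    then show "\<not> sublist [s, t, s] (proj s t u) \<or>
      (\<exists>t'\<in>{1..Suc n}. t' \<noteq> t \<and> matrix_D n s t' \<noteq> 2 \<and> \<not> sublist [s, s] (proj s t' u))"
    proof cases
      case 1
      have "1 \<le> s" "Suc s < n" using 1 st by auto
      from braid[OF this]
      consider "\<not> sublist [s, Suc s, s] (proj s (Suc s) u)"
        | t' where "t' \<in> {1..s}" "Suc t' = s \<or> t' = s" "\<not> sublist [s, s] (proj s t' u)" by blast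
      then show ?thesis
      proof cases
        case (2 t')
        then show ?thesis
          using 1 by (intro disjI2 bexI[of _ t']) (auto simp: matrix_D_simps adj_D_def)
      qed (simp add: 1)
    next
      case 2
      \<comment> \<open>The other end letter lies between any two \<open>n - 1\<close> as well, so
        no braid with \<open>t\<close> alone can form.\<close>
      define y where "y = (if t = n then Suc n else n)"
      have "y \<in> {n, Suc n}" "y \<noteq> t" using 2 by (auto simp: y_def)
      then show ?thesis
        using 2 end_square[of y]
        by (intro disjI2 bexI[of _ y]) (auto simp: matrix_D_simps adj_D_def)
    next
      case 3
      then show ?thesis
        using above[of s] st
        by (intro disjI2 bexI[of _ "Suc s"]) (auto simp: matrix_D_simps adj_D_def)
    next
      case 4
      then show ?thesis
        using end_square[of n] by (intro disjI2 bexI[of _ n]) (auto simp: matrix_D_simps adj_D_def)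
    next
      case 5
      then have "s \<noteq> t" using n by auto
      then show ?thesis
        using once[of s] 5 st by (intro disjI2 bexI[of _ s]) (auto simp: matrix_D_simps)
    qed
  qed (simp add: matrix_D_simps)
qed

lemma D_spec_fc_word:
  assumes d: "d \<in> D_data n" and u: "D_spec n d u" and n: "1 \<le> n"
  shows "small_coxeter.fc_word {1..Suc n} (matrix_D n) u"
  using d
proof (cases rule: D_data_cases)
  case (none c)
  then show ?thesis using u n by (intro fc_word_D_alternating[of n c]) (auto simp: D_spec_def)
next
  case (odd c x)
  then show ?thesis using u n by (intro fc_word_D_alternating[of n c]) (auto simp: D_spec_def)
next
  case (zig p c)
  then have z: "zig_spec (n - 1) p c u" using u by (simp add: D_spec_def)
  show ?thesis
  proof (rule fc_word_D_zigzag[OF n])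
    show "\<not> sublist [s, s] (proj s (Suc s) u)" if "1 \<le> s" "Suc s < n" for s
      using zig_spec_no_square[OF z] that by auto
    show "\<not> sublist [s, Suc s, s] (proj s (Suc s) u) \<or>
      (\<exists>t\<in>{1..s}. (Suc t = s \<or> t = s) \<and> \<not> sublist [s, s] (proj s t u))"
      if "1 \<le> s" "Suc s < n" for s
      using zig_spec_no_braid[OF z, of s] zig_spec_below[OF z zig(4), of s] that
      by (cases "p \<le> s") auto
  qed (use u zig in \<open>auto simp: D_spec_def\<close>)
next
  case (fork c)
  have below: "\<exists>t\<in>{1..s}. (Suc t = s \<or> t = s) \<and> \<not> sublist [s, s] (proj s t u)"
    if s: "1 \<le> s" "s < n" for s
  proof (cases "s = 1")
    case True
    have "c ! 1 \<le> 1" using fork(2) s True by (auto simp: zwalks_def zstep_def dest!: spec[of _ 0])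
    then have "count_list u 1 \<le> 1" using u fork s True by (auto simp: D_spec_def)
    then show ?thesis using True sublist_square_same[of 1 u] by auto
  next
    case False
    then have "distinct_adj (proj (s - 1) s u)"
      using u fork s by (auto simp: D_spec_def dest!: spec[of _ "s - 1"])
    then have "\<not> sublist [s, s] (proj s (s - 1) u)" by (rule alternating_no_square(2))
    then show ?thesis using False s by (intro bexI[of _ "s - 1"]) auto
  qed
  show ?thesis
  proof (rule fc_word_D_zigzag[OF n])
    show "\<not> sublist [s, s] (proj s (Suc s) u)" if "1 \<le> s" "Suc s < n" for s
      using u fork that by (intro alternating_no_square) (auto simp: D_spec_def)
    fix y assume y: "y \<in> {n, Suc n}"
    have "\<forall>y\<in>{n, Suc n}. proj (n - 1) y u =
        (if length c - 1 = n \<and> c ! (n - 1) = 0 then [y] else [n - 1, y, n - 1])"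
      using u unfolding D_spec_def fork(1) sum.case by blast
    from bspec[OF this y] show "proj (n - 1) y u = [y] \<or> proj (n - 1) y u = [n - 1, y, n - 1]"
      by metis
  qed (use u below in \<open>auto simp: D_spec_def\<close>)
qed

text \<open>The first end letter after the closing \<open>n - 1\<close> has an equal one in
  \<open>w\<close>, so a second \<open>n - 1\<close> precedes it; but between these two
  \<open>n - 1\<close> an end letter would have to occur even earlier. Without end letters no
  further \<open>n - 1\<close> is possible.\<close>

lemma fork_after:
  assumes two: "\<And>y a w b. y \<in> {n, Suc n} \<Longrightarrow> u = a @ y # w @ y # b \<Longrightarrow> 2 \<le> count_list w (n - 1)"
    and some: "\<And>a w b. u = a @ (n - 1) # w @ (n - 1) # b \<Longrightarrow> n \<in> set w \<or> Suc n \<in> set w"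
    and u: "u = a @ (n - 1) # w @ (n - 1) # b" "n - 1 \<notin> set w" "n \<in> set w" "Suc n \<in> set w"
  shows "n - 1 \<notin> set b" "n \<notin> set b" "Suc n \<notin> set b"
proof -
  have "\<not> (\<exists>y\<in>set b. y \<in> {n, Suc n})"
  proof
    assume "\<exists>y\<in>set b. y \<in> {n, Suc n}"
    then obtain b1 y b2 where b: "b = b1 @ y # b2" "y \<in> {n, Suc n}" "\<forall>z\<in>set b1. z \<notin> {n, Suc n}"
      using split_list_first_prop[of b "\<lambda>y. y \<in> {n, Suc n}"] by blast
    then have "y \<in> set w" using u by auto
    then obtain w1 w2 where w: "w = w1 @ y # w2" by (meson split_list)
    have "u = (a @ (n - 1) # w1) @ y # (w2 @ (n - 1) # b1) @ y # b2" using u w b by simp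
    then have "2 \<le> count_list (w2 @ (n - 1) # b1) (n - 1)" by (rule two[OF b(2)])
    then have "count_list b1 (n - 1) \<noteq> 0" using u(2) w by (simp add: count_list_0_iff[THEN iffD2])
    then have "n - 1 \<in> set b1" by (simp add: count_list_0_iff)
    then obtain c d where cd: "b1 = c @ (n - 1) # d" by (meson split_list)
    then have "u = (a @ (n - 1) # w) @ (n - 1) # c @ (n - 1) # (d @ y # b2)" using u b by simp
    then have "n \<in> set c \<or> Suc n \<in> set c" by (rule some)
    then show False using b(3) cd by auto
  qed
  then show b: "n \<notin> set b" "Suc n \<notin> set b" by auto
  show "n - 1 \<notin> set b"
  proof
    assume "n - 1 \<in> set b"
    then obtain c d where cd: "b = c @ (n - 1) # d" by (meson split_list)
    then have "u = (a @ (n - 1) # w) @ (n - 1) # c @ (n - 1) # d" using u by simp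
    then have "n \<in> set c \<or> Suc n \<in> set c" by (rule some)
    then show False using b cd by auto
  qed
qed

text \<open>Since every \<open>n - 1\<close> lies to the right of the pair, there is only one
  \<open>n - 1\<close> and only one \<open>y\<close>, and the projection \<open>[y, n - 1]\<close>
  is not a palindrome.\<close>

lemma fork_between_aux:
  assumes two: "\<And>y a w b. y \<in> {n, Suc n} \<Longrightarrow> u = a @ y # w @ y # b \<Longrightarrow> 2 \<le> count_list w (n - 1)"
    and some: "\<And>a w b. u = a @ (n - 1) # w @ (n - 1) # b \<Longrightarrow> n \<in> set w \<or> Suc n \<in> set w"
    and pal: "rev (proj (n - 1) y u) = proj (n - 1) y u"
    and n: "1 \<le> n" and u: "u = a @ y # w @ y' # b" and y: "{y, y'} = {n, Suc n}"
    and N: "n - 1 \<notin> set w" "n - 1 \<notin> set a" "n - 1 \<in> set b"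
  shows False
proof -
  have y_in: "y \<in> {n, Suc n}" "y' \<in> {n, Suc n}" and "y \<noteq> y'" using y by (auto simp: doubleton_eq_iff)
  have yN: "y \<noteq> n - 1" "y' \<noteq> n - 1" using y_in n by auto
  obtain b1 b2 where b: "b = b1 @ (n - 1) # b2" "n - 1 \<notin> set b1"
    using N(3) by (meson split_list_first)
  have b2: "n - 1 \<notin> set b2"
  proof
    assume "n - 1 \<in> set b2"
    then obtain c d where cd: "b2 = c @ (n - 1) # d" "n - 1 \<notin> set c" by (meson split_list_first)
    have "u = (a @ y # w @ y' # b1) @ (n - 1) # c @ (n - 1) # d" using u b cd by simp
    then have "n \<in> set c \<or> Suc n \<in> set c" by (rule some)
    then have "y \<in> set c \<or> y' \<in> set c" using y by (auto simp: doubleton_eq_iff)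
    then show False
    proof
      assume "y \<in> set c"
      then obtain c1 c2 where c: "c = c1 @ y # c2" by (meson split_list)
      have "u = a @ y # (w @ y' # b1 @ (n - 1) # c1) @ y # (c2 @ (n - 1) # d)"
        using u b cd c by simp
      from two[OF y_in(1) this] show False
        using N b cd c yN by (simp add: count_list_0_iff[THEN iffD2])
    next
      assume "y' \<in> set c"
      then obtain c1 c2 where c: "c = c1 @ y' # c2" by (meson split_list)
      have "u = (a @ y # w) @ y' # (b1 @ (n - 1) # c1) @ y' # (c2 @ (n - 1) # d)"
        using u b cd c by simp
      from two[OF y_in(2) this] show False
        using N b cd c yN by (simp add: count_list_0_iff[THEN iffD2])
    qed
  qed
  have "y \<notin> set a"
  proof
    assume "y \<in> set a"
    then obtain c d where cd: "a = c @ y # d" by (meson split_list)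
    then have "u = c @ y # d @ y # (w @ y' # b)" using u by simp
    from two[OF y_in(1) this] show False using N cd by (simp add: count_list_0_iff[THEN iffD2])
  qed
  moreover have "y \<notin> set w \<union> set b"
  proof
    assume "y \<in> set w \<union> set b"
    then have "y \<in> set (w @ y' # b)" by auto
    then obtain c d where cd: "w @ y' # b = c @ y # d" by (meson split_list)
    then have "u = a @ y # c @ y # d" using u by simp
    from two[OF y_in(1) this] have "2 \<le> count_list (w @ y' # b) (n - 1)" unfolding cd by simp
    then show False using N b b2 yN by (simp add: count_list_0_iff[THEN iffD2])
  qed
  ultimately have "proj (n - 1) y u = [y, n - 1]"
    using u b b2 N(1,2) \<open>y \<noteq> y'\<close> yN by (auto simp: proj_eq_Nil_iff[THEN iffD2])
  then have "rev [y, n - 1] = [y, n - 1]" using pal by metis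
  then have "hd (rev [y, n - 1]) = hd [y, n - 1]" by (rule arg_cong)
  then show False using yN(1) by simp
qed

text \<open>Two equal end letters are handled by \<open>two\<close>. Different ones with an
  \<open>n - 1\<close> on both sides would be enclosed together, against \<open>not_both\<close>;
  with \<open>n - 1\<close> on one side only, \<open>fork_between_aux\<close> applies to the word or
  to its reversal.\<close>

lemma fork_between:
  assumes two: "\<And>y a w b. y \<in> {n, Suc n} \<Longrightarrow> u = a @ y # w @ y # b \<Longrightarrow> 2 \<le> count_list w (n - 1)"
    and some: "\<And>a w b. u = a @ (n - 1) # w @ (n - 1) # b \<Longrightarrow> n \<in> set w \<or> Suc n \<in> set w"
    and not_both: "\<And>a w b. u = a @ (n - 1) # w @ (n - 1) # b \<Longrightarrow> n - 1 \<notin> set w \<Longrightarrow>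
      n \<notin> set w \<or> Suc n \<notin> set w"
    and pal: "\<And>y. y \<in> {n, Suc n} \<Longrightarrow> rev (proj (n - 1) y u) = proj (n - 1) y u"
    and n: "1 \<le> n" and N: "n - 1 \<in> set u"
  shows "separated (n - 1) n (fold_word n u)"
  unfolding separated_def
proof (intro allI impI)
  fix a' w' b' assume "fold_word n u = a' @ n # w' @ n # b'"
  then obtain a r where ar: "u = a @ r" "fold_word n r = n # w' @ n # b'"
    by (metis map_eq_append_conv)
  then obtain y r' where yr: "r = y # r'" "fold_end n y = n" "fold_word n r' = w' @ n # b'"
    by auto
  then obtain w s where ws: "r' = w @ s" "w' = fold_word n w" "fold_word n s = n # b'"
    by (metis map_eq_append_conv)
  then obtain y' b where yb: "s = y' # b" "fold_end n y' = n"
    by auto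
  have u: "u = a @ y # w @ y' # b" and w': "w' = fold_word n w" using ar yr ws yb by auto
  have y: "y \<in> {n, Suc n}" "y' \<in> {n, Suc n}"
    using yr(2) yb(2) by (auto simp: fold_end_def split: if_splits)
  have "n - 1 \<in> set w"
  proof (rule ccontr)
    assume w: "n - 1 \<notin> set w"
    have "y \<noteq> y'"
      using two[OF y(1), of a w b] u w by (auto simp: count_list_0_iff[THEN iffD2])
    then have yy: "{y, y'} = {n, Suc n}" "{y', y} = {n, Suc n}" using y by auto
    have ab_cases: "n - 1 \<in> set a \<or> n - 1 \<in> set b" using N u w y n by auto
    have both: False if ab: "n - 1 \<in> set a" "n - 1 \<in> set b"
    proof -
      obtain a1 a2 where a: "a = a1 @ (n - 1) # a2" "n - 1 \<notin> set a2"
        using ab(1) by (meson split_list_last)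
      obtain b1 b2 where b: "b = b1 @ (n - 1) # b2" "n - 1 \<notin> set b1"
        using ab(2) by (meson split_list_first)
      have "u = a1 @ (n - 1) # (a2 @ y # w @ y' # b1) @ (n - 1) # b2" using u a b by simp
      moreover have N: "n - 1 \<noteq> n" "n - 1 \<noteq> Suc n" using n by auto
      then have "n - 1 \<notin> set (a2 @ y # w @ y' # b1)" using a(2) b(2) w y by auto
      ultimately have "n \<notin> set (a2 @ y # w @ y' # b1) \<or> Suc n \<notin> set (a2 @ y # w @ y' # b1)"
        by (rule not_both)
      then show False using yy(1) by (auto simp: doubleton_eq_iff)
    qed
    have right: False if "n - 1 \<notin> set a" "n - 1 \<in> set b"
      using fork_between_aux[of n u y a w y' b] two some pal[OF y(1)] n u yy w that by blast
    have left: False if "n - 1 \<in> set a" "n - 1 \<notin> set b"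
    proof (rule fork_between_aux[of n "rev u" y' "rev b" "rev w" y "rev a"])
      fix z p q r assume "z \<in> {n, Suc n}" "rev u = p @ z # q @ z # r"
      then have "u = rev r @ z # rev q @ z # rev p" by (simp add: rev_swap)
      from two[OF \<open>z \<in> _\<close> this] show "2 \<le> count_list q (n - 1)" by simp
    next
      fix p q r assume "rev u = p @ (n - 1) # q @ (n - 1) # r"
      then have "u = rev r @ (n - 1) # rev q @ (n - 1) # rev p" by (simp add: rev_swap)
      from some[OF this] show "n \<in> set q \<or> Suc n \<in> set q" by simp
    next
      show "rev (proj (n - 1) y' (rev u)) = proj (n - 1) y' (rev u)"
        unfolding proj_simps(4) pal[OF y(2)] ..
      show "rev u = rev b @ y' # rev w @ y # rev a" using u by simp
      show "n - 1 \<notin> set (rev w)" "n - 1 \<notin> set (rev b)" "n - 1 \<in> set (rev a)"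
        using w that by simp_all
    qed (fact n yy(2))+
    show False
      using ab_cases both left right by (cases "n - 1 \<in> set a"; cases "n - 1 \<in> set b") simp_all
  qed
  then have "fold_end n (n - 1) \<in> set w'" using w' by simp
  moreover have "fold_end n (n - 1) = n - 1" by (simp add: fold_end_def)
  ultimately show "n - 1 \<in> set w'" by simp
qed

text \<open>By symmetry as many \<open>n - 1\<close> precede the first \<open>x\<close> as follow
  the last one. The latter comprise those in \<open>e\<close> and at least one between the last
  \<open>x\<close> and the \<open>y\<close>.\<close>

lemma fork_parity:
  assumes sep: "separated (n - 1) n (fold_word n u)" and n: "1 \<le> n"
    and pal: "rev (proj (n - 1) x u) = proj (n - 1) x u"
    and u: "u = a @ x # m @ y # e" and xy: "{x, y} = {n, Suc n}"
    and x: "x \<notin> set a" "x \<notin> set e"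
  shows "count_list e (n - 1) < count_list a (n - 1)"
proof -
  have in_labels: "x \<in> {n, Suc n}" "y \<in> {n, Suc n}" and "x \<noteq> y"
    using xy by (auto simp: doubleton_eq_iff)
  have N: "x \<noteq> n - 1" "y \<noteq> n - 1" using in_labels n by auto
  obtain g h where gh: "x # m = g @ x # h" "x \<notin> set h"
    using split_list_last[of x "x # m"] by auto
  have u2: "u = (a @ g) @ x # h @ y # e" using u gh(1) by (metis append_Cons append_assoc)
  have "n - 1 \<in> set h" by (rule separated_fold_wordD[OF sep n u2 in_labels])
  then have h: "count_list h (n - 1) \<noteq> 0" by (simp add: count_list_0_iff)
  have take: "takeWhile (\<lambda>z. z \<noteq> x) (s @ x # r) = s" if "x \<notin> set s" for s r
    using that by (subst takeWhile_append2) auto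
  have "proj (n - 1) x u = proj (n - 1) x a @ x # proj (n - 1) x (m @ y # e)" using u by simp
  then have "takeWhile (\<lambda>z. z \<noteq> x) (proj (n - 1) x u) = proj (n - 1) x a"
    using x(1) by (simp only:) (rule take, simp)
  moreover have "rev (proj (n - 1) x u) = (rev (proj (n - 1) x e) @ rev (proj (n - 1) x h)) @
      x # rev (proj (n - 1) x (a @ g))"
    using u2 \<open>x \<noteq> y\<close> N by simp
  then have "takeWhile (\<lambda>z. z \<noteq> x) (rev (proj (n - 1) x u)) =
      rev (proj (n - 1) x e) @ rev (proj (n - 1) x h)"
    using x(2) gh(2) by (simp only:) (rule take, simp)
  ultimately have "length (proj (n - 1) x a) = length (rev (proj (n - 1) x e) @ rev (proj (n - 1) x h))"
    using pal by metis
  then show ?thesis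
    using x gh(2) h by (simp add: proj_absent)
qed

lemma fork_walk:
  assumes "1 \<le> n" "0 \<notin> set u"
    and "\<And>i. Suc i < n \<Longrightarrow> zstep (count_list u i) (count_list u (Suc i))"
    and "count_list u (n - 1) \<in> {0, 2}"
  shows "map (count_list u) [0..<n] @ [1] \<in> zwalks n" (is "?c \<in> _")
  unfolding zwalks_def
proof (intro CollectI conjI allI impI)
  have nth: "?c ! i = count_list u i" if "i < n" for i
    using that by (simp add: nth_append)
  show "length ?c = Suc n" by simp
  show "?c ! 0 = 0" using nth[of 0] assms(1,2) by (simp add: count_list_0_iff)
  fix i assume i: "i < n"
  show "zstep (?c ! i) (?c ! Suc i)"
  proof (cases "Suc i = n")
    case True
    then have "i = n - 1" by simp
    then show ?thesis using assms(4) nth[OF i] True by (auto simp: zstep_def nth_append)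
  qed (use i nth assms(3) in simp)
qed

lemma length_filter_three:
  assumes "distinct [p, q, r]"
  shows "length (filter (\<lambda>x. x = p \<or> x = q \<or> x = r) w) =
    count_list w p + count_list w q + count_list w r"
  using assms by (induction w) auto

text \<open>A nonempty alternating sequence of even length begins and ends with different letters,
  and \<open>fork_parity\<close> applied from both sides gives two opposite strict
  inequalities.\<close>

lemma odd_label_count:
  assumes n: "1 \<le> n" and sep: "separated (n - 1) n (fold_word n u)"
    and alt: "distinct_adj (proj n (Suc n) u)"
    and pal: "\<And>y. y \<in> {n, Suc n} \<Longrightarrow> rev (proj (n - 1) y u) = proj (n - 1) y u"
    and nonempty: "proj n (Suc n) u \<noteq> []"
  shows "odd (length (proj n (Suc n) u))"
proof (rule ccontr)
  let ?v = "proj n (Suc n) u"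
  assume even: "\<not> odd (length ?v)"
  obtain x where x: "x = hd ?v" by blast
  define y where "y = (if x = n then Suc n else n)"
  have "x \<in> {n, Suc n}" using hd_in_set[OF nonempty] x by auto
  then have xy: "{x, y} = {n, Suc n}" "{y, x} = {n, Suc n}" "x \<noteq> y" by (auto simp: y_def)
  have sv: "set ?v \<subseteq> {x, y}" unfolding xy by auto
  have "length ?v = count_list ?v x + count_list ?v y"
    using sum_count_set[OF sv] xy(3) by simp
  moreover have "count_list ?v x = count_list ?v y + (if last ?v = x then 1 else 0)"
    by (rule alternating_count[OF alt sv xy(3) nonempty x[symmetric]])
  ultimately have "last ?v \<noteq> x" using even by auto
  moreover have "last ?v \<in> {x, y}" using sv last_in_set[OF nonempty] by blast
  ultimately have last: "last ?v = y" by blast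
  let ?P = "\<lambda>z. z = n \<or> z = Suc n"
  obtain v' where v': "?v = x # v'" using x nonempty by (cases ?v) auto
  have "v' \<noteq> []" using even v' by auto
  then obtain v'' where v'': "v' = v'' @ [y]" using last v' by (metis append_butlast_last_id last_ConsR)
  obtain a u' where a: "u = a @ x # u'" "\<forall>z\<in>set a. \<not> ?P z" "filter ?P u' = v'' @ [y]"
    using filter_eq_ConsD[of ?P u x v'] v' v'' unfolding proj_def by metis
  obtain m0 r where m0: "u' = m0 @ r" "filter ?P r = [y]" using filter_eq_appendE[OF a(3)] by metis
  obtain m1 e where e: "r = m1 @ y # e" "filter ?P e = []"
    using filter_eq_ConsD[OF m0(2)] by metis
  have u: "u = a @ x # (m0 @ m1) @ y # e" using a m0 e by simp
  have ends: "\<forall>z\<in>set a. z \<noteq> x \<and> z \<noteq> y" "\<forall>z\<in>set e. z \<noteq> x \<and> z \<noteq> y"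
    using a(2) e(2) \<open>x \<in> _\<close> by (auto simp: filter_empty_conv y_def)
  have "count_list e (n - 1) < count_list a (n - 1)"
  proof (rule fork_parity[OF sep n _ u xy(1)])
    show "rev (proj (n - 1) x u) = proj (n - 1) x u" using pal \<open>x \<in> _\<close> by blast
  qed (use ends in blast)+
  moreover have "count_list (rev a) (n - 1) < count_list (rev e) (n - 1)"
  proof (rule fork_parity[OF _ n _ _ xy(2)])
    show "separated (n - 1) n (fold_word n (rev u))" using sep by (simp add: rev_map[symmetric])
    have "y \<in> {n, Suc n}" by (simp add: y_def)
    then show "rev (proj (n - 1) y (rev u)) = proj (n - 1) y (rev u)"
      unfolding proj_simps(4) by (simp only: pal)
    show "rev u = rev e @ y # rev (m0 @ m1) @ x # rev a" using u by simp
  qed (use ends in auto)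
  ultimately show False by simp
qed

lemma D_spec_of_fc_word:
  assumes n: "1 \<le> n" and fc: "small_coxeter.fc_word {1..Suc n} (matrix_D n) u"
    and self_dual: "(commutation_step {1..Suc n} (matrix_D n))\<^sup>*\<^sup>* u (rev u)"
  shows "\<exists>d\<in>D_data n. D_spec n d u"
proof -
  interpret small_coxeter "{1..Suc n}" "matrix_D n" by (rule small_coxeter_D)
  have set: "set u \<subseteq> {1..Suc n}" using fc_wordD(1)[OF fc] by auto
  have u0: "0 \<notin> set u" using set by auto
  have gap: "2 \<le> length (filter (\<lambda>x. x \<noteq> i \<and> adj_D n i x) w)"
    if "u = a @ i # w @ i # b" "i \<notin> set w" for a i w b
  proof -
    have "filter (\<lambda>x. matrix_D n i x \<noteq> 2) w = filter (\<lambda>x. x \<noteq> i \<and> adj_D n i x) w"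
      using that(2) by (intro filter_cong) (auto simp: matrix_D_simps)
    then show ?thesis using fc_word_gap[OF fc that] by (simp add: matrix_D_simps)
  qed
  have gap_path: "2 \<le> count_list w (i - 1) + count_list w (i + 1)"
    if g: "u = a @ i # w @ i # b" "i \<notin> set w" and i: "Suc i < n" for a i w b
  proof -
    have "i \<noteq> 0" using g(1) u0 by auto
    then have "filter (\<lambda>x. x \<noteq> i \<and> adj_D n i x) w = filter (\<lambda>x. x = i - 1 \<or> x = i + 1) w"
      using i by (intro filter_cong) (auto simp: adj_D_def)
    then show ?thesis using gap[OF g] by (simp add: length_filter_two)
  qed
  have gap_N: "2 \<le> count_list w (n - 2) + count_list w n + count_list w (Suc n)"
    if g: "u = a @ (n - 1) # w @ (n - 1) # b" "n - 1 \<notin> set w" for a w b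
  proof -
    have "n - 1 \<noteq> 0" using g(1) u0 by auto
    then have n2: "2 \<le> n" by simp
    then have "filter (\<lambda>x. x \<noteq> n - 1 \<and> adj_D n (n - 1) x) w =
        filter (\<lambda>x. x = n - 2 \<or> x = n \<or> x = Suc n) w"
      by (intro filter_cong) (auto simp: adj_D_def)
    moreover have "distinct [n - 2, n, Suc n]" using n2 by auto
    ultimately show ?thesis using gap[OF g] by (simp only: length_filter_three)
  qed
  have gap_end: "2 \<le> count_list w (n - 1)"
    if g: "u = a @ y # w @ y # b" "y \<notin> set w" and y: "y \<in> {n, Suc n}" for a w b y
  proof -
    have "filter (\<lambda>x. x \<noteq> y \<and> adj_D n y x) w = filter (\<lambda>x. x = n - 1 \<or> x = n - 1) w"
      using y n by (intro filter_cong) (auto simp: adj_D_def)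
    then have "2 \<le> length (filter (\<lambda>x. x = n - 1) w)" using gap[OF g] by simp
    also have "filter (\<lambda>x. x = n - 1) w = proj (n - 1) (n - 1) w" by (simp add: proj_def)
    finally show ?thesis by (simp add: proj_same)
  qed
  have two: "2 \<le> count_list w (n - 1)"
    if y: "y \<in> {n, Suc n}" and w: "u = a @ y # w @ y # b" for a w b y
  proof (cases "y \<in> set w")
    case True
    then obtain w1 w2 where w12: "w = w1 @ y # w2" "y \<notin> set w1" by (meson split_list_first)
    then have "u = a @ y # w1 @ y # (w2 @ y # b)" using w by simp
    then have "2 \<le> count_list w1 (n - 1)" using w12(2) y by (rule gap_end)
    then show ?thesis using w12 by simp
  qed (use gap_end[OF w] y in blast)
  have crowded: "crowded i u" if "Suc i < n" for i
    unfolding crowded_def using gap_path that by blast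
  have left: "separated (Suc i) i u" if "Suc i < n" for i
  proof (rule chain_left[of u "n - 2"])
    show "0 \<notin> set u" by (rule u0)
    show "i \<le> n - 2" using that by simp
    fix i a w b
    assume *: "1 \<le> i" "i \<le> n - 2" "u = a @ i # w @ i # b" "i \<notin> set w" "Suc i \<notin> set w"
    then have "2 \<le> count_list w (i - 1) + count_list w (i + 1)" using that by (intro gap_path[of a i w b]) auto
    then show "2 \<le> count_list w (i - 1)" using * by (simp add: count_list_0_iff[THEN iffD2])
  qed
  have few: "count_list w (n - 2) \<le> 1" if "u = a @ w @ b" "n - 1 \<notin> set w" for a w b
  proof (cases "n = 1")
    case True
    have "0 \<notin> set w" using that(1) u0 by auto
    then show ?thesis using True by (simp add: count_list_0_iff[THEN iffD2])
  next
    case False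
    then have n2: "n - 1 = Suc (n - 2)" "Suc (n - 2) < n" using n by auto
    have "separated (n - 1) (n - 2) u" using left[OF n2(2)] n2(1) by simp
    then show ?thesis using that by (rule separated_count_le)
  qed
  \<comment> \<open>A gap between consecutive \<open>n - 1\<close> needs two neighbours, and at most
    one of them is an \<open>n - 2\<close>.\<close>
  have some: "n \<in> set w \<or> Suc n \<in> set w" if "u = a @ (n - 1) # w @ (n - 1) # b" for a w b
  proof -
    have *: "n \<in> set w \<or> Suc n \<in> set w"
      if g: "u = a @ (n - 1) # w @ (n - 1) # b" "n - 1 \<notin> set w" for a w b
    proof -
      have "u = (a @ [n - 1]) @ w @ ((n - 1) # b)" using g(1) by simp
      then have "count_list w (n - 2) \<le> 1" using g(2) by (rule few)
      then have "count_list w n \<noteq> 0 \<or> count_list w (Suc n) \<noteq> 0" using gap_N[OF g] by auto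
      then show ?thesis by (simp add: count_list_0_iff)
    qed
    show ?thesis
    proof (cases "n - 1 \<in> set w")
      case True
      then obtain w1 w2 where w12: "w = w1 @ (n - 1) # w2" "n - 1 \<notin> set w1"
        by (meson split_list_first)
      then have "u = a @ (n - 1) # w1 @ (n - 1) # (w2 @ (n - 1) # b)" using that by simp
      then have "n \<in> set w1 \<or> Suc n \<in> set w1" using w12(2) by (rule *)
      then show ?thesis using w12 by auto
    qed (use * that in blast)
  qed
  have sep_y: "separated (n - 1) y u" if "y \<in> {n, Suc n}" for y
    unfolding separated_def using two[OF that] by (metis count_list_0_iff not_numeral_le_zero)
  have pal_i: "rev (proj i (Suc i) u) = proj i (Suc i) u" if "Suc i < n" for i
  proof (cases "i = 0")
    case True
    then show ?thesis using u0 by (simp add: proj_commute[of 0] proj_absent)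
  next
    case False
    then show ?thesis
      using that by (intro palindrome_proj[OF self_dual]) (auto simp: matrix_D_simps adj_D_def)
  qed
  have pal_y: "rev (proj (n - 1) y u) = proj (n - 1) y u" if y: "y \<in> {n, Suc n}" for y
  proof (cases "n = 1")
    case True
    then show ?thesis using u0 by (simp add: proj_commute[of 0] proj_absent)
  next
    case False
    then show ?thesis
      using y n by (intro palindrome_proj[OF self_dual]) (auto simp: matrix_D_simps adj_D_def)
  qed
  have right: "separated i (Suc i) u" if "separated (n - 2) (n - 1) u" "Suc i < n" for i
  proof -
    have "separated (n - 2) (Suc (n - 2)) u" using that by (simp add: numeral_2_eq_2 Suc_diff_Suc)
    then show ?thesis using that by (intro chain_right[of i "n - 2"] crowded) auto
  qed
  have zs: "zstep (count_list u i) (count_list u (Suc i))"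
    if "separated (n - 2) (n - 1) u" "Suc i < n" for i
    by (rule zstep_of_proj[OF right[OF that] left[OF that(2)] pal_i[OF that(2)]])
  \<comment> \<open>Turning point \<open>n\<close>: each end letter occurs once, between two
    \<open>n - 1\<close> or in a word without \<open>n - 1\<close>.\<close>
  have fork: "\<exists>d\<in>D_data n. D_spec n d u"
    if sep: "separated (n - 2) (n - 1) u"
      and proj: "count_list u (n - 1) = 0 \<and> (\<forall>y\<in>{n, Suc n}. proj (n - 1) y u = [y]) \<or>
        count_list u (n - 1) = 2 \<and> (\<forall>y\<in>{n, Suc n}. proj (n - 1) y u = [n - 1, y, n - 1])"
  proof -
    let ?c = "map (count_list u) [0..<n] @ [1]"
    have c: "?c \<in> zwalks n" using n u0 zs[OF sep] proj by (intro fork_walk) auto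
    have nth: "?c ! i = count_list u i" if "i < n" for i using that by (simp add: nth_append)
    have "?c ! n = 1" by (simp add: nth_append)
    then have "?c \<in> (\<Union>p\<in>{1..n}. {c \<in> zwalks p. c ! p = 1})" using c n by auto
    then have "Inr ?c \<in> D_data n" unfolding D_data_def by blast
    moreover have "D_spec n (Inr ?c) u"
      unfolding D_spec_def sum.case
    proof (intro conjI)
      have alt: "distinct_adj (proj i (Suc i) u)" if "Suc i < n" for i
        using right[OF sep that] left[OF that] by (simp add: distinct_adj_proj_iff)
      show "if length ?c - 1 < n then zig_spec (n - 1) (length ?c - 1) ?c u
        else (\<forall>i<n. count_list u i = ?c ! i) \<and>
          (\<forall>i. Suc i < n \<longrightarrow> distinct_adj (proj i (Suc i) u))"
        using nth alt by simp
      show "\<forall>y\<in>{n, Suc n}. proj (n - 1) y u =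
          (if length ?c - 1 = n \<and> ?c ! (n - 1) = 0 then [y] else [n - 1, y, n - 1])"
        using proj nth[of "n - 1"] n by auto
    qed (rule set)
    ultimately show ?thesis by blast
  qed
  show ?thesis
  \<comment> \<open>If two consecutive \<open>n - 1\<close> enclose both end letters, none of these
    three letters occurs outside, and the word is a zigzag, possibly with turning point
    \<open>n\<close>. Otherwise the folded word alternates, unless both end letters occur without
    any \<open>n - 1\<close>.\<close>
  proof (cases "\<exists>a w b. u = a @ (n - 1) # w @ (n - 1) # b \<and> n - 1 \<notin> set w \<and>
      n \<in> set w \<and> Suc n \<in> set w")
    case True
    then obtain a w b where u: "u = a @ (n - 1) # w @ (n - 1) # b" "n - 1 \<notin> set w"
      "n \<in> set w" "Suc n \<in> set w" by blast
    have "n - 1 \<noteq> 0" using u(1) u0 by auto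
    then have n2: "2 \<le> n" by simp
    have b: "n - 1 \<notin> set b" "n \<notin> set b" "Suc n \<notin> set b"
      by (rule fork_after[of n u a w b]; fact two some u)+
    have rev_two: "2 \<le> count_list w (n - 1)" if "y \<in> {n, Suc n}" "rev u = a @ y # w @ y # b" for y a w b
    proof -
      have "u = rev b @ y # rev w @ y # rev a" using that(2) by (simp add: rev_swap)
      from two[OF that(1) this] show ?thesis by simp
    qed
    have rev_some: "n \<in> set w \<or> Suc n \<in> set w" if "rev u = a @ (n - 1) # w @ (n - 1) # b" for a w b
    proof -
      have "u = rev b @ (n - 1) # rev w @ (n - 1) # rev a" using that by (simp add: rev_swap)
      from some[OF this] show ?thesis by simp
    qed
    have rev_u: "rev u = rev b @ (n - 1) # rev w @ (n - 1) # rev a" "n - 1 \<notin> set (rev w)"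
      "n \<in> set (rev w)" "Suc n \<in> set (rev w)" using u by simp_all
    have "n - 1 \<notin> set (rev a)" "n \<notin> set (rev a)" "Suc n \<notin> set (rev a)"
      by (rule fork_after[of n "rev u" "rev b" "rev w" "rev a"]; fact rev_two rev_some rev_u)+
    then have a: "n - 1 \<notin> set a" "n \<notin> set a" "Suc n \<notin> set a" by auto
    have count_N: "count_list u (n - 1) = 2"
      using u(1,2) a(1) b(1) by (simp add: count_list_0_iff[THEN iffD2])
    have proj_y: "proj (n - 1) y u = [n - 1, y, n - 1]" if y: "y \<in> {n, Suc n}" for y
    proof -
      have "y \<in> set w" "y \<notin> set a" "y \<notin> set b" using y u(3,4) a b by auto
      have "count_list w y \<le> 1"
        using separated_count_le[OF sep_y[OF y], of "a @ [n - 1]" w "(n - 1) # b"] u by simp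
      then have "count_list w y = 1" using \<open>y \<in> set w\<close> by (simp add: le_Suc_eq count_list_0_iff)
      then have "proj (n - 1) y w = [y]"
        using proj_absent[of "n - 1" w y] u(2) proj_commute[of "n - 1" y w] by simp
      then show ?thesis
        using u(1) a b \<open>y \<notin> set a\<close> \<open>y \<notin> set b\<close> by (simp add: proj_eq_Nil_iff[THEN iffD2])
    qed
    show ?thesis
    proof (cases "separated (n - 2) (n - 1) u")
      case True
      then show ?thesis using fork count_N proj_y by blast
    next
      case False
      have "\<exists>p\<in>{1..n - 1}. \<exists>c\<in>zwalks p. c ! p = 1 \<and> zig_spec (n - 1) p c u"
      proof (rule zig_spec_of_word[OF u0 _ count_N])
        show "\<not> separated (n - 1 - 1) (n - 1) u" using False by (simp add: numeral_2_eq_2)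
      qed (use n2 crowded left pal_i in auto)
      then obtain p c where pc: "1 \<le> p" "p \<le> n - 1" "c \<in> zwalks p" "c ! p = 1"
        "zig_spec (n - 1) p c u" by auto
      then have "p < n" "length c - 1 = p" using n by (auto simp: zwalks_def)
      have "c \<in> (\<Union>p\<in>{1..n}. {c \<in> zwalks p. c ! p = 1})" using pc n by auto
      then have "Inr c \<in> D_data n" unfolding D_data_def by blast
      moreover have "D_spec n (Inr c) u"
        using set pc(5) proj_y \<open>p < n\<close> \<open>length c - 1 = p\<close> by (simp add: D_spec_def)
      ultimately show ?thesis by blast
    qed
  next
    case False
    then have not_both: "n \<notin> set w \<or> Suc n \<notin> set w"
      if "u = a @ (n - 1) # w @ (n - 1) # b" "n - 1 \<notin> set w" for a w b using that by blast
    \<comment> \<open>With at most one end letter in the gap, the second neighbour must be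
      \<open>n - 2\<close>.\<close>
    have sep: "separated (n - 2) (n - 1) u"
    proof (rule separatedI)
      fix a w b assume g: "u = a @ (n - 1) # w @ (n - 1) # b" "n - 1 \<notin> set w"
      have "u = (a @ [n - 1]) @ w @ ((n - 1) # b)" using g(1) by simp
      then have "count_list w n \<le> 1" "count_list w (Suc n) \<le> 1"
        using separated_count_le[OF sep_y _ g(2)] by blast+
      moreover have "count_list w n = 0 \<or> count_list w (Suc n) = 0"
        using not_both[OF g] by (simp add: count_list_0_iff)
      ultimately have "count_list w (n - 2) \<noteq> 0" using gap_N[OF g] by auto
      then show "n - 2 \<in> set w" by (simp add: count_list_0_iff)
    qed
    have one: "count_list u y \<le> 1" if "n - 1 \<notin> set u" "y \<in> {n, Suc n}" for y
      using separated_count_le[OF sep_y[OF that(2)], of "[]" u "[]"] that(1) by simp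
    show ?thesis
    proof (cases "n - 1 \<notin> set u \<and> n \<in> set u \<and> Suc n \<in> set u")
      case True
      have "proj (n - 1) y u = [y]" if "y \<in> {n, Suc n}" for y
      proof -
        have "count_list u y \<noteq> 0" using True that by (auto simp: count_list_0_iff)
        then have "count_list u y = 1" using one[of y] True that by simp
        then show ?thesis
          using proj_absent[of "n - 1" u y] True proj_commute[of "n - 1" y u] by simp
      qed
      then show ?thesis using fork[OF sep] True by (simp add: count_list_0_iff[THEN iffD2])
    next
      case False
      have sepN: "separated (n - 1) n (fold_word n u)"
      proof (cases "n - 1 \<in> set u")
        case True
        show ?thesis by (rule fork_between[of n u]) (fact two some not_both pal_y n True)+
      next
        case N: False
        have "count_list u n = 0 \<or> count_list u (Suc n) = 0"
          using False N by (simp add: count_list_0_iff)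
        then have "count_list (fold_word n u) n \<le> 1"
          using one[OF N, of n] one[OF N, of "Suc n"] by (auto simp: count_fold_word_end)
        then show ?thesis unfolding separated_def by auto
      qed
      have sepF: "separated n (n - 1) (fold_word n u)"
        unfolding separated_def
      proof (intro allI impI)
        fix a' w' b' assume "fold_word n u = a' @ (n - 1) # w' @ (n - 1) # b'"
        then obtain a r where ar: "u = a @ r" "fold_word n r = (n - 1) # w' @ (n - 1) # b'"
          by (metis map_eq_append_conv)
        then obtain y r' where yr: "r = y # r'" "fold_end n y = n - 1"
          "fold_word n r' = w' @ (n - 1) # b'" by auto
        then obtain w s where ws: "r' = w @ s" "w' = fold_word n w" "fold_word n s = (n - 1) # b'"
          by (metis map_eq_append_conv)
        then obtain y' b where yb: "s = y' # b" "fold_end n y' = n - 1" by auto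
        have "y = n - 1" "y' = n - 1"
          using yr(2) yb(2) n by (auto simp: fold_end_def split: if_splits)
        then have "u = a @ (n - 1) # w @ (n - 1) # b" using ar yr ws yb by simp
        from some[OF this] show "n \<in> set w'" unfolding ws(2)
        proof
          assume "n \<in> set w"
          then have "fold_end n n \<in> set (fold_word n w)" by simp
          then show "n \<in> set (fold_word n w)" by (simp add: fold_end_def)
        next
          assume "Suc n \<in> set w"
          then have "fold_end n (Suc n) \<in> set (fold_word n w)" by (metis imageI list.set_map)
          then show "n \<in> set (fold_word n w)" by (simp add: fold_end_def)
        qed
      qed
      \<comment> \<open>Between two consecutive \<open>y\<close> there are two \<open>n - 1\<close>,
        hence an end letter between these, which must be the other one.\<close>
      have labels: "distinct_adj (proj n (Suc n) u)"
      proof -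
        have "separated y' y u" if yy: "{y, y'} = {n, Suc n}" for y y'
        proof (rule separatedI, rule ccontr)
          fix a w b assume g: "u = a @ y # w @ y # b" "y \<notin> set w" "y' \<notin> set w"
          have "n \<notin> set (fold_word n w)"
            using g(2,3) yy by (auto simp: fold_end_def doubleton_eq_iff split: if_splits)
          then have "count_list (fold_word n w) (n - 1) \<le> 1"
            using separated_count_le[OF sepF, of "fold_word n (a @ [y])" "fold_word n w"
                "fold_word n (y # b)"] g(1) by simp
          moreover have "count_list (fold_word n w) (n - 1) = count_list w (n - 1)"
            using n by (intro count_fold_word) simp
          moreover have "2 \<le> count_list w (n - 1)" using two[OF _ g(1)] yy by blast
          ultimately show False by simp
        qed
        then show ?thesis by (subst distinct_adj_proj_iff) (auto simp: insert_commute)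
      qed
      let ?f = "fold_word n u"
      let ?c = "map (count_list ?f) [0..<Suc n]"
      have set_f: "set ?f \<subseteq> {1..n}"
      proof
        fix z assume "z \<in> set ?f"
        then obtain x where "x \<in> set u" "z = fold_end n x" by auto
        then show "z \<in> {1..n}" using set n by (auto simp: fold_end_def)
      qed
      have sep_f: "separated i (Suc i) ?f \<and> separated (Suc i) i ?f" if i: "i < n" for i
      proof (cases "Suc i = n")
        case True
        then have "i = n - 1" "Suc i = n" by auto
        then show ?thesis using sepN sepF by simp
      next
        case False
        then have si: "Suc i < n" using i by simp
        have "distinct_adj (proj i (Suc i) u)"
          using right[OF sep si] left[OF si] by (simp add: distinct_adj_proj_iff)
        then have "distinct_adj (proj i (Suc i) ?f)" using si by (simp add: proj_fold_word)
        then show ?thesis by (simp add: distinct_adj_proj_iff)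
      qed
      have pal_f: "rev (proj i (Suc i) ?f) = proj i (Suc i) ?f" if i: "0 < i" "i < n" for i
      proof (cases "Suc i = n")
        case True
        then have "i = n - 1" "Suc i = n" by auto
        then show ?thesis using comm_fold_word[OF self_dual n] by (simp add: rev_map[symmetric])
      next
        case False
        then show ?thesis using pal_i[of i] i by (simp add: proj_fold_word)
      qed
      have c: "?c \<in> zwalks n" and spec: "alt_spec n ?c ?f"
        using alt_spec_of_word[OF set_f sep_f pal_f] by blast+
      have c_n: "?c ! n = length (proj n (Suc n) u)"
        using spec by (simp add: alt_spec_def length_proj count_fold_word_end nth_append)
      define x where "x = (if ?c ! n = 0 then 0 else hd (proj n (Suc n) u))"
      have "(?c, x) \<in> {c \<in> zwalks n. c ! n = 0} \<times> {0} \<union> {c \<in> zwalks n. odd (c ! n)} \<times> {n, Suc n}"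
      proof (cases "?c ! n = 0")
        case True
        then show ?thesis using c by (simp add: x_def)
      next
        case False
        then have ne: "proj n (Suc n) u \<noteq> []" using c_n by (metis list.size(3))
        have "odd (?c ! n)"
          unfolding c_n by (rule odd_label_count[OF n sepN labels pal_y ne])
        moreover have "hd (proj n (Suc n) u) \<in> {n, Suc n}" using hd_in_set[OF ne] by auto
        ultimately show ?thesis using c False by (simp add: x_def)
      qed
      then have "Inl (?c, x) \<in> D_data n" unfolding D_data_def by blast
      moreover have "D_spec n (Inl (?c, x)) u"
        using set spec labels by (simp add: D_spec_def x_def)
      ultimately show ?thesis by blast
    qed
  qed
qed

lemma fc_inv_poly_D:
  assumes n: "1 \<le> n"
  shows "fc_inv_poly {1..Suc n} (matrix_D n) =
    (\<Sum>c | c \<in> zwalks n \<and> c ! n = 0. monom 1 (sum_list c)) +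
    2 * (\<Sum>c | c \<in> zwalks n \<and> odd (c ! n). monom 1 (sum_list c)) +
    (\<Sum>p\<in>{1..n}. \<Sum>c | c \<in> zwalks p \<and> c ! p = 1. monom 1 (sum_list c + 2 * (n - p) + 1))"
proof -
  interpret small_coxeter "{1..Suc n}" "matrix_D n" by (rule small_coxeter_D)
  have S: "u \<in> lists {1..Suc n}" if "D_spec n d u" for d u using that by (auto simp: D_spec_def)
  have unique: "comm u v" if "d \<in> D_data n" "D_spec n d u" "D_spec n d v" for d u v
  proof (rule comm_if_proj_eq[OF S[OF that(2)] S[OF that(3)]])
    have path: "proj i (Suc i) u = proj i (Suc i) v" if "1 \<le> i" "Suc i < n" for i
      using D_spec_proj_eq(1) n that \<open>d \<in> D_data n\<close> \<open>D_spec n d u\<close> \<open>D_spec n d v\<close> by blast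
    have tips: "proj (n - 1) y u = proj (n - 1) y v" if "y \<in> {n, Suc n}" for y
      using D_spec_proj_eq(2) n that \<open>d \<in> D_data n\<close> \<open>D_spec n d u\<close> \<open>D_spec n d v\<close> by blast
    have count: "count_list u s = count_list v s" if s: "s \<in> {1..Suc n}" for s
    proof -
      consider "Suc s < n" | "s = n - 1" | "s \<in> {n, Suc n}" using s by force
      then show ?thesis
      proof cases
        case 1
        then show ?thesis using path[of s] s count_proj[of s s "Suc s"] by (metis atLeastAtMost_iff)
      next
        case 2
        then show ?thesis using tips[of n] count_proj[of s s n] by (metis insertI1)
      next
        case 3
        then show ?thesis using tips[of s] count_proj[of s "n - 1" s] by metis
      qed
    qed
    fix s t assume st: "s \<in> {1..Suc n}" "t \<in> {1..Suc n}" "matrix_D n s t \<noteq> 2"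
    then have "s = t \<or> adj_D n s t" by (simp add: matrix_D_simps)
    then consider "s = t" | "t = Suc s" "t < n" | "s = n - 1" "t \<in> {n, Suc n}"
      | "s = Suc t" "s < n" | "t = n - 1" "s \<in> {n, Suc n}"
      unfolding adj_D_def by force
    then show "proj s t u = proj s t v"
    proof cases
      case 1
      then show ?thesis using count[OF st(1)] by (simp add: proj_same)
    next
      case 2
      then show ?thesis using path[of s] st by simp
    next
      case 3
      then show ?thesis using tips[of t] by simp
    next
      case 4
      then show ?thesis using path[of t] st by (simp add: proj_commute[of "Suc t" t])
    next
      case 5
      then show ?thesis using tips[of s] by (simp add: proj_commute[of s])
    qed
  qed
  have "fc_inv_poly {1..Suc n} (matrix_D n) = (\<Sum>d\<in>D_data n. monom 1 (D_weight n d))"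
  proof (rule fc_inv_poly_eq_sum[where Spec = "D_spec n"])
    show "\<exists>u. D_spec n d u" if "d \<in> D_data n" for d using D_spec_exists[OF that n] by blast
  next
    fix d u assume d: "d \<in> D_data n" and u: "D_spec n d u"
    obtain u' where "D_spec n d u'" "length u' = D_weight n d"
      using D_spec_exists[OF d n] by blast
    then show "fc_word u \<and> comm u (rev u) \<and> length u = D_weight n d"
      using comm_length[OF unique[OF d u]] D_spec_fc_word[OF d u n]
        unique[OF d u D_spec_rev[OF d u n]] by metis
  next
    fix d e u v
    assume d: "d \<in> D_data n" "e \<in> D_data n" and u: "D_spec n d u" and v: "D_spec n e v"
      and uv: "comm u v"
    show "d = e"
    proof (rule D_spec_disjoint[OF d u v n comm_count[OF uv]])
      fix i assume i: "Suc i < n"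
      show "proj i (Suc i) u = proj i (Suc i) v"
      proof (cases "i = 0")
        case True
        have "0 \<notin> set u" "0 \<notin> set v" using u v by (auto simp: D_spec_def)
        then show ?thesis using True comm_count[OF uv] by (simp add: proj_commute[of 0] proj_absent)
      qed (use i in \<open>auto intro!: comm_proj[OF uv] simp: matrix_D_simps adj_D_def\<close>)
    qed
  qed (use unique D_spec_of_fc_word[OF n] in auto)
  also have "\<dots> = (\<Sum>cx\<in>{c \<in> zwalks n. c ! n = 0} \<times> {0} \<union> {c \<in> zwalks n. odd (c ! n)} \<times> {n, Suc n}.
        monom 1 (sum_list (fst cx))) +
      (\<Sum>c\<in>(\<Union>p\<in>{1..n}. {c \<in> zwalks p. c ! p = 1}).
        monom 1 (sum_list c + 2 * (n - (length c - 1)) + 1))"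
    unfolding D_data_def
    by (subst sum.union_disjoint)
      (auto simp: finite_zwalks sum.reindex D_weight_def case_prod_unfold simp del: UN_simps)
  also have "(\<Sum>cx\<in>{c \<in> zwalks n. c ! n = 0} \<times> {0} \<union> {c \<in> zwalks n. odd (c ! n)} \<times> {n, Suc n}.
        monom 1 (sum_list (fst cx))) =
      (\<Sum>cx\<in>{c \<in> zwalks n. c ! n = 0} \<times> {0::nat}. monom (1::int) (sum_list (fst cx))) +
      (\<Sum>cx\<in>{c \<in> zwalks n. odd (c ! n)} \<times> {n, Suc n}. monom 1 (sum_list (fst cx)))"
    using finite_zwalks by (intro sum.union_disjoint) auto
  also have "(\<Sum>cx\<in>{c \<in> zwalks n. c ! n = 0} \<times> {0::nat}. monom (1::int) (sum_list (fst cx))) =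
      (\<Sum>c | c \<in> zwalks n \<and> c ! n = 0. monom 1 (sum_list c))"
    using sum.cartesian_product[of "\<lambda>c _. monom (1::int) (sum_list c)" "{0::nat}"
        "{c \<in> zwalks n. c ! n = 0}"] by (simp add: case_prod_unfold)
  also have "(\<Sum>cx\<in>{c \<in> zwalks n. odd (c ! n)} \<times> {n, Suc n}. monom (1::int) (sum_list (fst cx))) =
      2 * (\<Sum>c | c \<in> zwalks n \<and> odd (c ! n). monom 1 (sum_list c))"
    using sum.cartesian_product[of "\<lambda>c _. monom (1::int) (sum_list c)" "{n, Suc n}"
        "{c \<in> zwalks n. odd (c ! n)}"] by (simp add: case_prod_unfold sum_distrib_left)
  also have "(\<Sum>c\<in>(\<Union>p\<in>{1..n}. {c \<in> zwalks p. c ! p = 1}).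
        monom (1::int) (sum_list c + 2 * (n - (length c - 1)) + 1)) =
      (\<Sum>p\<in>{1..n}. \<Sum>c | c \<in> zwalks p \<and> c ! p = 1. monom 1 (sum_list c + 2 * (n - p) + 1))"
    by (rule sum_short_zwalks) simp
  finally show ?thesis .
qed

unbundle fps_syntax

section \<open>Generating functions of walks\<close>

text \<open>The step relation is a parameter because the walks of the theorem and those with flat
  steps are treated alike.\<close>

definition paths :: "(nat \<Rightarrow> nat \<Rightarrow> bool) \<Rightarrow> nat \<Rightarrow> nat \<Rightarrow> nat list set" where
  "paths R n k = {h. length h = Suc n \<and> h ! 0 = 0 \<and> h ! n = k \<and> (\<forall>i<n. R (h ! i) (h ! Suc i))}"

definition path_sum :: "(nat \<Rightarrow> nat \<Rightarrow> bool) \<Rightarrow> nat \<Rightarrow> nat \<Rightarrow> int poly" where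
  "path_sum R n k = (\<Sum>h\<in>paths R n k. monom 1 (sum_list h))"

lemma paths_0: "paths R 0 k = (if k = 0 then {[0]} else {})"
  by (auto simp: paths_def length_Suc_conv)

lemma paths_Suc: "paths R (Suc n) k = (\<lambda>h. h @ [k]) ` (\<Union>j\<in>{j. R j k}. paths R n j)"
proof (intro equalityI subsetI)
  fix h assume h: "h \<in> paths R (Suc n) k"
  then have len: "length h = Suc (Suc n)" by (simp add: paths_def)
  then have "h \<noteq> []" by auto
  then have split: "h = butlast h @ [k]"
    using h len append_butlast_last_id[of h] by (simp add: paths_def last_conv_nth)
  have "butlast h \<in> paths R n (h ! n)"
    using h len by (auto simp: paths_def nth_butlast)
  moreover have "R (h ! n) k" using h by (auto simp: paths_def)
  ultimately show "h \<in> (\<lambda>h. h @ [k]) ` (\<Union>j\<in>{j. R j k}. paths R n j)" using split by blast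
next
  fix h assume "h \<in> (\<lambda>h. h @ [k]) ` (\<Union>j\<in>{j. R j k}. paths R n j)"
  then obtain g j where "h = g @ [k]" "R j k" "g \<in> paths R n j" by blast
  then show "h \<in> paths R (Suc n) k"
    by (auto simp: paths_def nth_append less_Suc_eq)
qed

lemma finite_paths:
  assumes "\<And>k. finite {j. R j k}"
  shows "finite (paths R n k)"
  using assms by (induction n arbitrary: k) (auto simp: paths_0 paths_Suc)

lemma path_sum_0: "path_sum R 0 k = (if k = 0 then 1 else 0)"
  by (simp add: path_sum_def paths_0 monom_eq_1)

lemma path_sum_Suc:
  assumes "\<And>k. finite {j. R j k}"
  shows "path_sum R (Suc n) k = monom 1 k * (\<Sum>j | R j k. path_sum R n j)"
proof -
  have "path_sum R (Suc n) k = (\<Sum>h\<in>(\<Union>j\<in>{j. R j k}. paths R n j). monom 1 (sum_list (h @ [k])))"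
    unfolding path_sum_def paths_Suc by (subst sum.reindex) (auto simp: inj_on_def)
  also have "\<dots> = (\<Sum>j | R j k. \<Sum>h\<in>paths R n j. monom 1 (sum_list (h @ [k])))"
    using assms finite_paths[OF assms] by (intro sum.UNION_disjoint) (auto simp: paths_def)
  also have "\<dots> = monom 1 k * (\<Sum>j | R j k. path_sum R n j)"
    by (simp add: path_sum_def sum_distrib_left mult_monom add.commute)
  finally show ?thesis .
qed

lemma path_sum_high:
  assumes "\<And>j k. R j k \<Longrightarrow> k \<le> Suc j" "n < k"
  shows "path_sum R n k = 0"
proof -
  have "paths R n k = {}"
    using assms(2)
  proof (induction n arbitrary: k)
    case (Suc n)
    have "paths R n j = {}" if "R j k" for j
      using Suc assms(1)[OF that] by simp
    then show ?case by (simp add: paths_Suc)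
  qed (simp add: paths_0)
  then show ?thesis by (simp add: path_sum_def)
qed

definition height_series :: "(nat \<Rightarrow> nat \<Rightarrow> bool) \<Rightarrow> nat \<Rightarrow> int poly fps" where
  "height_series R k = Abs_fps (\<lambda>n. path_sum R n k)"

lemma t_power: "[:0, 1:] ^ k = (monom 1 k :: int poly)"
  by (simp add: monom_altdef)

text \<open>Removes the last step; the final point contributes the factor t^k.\<close>

lemma height_series_rec:
  assumes "\<And>k. finite {j. R j k}"
  shows "height_series R k =
    (if k = 0 then 1 else 0) + fps_X * (fps_t ^ k * (\<Sum>j | R j k. height_series R j))"
proof (rule fps_ext)
  fix n
  show "height_series R k $ n =
    ((if k = 0 then 1 else 0) + fps_X * (fps_t ^ k * (\<Sum>j | R j k. height_series R j))) $ n"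
  proof (cases n)
    case 0
    then show ?thesis by (simp add: height_series_def path_sum_0)
  next
    case (Suc i)
    then show ?thesis
      using path_sum_Suc[of R i k, OF assms]
      by (simp add: height_series_def t_power fps_sum_nth)
  qed
qed

subsection \<open>Agreement of initial segments\<close>

text \<open>Congruence modulo x^n.\<close>

definition agree :: "nat \<Rightarrow> int poly fps \<Rightarrow> int poly fps \<Rightarrow> bool" where
  "agree n f g \<longleftrightarrow> (\<forall>i<n. f $ i = g $ i)"

lemma agreeD: "agree n f g \<Longrightarrow> i < n \<Longrightarrow> f $ i = g $ i"
  by (simp add: agree_def)

lemma agree_refl: "agree n f f"
  by (simp add: agree_def)

lemma agree_add: "agree n f g \<Longrightarrow> agree n f' g' \<Longrightarrow> agree n (f + f') (g + g')"
  by (simp add: agree_def)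

lemma agree_mult: "agree n f g \<Longrightarrow> agree n f' g' \<Longrightarrow> agree n (f * f') (g * g')"
  by (auto simp: agree_def fps_mult_nth intro!: sum.cong)

lemma agree_X: "agree n f g \<Longrightarrow> agree (Suc n) (fps_X * f) (fps_X * g)"
  by (auto simp: agree_def)

lemma agree_scale: "agree n f g \<Longrightarrow> agree n (f oo (fps_const c * fps_X)) (g oo (fps_const c * fps_X))"
  by (simp add: agree_def)

lemma agree_Suc_imp: "agree (Suc n) f g \<Longrightarrow> agree n f g"
  by (simp add: agree_def)

text \<open>Made for equations in which a factor x stands before the unknown: the right-hand side
  raises the order of agreement by one.\<close>

lemma fps_eq_if_agree:
  assumes "\<And>n. agree n f g \<Longrightarrow> agree (Suc n) f g"
  shows "f = g"
proof -
  have "agree n f g" for n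
    by (induction n) (simp add: agree_def, rule assms)
  then show ?thesis by (auto simp: agree_def fps_eq_iff)
qed

text \<open>The recursions couple all heights, so agreement is raised for the whole family at
  once.\<close>

lemma family_eq_if_agree:
  assumes "\<And>n. (\<And>k. agree n (f k) (g k)) \<Longrightarrow> (\<And>k. agree (Suc n) (f k) (g k))"
  shows "f k = g k"
proof -
  have "\<forall>k. agree n (f k) (g k)" for n
  proof (induction n)
    case (Suc n)
    then show ?case using assms by blast
  qed (simp add: agree_def)
  then show ?thesis by (auto simp: agree_def fps_eq_iff)
qed

subsection \<open>Decomposition of walks at the last return\<close>

definition wstep :: "nat \<Rightarrow> nat \<Rightarrow> bool" where
  "wstep j k \<longleftrightarrow> k = j + 1 \<or> j = k + 1"

text \<open>Raising a walk of length n by one level adds 1 at each of its n + 1 points: the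
  substitution of t x for x accounts for t^n, and a separate factor \<open>fps_t\<close> for the
  remaining point.\<close>

abbreviation (input) scale :: "int poly fps \<Rightarrow> int poly fps" where
  "scale f \<equiv> f oo (fps_t * fps_X)"

lemma scale_simps:
  "scale (f + g) = scale f + scale g" "scale (f * g) = scale f * scale g"
  "scale fps_X = fps_t * fps_X" "scale (fps_t ^ k) = fps_t ^ k" "scale 1 = 1"
  by (simp_all add: fps_compose_add_distrib fps_compose_mult_distrib fps_const_power)

lemma wstep_sets: "{j. wstep j 0} = {1}" "{j. wstep j (Suc k)} = {k, Suc (Suc k)}"
  by (auto simp: wstep_def)

lemma zstep_sets: "{j. zstep j 0} = {0, 1}" "{j. zstep j (Suc k)} = {k, Suc (Suc k)}"
  by (auto simp: zstep_def)

lemma finite_steps: "finite {j. wstep j k}" "finite {j. zstep j k}"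
  by (cases k; simp add: wstep_sets zstep_sets)+

lemma wseries_rec:
  "height_series wstep 0 = 1 + fps_X * height_series wstep 1"
  "height_series wstep (Suc k) =
    fps_X * (fps_t ^ Suc k * (height_series wstep k + height_series wstep (Suc (Suc k))))"
  using height_series_rec[of wstep 0] height_series_rec[of wstep "Suc k"]
  by (simp_all only: finite_steps wstep_sets) simp_all

lemma zseries_rec:
  "height_series zstep 0 = 1 + fps_X * (height_series zstep 0 + height_series zstep 1)"
  "height_series zstep (Suc k) =
    fps_X * (fps_t ^ Suc k * (height_series zstep k + height_series zstep (Suc (Suc k))))"
  using height_series_rec[of zstep 0] height_series_rec[of zstep "Suc k"]
  by (simp_all only: finite_steps zstep_sets) simp_all

text \<open>Cutting a walk at its last visit to height 0 leaves a Dyck path, an up step and a walk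
  raised by one level. The proof checks instead that the right-hand sides satisfy the recursion of
  the left-hand sides.\<close>

lemma last_return:
  "height_series wstep (Suc k) =
    height_series wstep 0 * (fps_X * fps_t * scale (height_series wstep k))"
proof -
  let ?F = "height_series wstep"
  \<comment> \<open>At height 0 both families agree by definition, so only the recursion for
    positive heights has to be checked.\<close>
  define G where "G k = (case k of 0 \<Rightarrow> ?F 0 | Suc k \<Rightarrow> ?F 0 * (fps_X * fps_t * scale (?F k)))" for k
  have G_rec: "G (Suc k) = fps_X * (fps_t ^ Suc k * (G k + G (Suc (Suc k))))" for k
  proof (cases k)
    case 0
    have "scale (?F 0) = 1 + fps_t * fps_X * scale (?F 1)"
      by (subst wseries_rec(1)) (simp only: scale_simps)
    then show ?thesis
      unfolding 0 by (simp only: G_def nat.case power_Suc power_0 mult_1_right mult_1_left One_nat_def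
          ring_distribs ac_simps)
  next
    case (Suc j)
    have "scale (?F (Suc j)) =
        fps_t * fps_X * (fps_t ^ Suc j * (scale (?F j) + scale (?F (Suc (Suc j)))))"
      by (subst wseries_rec(2)) (simp only: scale_simps)
    then show ?thesis
      unfolding Suc by (simp only: G_def nat.case power_Suc ring_distribs ac_simps)
  qed
  have "?F k = G k" for k
  proof (rule family_eq_if_agree[of ?F G])
    fix n k assume IH: "\<And>k. agree n (?F k) (G k)"
    show "agree (Suc n) (?F k) (G k)"
    proof (cases k)
      case 0
      then show ?thesis by (simp add: G_def agree_refl)
    next
      case (Suc j)
      show ?thesis
        unfolding Suc wseries_rec(2)[of j] G_rec[of j]
        by (intro agree_X agree_mult agree_add agree_refl IH)
    qed
  qed
  from this[of "Suc k"] show ?thesis by (simp add: G_def)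
qed

definition path_series :: "(nat \<Rightarrow> nat \<Rightarrow> bool) \<Rightarrow> (nat \<Rightarrow> bool) \<Rightarrow> int poly fps" where
  "path_series R P = Abs_fps (\<lambda>n. \<Sum>k\<le>n. if P k then path_sum R n k else 0)"

text \<open>Walks of length at most n stay at height at most n, so a finite sum of height series
  suffices up to this order.\<close>

lemma path_series_agree:
  assumes "\<And>j k. R j k \<Longrightarrow> k \<le> Suc j"
  shows "agree (Suc n) (path_series R P) (\<Sum>k\<le>n. if P k then height_series R k else 0)"
  unfolding agree_def
proof (intro allI impI)
  fix i assume "i < Suc n"
  then have "(\<Sum>k\<le>i. if P k then path_sum R i k else 0) = (\<Sum>k\<le>n. if P k then path_sum R i k else 0)"
    using path_sum_high[of R i] assms by (intro sum.mono_neutral_left) auto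
  also have "\<dots> = (\<Sum>k\<le>n. if P k then height_series R k else 0) $ i"
    by (auto simp: fps_sum_nth height_series_def intro!: sum.cong)
  finally show "path_series R P $ i = (\<Sum>k\<le>n. if P k then height_series R k else 0) $ i"
    by (simp add: path_series_def)
qed

lemma sum_by_height:
  assumes "\<And>j k. R j k \<Longrightarrow> k \<le> Suc j" "\<And>k. finite {j. R j k}"
    and "\<And>k. {h \<in> H. h ! n = k} = paths R n k"
  shows "(\<Sum>h | h \<in> H \<and> P (h ! n). monom 1 (sum_list h)) = path_series R P $ n"
proof -
  have le: "h ! n \<le> n" if "h \<in> H" for h
  proof (rule ccontr)
    assume "\<not> h ! n \<le> n"
    moreover have "h \<in> paths R n (h ! n)" using that assms(3) by blast
    moreover have "path_sum R n (h ! n) = 0 \<Longrightarrow> paths R n (h ! n) = {}" for h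
    proof -
      assume "path_sum R n (h ! n) = 0"
      \<comment> \<open>At t = 1 the polynomial counts the paths, so it vanishes only if there are
        none.\<close>
      moreover have "poly (path_sum R n (h ! n)) 1 = int (card (paths R n (h ! n)))"
        by (simp add: path_sum_def poly_sum poly_monom)
      ultimately show ?thesis using finite_paths[OF assms(2)] by simp
    qed
    ultimately show False using path_sum_high[of R n "h ! n"] assms(1) by auto
  qed
  have "{h. h \<in> H \<and> P (h ! n)} = (\<Union>k\<in>{k\<in>{..n}. P k}. paths R n k)"
    using le by (auto simp: assms(3)[symmetric])
  then have "(\<Sum>h | h \<in> H \<and> P (h ! n). monom 1 (sum_list h)) =
      (\<Sum>k\<in>{k\<in>{..n}. P k}. path_sum R n k)"
    unfolding path_sum_def using finite_paths[OF assms(2)]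
    by (simp only:) (intro sum.UNION_disjoint; auto simp: paths_def)
  also have "\<dots> = path_series R P $ n"
    unfolding path_series_def fps_nth_Abs_fps by (rule sum.inter_filter) simp
  finally show ?thesis .
qed

lemma walk_series_eq: "walk_series P = path_series wstep P"
proof (rule fps_ext)
  fix n
  show "walk_series P $ n = path_series wstep P $ n"
    unfolding walk_series_def fps_nth_Abs_fps
    by (rule sum_by_height[OF _ finite_steps(1)]) (auto simp: walks_def paths_def wstep_def)
qed

lemma zwalk_sum_eq:
  "(\<Sum>c | c \<in> zwalks n \<and> P (c ! n). monom 1 (sum_list c)) = path_series zstep P $ n"
  by (rule sum_by_height[OF _ finite_steps(2)]) (auto simp: zwalks_def paths_def zstep_def)

lemma M_series_eq: "M_series = height_series wstep 0"
  by (rule fps_ext) (simp add: M_series_def walk_series_eq path_series_def height_series_def)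

text \<open>This is \<open>last_return\<close> summed over the admissible final heights; lowering
  the part after the last visit to 0 by one level shifts the predicate.\<close>

lemma walk_series_decompose:
  "walk_series P =
    M_series * ((if P 0 then 1 else 0) + fps_X * (fps_t * scale (walk_series (\<lambda>k. P (Suc k)))))"
proof (rule fps_ext)
  fix n
  let ?F = "height_series wstep"
  let ?T = "\<Sum>k\<le>n. if P (Suc k) then ?F k else 0"
  have bound: "wstep j k \<Longrightarrow> k \<le> Suc j" for j k by (auto simp: wstep_def)
  have a1: "agree (Suc (Suc n)) (walk_series P) (\<Sum>k\<le>Suc n. if P k then ?F k else 0)"
    unfolding walk_series_eq by (rule path_series_agree[OF bound])
  have a2: "(\<Sum>k\<le>Suc n. if P k then ?F k else 0) =
      M_series * ((if P 0 then 1 else 0) + fps_X * (fps_t * scale ?T))"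
  proof -
    have "(\<Sum>k\<le>Suc n. if P k then ?F k else 0) =
        (if P 0 then ?F 0 else 0) + (\<Sum>k\<le>n. if P (Suc k) then ?F (Suc k) else 0)"
      by (rule sum.atMost_Suc_shift)
    also have "(\<Sum>k\<le>n. if P (Suc k) then ?F (Suc k) else 0) =
        (\<Sum>k\<le>n. M_series * (fps_X * fps_t * scale (if P (Suc k) then ?F k else 0)))"
      by (intro sum.cong) (auto simp: last_return M_series_eq)
    also have "\<dots> = M_series * (fps_X * fps_t * scale ?T)"
      by (simp add: sum_distrib_left fps_compose_sum_distrib)
    finally show ?thesis by (simp add: M_series_eq algebra_simps)
  qed
  have "agree (Suc n) ?T (walk_series (\<lambda>k. P (Suc k)))"
    using path_series_agree[of wstep n "\<lambda>k. P (Suc k)", OF bound] by (simp add: walk_series_eq agree_def)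
  then have a3: "agree (Suc n) (M_series * ((if P 0 then 1 else 0) + fps_X * (fps_t * scale ?T)))
      (M_series * ((if P 0 then 1 else 0) + fps_X * (fps_t * scale (walk_series (\<lambda>k. P (Suc k))))))"
    by (intro agree_mult agree_add agree_refl agree_Suc_imp[OF agree_X] agree_scale)
  have "walk_series P $ n = (\<Sum>k\<le>Suc n. if P k then ?F k else 0) $ n"
    by (rule agreeD[OF a1]) simp
  then show "walk_series P $ n =
      (M_series * ((if P 0 then 1 else 0) + fps_X * (fps_t * scale (walk_series (\<lambda>k. P (Suc k)))))) $ n"
    unfolding a2 using agreeD[OF a3, of n] by (simp only: lessI)
qed

subsection \<open>The functional equations\<close>

lemma M_equation: "M_series = 1 + fps_t * fps_X ^ 2 * M_series * scale M_series"
proof -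
  have "M_series = 1 + fps_X * height_series wstep 1"
    using wseries_rec(1) by (simp add: M_series_eq)
  also have "height_series wstep 1 = M_series * (fps_X * fps_t * scale M_series)"
    using last_return[of 0] by (simp add: M_series_eq)
  finally show ?thesis by (simp add: power2_eq_square algebra_simps)
qed

lemma Q_equation: "Q_series = M_series * (1 + fps_X * fps_t * scale Q_series)"
  using walk_series_decompose[of "\<lambda>k. True"] by (simp add: Q_series_def mult.assoc)

lemma scale_scale: "scale (scale f) = f oo (fps_X * fps_t ^ 2)"
proof -
  have "fps_X * fps_t ^ 2 = fps_const ([:0, 1:] ^ 2) * fps_X"
    by (simp add: fps_const_power mult.commute)
  then show ?thesis
    by (intro fps_ext) (simp only: fps_compose_linear fps_nth_Abs_fps power2_eq_square
        power_mult_distrib mult.assoc)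
qed

text \<open>Two applications of the decomposition: lowering by one level makes odd final heights
  even, and these are 0 or become odd again after a second lowering.\<close>

lemma Qo_equation:
  "Qo_series = fps_X * fps_t * M_series * scale M_series *
    (1 + fps_X * fps_t ^ 2 * (Qo_series oo (fps_X * fps_t ^ 2)))"
proof -
  have "Qo_series = M_series * (fps_X * (fps_t * scale (walk_series even)))"
    using walk_series_decompose[of odd] by (simp add: Qo_series_def)
  moreover have "walk_series even = M_series * (1 + fps_X * (fps_t * scale Qo_series))"
    using walk_series_decompose[of even] by (simp add: Qo_series_def)
  then have "scale (walk_series even) =
      scale M_series * (1 + fps_t * fps_X * (fps_t * scale (scale Qo_series)))"
    by (simp only: scale_simps fps_const_compose)
  ultimately have "Qo_series = M_series * (fps_X * (fps_t * (scale M_series *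
      (1 + fps_t * fps_X * (fps_t * (Qo_series oo (fps_X * fps_t ^ 2)))))))"
    by (simp only: scale_scale)
  then show ?thesis by (simp only: power2_eq_square ac_simps)
qed

lemma M_unique: "F = 1 + fps_t * fps_X ^ 2 * F * scale F \<Longrightarrow> F = M_series"
proof (rule fps_eq_if_agree)
  fix n assume F: "F = 1 + fps_t * fps_X ^ 2 * F * scale F" and "agree n F M_series"
  then have "agree (Suc n) (1 + fps_X * (fps_X * fps_t * F * scale F))
      (1 + fps_X * (fps_X * fps_t * M_series * scale M_series))"
    by (intro agree_add agree_X agree_mult agree_refl agree_scale)
  moreover have "1 + fps_X * (fps_X * fps_t * G * scale G) = 1 + fps_t * fps_X ^ 2 * G * scale G" for G
    by (simp add: power2_eq_square algebra_simps)
  ultimately show "agree (Suc n) F M_series" using F M_equation by simp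
qed

lemma Q_unique: "F = M_series * (1 + fps_X * fps_t * scale F) \<Longrightarrow> F = Q_series"
proof (rule fps_eq_if_agree)
  fix n assume F: "F = M_series * (1 + fps_X * fps_t * scale F)" and "agree n F Q_series"
  then have "agree (Suc n) (M_series * (1 + fps_X * (fps_t * scale F)))
      (M_series * (1 + fps_X * (fps_t * scale Q_series)))"
    by (intro agree_add agree_X agree_mult agree_refl agree_scale)
  then show "agree (Suc n) F Q_series" using F Q_equation by (simp add: mult.assoc)
qed

lemma Qo_unique:
  "F = fps_X * fps_t * M_series * scale M_series *
    (1 + fps_X * fps_t ^ 2 * (F oo (fps_X * fps_t ^ 2))) \<Longrightarrow> F = Qo_series"
proof (rule fps_eq_if_agree)
  let ?rhs = "\<lambda>G. fps_X * fps_t * M_series * scale M_series *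
    (1 + fps_X * fps_t ^ 2 * (G oo (fps_X * fps_t ^ 2)))"
  fix n assume F: "F = ?rhs F" and "agree n F Qo_series"
  then have "agree (Suc n)
      (fps_X * (fps_t * M_series * scale M_series * (1 + fps_X * fps_t ^ 2 * scale (scale F))))
      (fps_X * (fps_t * M_series * scale M_series * (1 + fps_X * fps_t ^ 2 * scale (scale Qo_series))))"
    by (intro agree_add agree_X agree_mult agree_refl agree_scale)
  moreover have "fps_X * (fps_t * M_series * scale M_series * (1 + fps_X * fps_t ^ 2 * scale (scale G))) =
      ?rhs G" for G by (simp only: scale_scale mult.assoc)
  ultimately have "agree (Suc n) (?rhs F) (?rhs Qo_series)" by (simp only:)
  then show "agree (Suc n) F Qo_series" by (simp only: F[symmetric] Qo_equation[symmetric])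
qed

section \<open>The generating functions of fully commutative involutions\<close>

text \<open>This is 1 / (1 - x M(x)). It accounts for the part of a walk up to and including its
  last flat step.\<close>

definition flat_series :: "int poly fps" where
  "flat_series = 1 + fps_X * height_series zstep 0"

text \<open>After the last flat step there remains a walk without flat steps. As in
  \<open>last_return\<close>, the two sides are compared through their recursions.\<close>

lemma zseries_eq: "height_series zstep k = height_series wstep k * flat_series"
proof (rule family_eq_if_agree[of "height_series zstep" "\<lambda>k. height_series wstep k * flat_series"])
  fix n k
  assume IH: "\<And>k. agree n (height_series zstep k) (height_series wstep k * flat_series)"
  show "agree (Suc n) (height_series zstep k) (height_series wstep k * flat_series)"
  proof (cases k)
    case 0
    have "height_series zstep 0 = flat_series + fps_X * height_series zstep 1"
      by (subst zseries_rec(1)) (simp add: flat_series_def algebra_simps)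
    moreover have "height_series wstep 0 * flat_series =
        flat_series + fps_X * (height_series wstep 1 * flat_series)"
      by (subst wseries_rec(1)) (simp add: algebra_simps)
    moreover have "agree (Suc n) (flat_series + fps_X * height_series zstep 1)
        (flat_series + fps_X * (height_series wstep 1 * flat_series))"
      by (intro agree_add agree_X agree_refl IH)
    ultimately show ?thesis using 0 by simp
  next
    case (Suc j)
    have "height_series wstep (Suc j) * flat_series = fps_X * (fps_t ^ Suc j *
        (height_series wstep j * flat_series + height_series wstep (Suc (Suc j)) * flat_series))"
      by (subst wseries_rec(2)) (simp add: algebra_simps)
    moreover have "agree (Suc n)
        (fps_X * (fps_t ^ Suc j * (height_series zstep j + height_series zstep (Suc (Suc j)))))
        (fps_X * (fps_t ^ Suc j *
        (height_series wstep j * flat_series + height_series wstep (Suc (Suc j)) * flat_series)))"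
      by (intro agree_X agree_mult agree_add agree_refl IH)
    ultimately show ?thesis using Suc zseries_rec(2)[of j] by simp
  qed
qed

lemma path_series_zstep: "path_series zstep P = walk_series P * flat_series"
proof (rule fps_ext)
  fix n
  have "agree (Suc n) (path_series zstep P) (\<Sum>k\<le>n. if P k then height_series zstep k else 0)"
    by (rule path_series_agree) (auto simp: zstep_def)
  moreover have "(\<Sum>k\<le>n. if P k then height_series zstep k else 0) =
      (\<Sum>k\<le>n. if P k then height_series wstep k else 0) * flat_series"
    by (auto simp: sum_distrib_right zseries_eq intro!: sum.cong)
  moreover have "agree (Suc n) (walk_series P * flat_series)
      ((\<Sum>k\<le>n. if P k then height_series wstep k else 0) * flat_series)"
    unfolding walk_series_eq
    by (intro agree_mult agree_refl path_series_agree) (auto simp: wstep_def)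
  ultimately show "path_series zstep P $ n = (walk_series P * flat_series) $ n"
    by (simp add: agree_def)
qed

section \<open>Quotients as products with explicit inverses\<close>

lemma fps_quot_eq:
  assumes "g * h = 1" "g $ 0 = 1"
  shows "f \<oslash> g = f * h"
proof -
  have "f \<oslash> g = f \<oslash> g * (g * h)" using assms(1) by simp
  also have "\<dots> = f * h" using fps_quot_mult[OF assms(2), of f] by (simp only: mult.assoc[symmetric])
  finally show ?thesis .
qed

lemma quot_flat: "f \<oslash> (1 - fps_X * M_series) = f * flat_series"
proof (rule fps_quot_eq)
  have "height_series zstep 0 = M_series * flat_series" by (simp add: zseries_eq M_series_eq)
  then show "(1 - fps_X * M_series) * flat_series = 1"
    by (simp add: left_diff_distrib mult.assoc) (simp add: flat_series_def)
qed simp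

definition geometric :: "int poly fps" where
  "geometric = Abs_fps (\<lambda>n. monom 1 (2 * n))"

lemma quot_geometric: "f \<oslash> (1 - fps_X * fps_t ^ 2) = f * geometric"
proof (rule fps_quot_eq)
  show "(1 - fps_X * fps_t ^ 2) * geometric = 1"
  proof (rule fps_ext)
    fix n
    show "((1 - fps_X * fps_t ^ 2) * geometric) $ n = 1 $ n"
      by (cases n) (simp_all add: left_diff_distrib mult.assoc geometric_def monom_eq_1
          t_power mult_monom)
  qed
qed simp

text \<open>The source of M(x) M(tx) in the formulas for types B and D: the walk of a zigzag ends at
  height 1.\<close>

lemma height_one: "height_series zstep 1 = fps_X * fps_t * (M_series * scale M_series * flat_series)"
  using last_return[of 0] by (simp add: zseries_eq M_series_eq algebra_simps)

lemma zwalk_height_one: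
  "(\<Sum>c | c \<in> zwalks p \<and> c ! p = 1. monom 1 (sum_list c)) = height_series zstep 1 $ p"
proof -
  have "{c. c \<in> zwalks p \<and> c ! p = 1} = paths zstep p 1" by (auto simp: zwalks_def paths_def)
  then show ?thesis by (simp add: height_series_def path_sum_def)
qed

lemma height_one_0: "height_series zstep 1 $ 0 = 0"
  by (simp add: height_series_def path_sum_0)

lemma zigzag_sum:
  "(\<Sum>c | c \<in> zwalks p \<and> c ! p = 1. monom 1 (sum_list c + k)) =
    height_series zstep 1 $ p * monom 1 k"
  unfolding zwalk_height_one[symmetric] sum_distrib_right by (simp add: mult_monom)

lemma A_series_eq: "A_series = M_series * flat_series - 1"
proof (rule fps_ext)
  fix n
  show "A_series $ n = (M_series * flat_series - 1) $ n"
  proof (cases n)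
    \<comment> \<open>The walk of length 0 has no counterpart in \<open>A_series\<close>, hence the
      summand -1.\<close>
    case 0
    then show ?thesis
      by (simp add: A_series_def M_series_eq flat_series_def height_series_def path_sum_0)
  next
    case (Suc k)
    have "A_series $ n = fc_inv_poly {1..k} matrix_A" using Suc by (simp add: A_series_def)
    also have "\<dots> = path_series zstep (\<lambda>k. k = 0) $ n"
      unfolding fc_inv_poly_A Suc by (rule zwalk_sum_eq)
    finally show ?thesis using Suc by (simp add: path_series_zstep M_series_def)
  qed
qed

text \<open>The zigzag sum is a convolution of walks of length p ending at height 1 with n - p > 0
  levels of weight t^2 each, which gives the factor x t^2 / (1 - x t^2).\<close>

lemma B_series_eq:
  "B_series = Q_series * flat_series + fps_X * fps_t ^ 2 * geometric * height_series zstep 1"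
proof (rule fps_ext)
  fix n
  define g where "g = fps_X * fps_t ^ 2 * geometric"
  let ?H = "height_series zstep 1"
  have g_nth: "g $ i = (if i = 0 then 0 else monom 1 (2 * i))" for i
    by (cases i) (simp_all add: g_def mult.assoc geometric_def t_power mult_monom)
  have "(\<Sum>p\<in>{1..<n}. \<Sum>c | c \<in> zwalks p \<and> c ! p = 1. monom 1 (sum_list c + 2 * (n - p))) =
      (\<Sum>p\<in>{1..<n}. ?H $ p * g $ (n - p))"
    by (intro sum.cong HOL.refl, subst zigzag_sum) (simp add: g_nth)
  \<comment> \<open>The added terms vanish: no walk of length 0 ends at height 1, and
    \<open>g\<close> has no constant term.\<close>
  also have "\<dots> = (\<Sum>p=0..n. ?H $ p * g $ (n - p))"
  proof (rule sum.mono_neutral_left)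
    show "\<forall>p\<in>{0..n} - {1..<n}. ?H $ p * g $ (n - p) = 0"
    proof
      fix p assume "p \<in> {0..n} - {1..<n}"
      then consider "p = 0" | "n - p = 0" by fastforce
      then show "?H $ p * g $ (n - p) = 0" by cases (simp_all only: height_one_0 g_nth, simp_all)
    qed
  qed auto
  also have "\<dots> = (g * ?H) $ n"
    unfolding mult.commute[of g] by (rule fps_mult_nth[symmetric])
  finally have zigzag: "(\<Sum>p\<in>{1..<n}. \<Sum>c | c \<in> zwalks p \<and> c ! p = 1.
      monom 1 (sum_list c + 2 * (n - p))) = (g * ?H) $ n" .
  have "(\<Sum>c\<in>zwalks n. monom 1 (sum_list c)) = (Q_series * flat_series) $ n"
    using zwalk_sum_eq[of n "\<lambda>k. True"] by (simp add: path_series_zstep Q_series_def)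
  then show "B_series $ n = (Q_series * flat_series + fps_X * fps_t ^ 2 * geometric * ?H) $ n"
    unfolding B_series_def fps_nth_Abs_fps fc_inv_poly_B zigzag g_def[symmetric] by simp
qed

text \<open>The number n - p of levels may now be 0, and there is one more letter, so the factor is
  t / (1 - x t^2). The value 1 at n = 0 is the constant term of M(x) / (1 - x M(x)).\<close>

lemma D_series_eq:
  "D_series = 2 * (Qo_series * flat_series) + M_series * flat_series +
    fps_t * geometric * height_series zstep 1"
proof (rule fps_ext)
  fix n
  define g where "g = fps_t * geometric"
  let ?H = "height_series zstep 1"
  have g_nth: "g $ i = monom 1 (2 * i + 1)" for i
    by (simp add: g_def geometric_def monom_Suc)
  show "D_series $ n = (2 * (Qo_series * flat_series) + M_series * flat_series +
    fps_t * geometric * ?H) $ n"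
    unfolding g_def[symmetric]
  proof (cases n)
    case 0
    have "(g * ?H) $ 0 = 0" unfolding fps_mult_nth_0 height_one_0 by simp
    moreover have "Qo_series $ 0 = 0"
      by (simp add: Qo_series_def walk_series_eq path_series_def)
    ultimately show "D_series $ n = (2 * (Qo_series * flat_series) + M_series * flat_series + g * ?H) $ n"
      using 0 by (simp add: D_series_def M_series_eq flat_series_def height_series_def path_sum_0)
  next
    case (Suc k)
    have "(\<Sum>p\<in>{1..n}. \<Sum>c | c \<in> zwalks p \<and> c ! p = 1. monom 1 (sum_list c + 2 * (n - p) + 1)) =
        (\<Sum>p\<in>{1..n}. ?H $ p * g $ (n - p))"
      unfolding g_nth zigzag_sum[symmetric] by (simp only: add.assoc)
    also have "\<dots> = (\<Sum>p=0..n. ?H $ p * g $ (n - p))"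
    proof (rule sum.mono_neutral_left)
      show "\<forall>p\<in>{0..n} - {1..n}. ?H $ p * g $ (n - p) = 0"
      proof
        fix p assume "p \<in> {0..n} - {1..n}"
        then have "p = 0" by auto
        then show "?H $ p * g $ (n - p) = 0" using height_one_0 by simp
      qed
    qed auto
    also have "\<dots> = (g * ?H) $ n"
      unfolding mult.commute[of g] by (rule fps_mult_nth[symmetric])
    finally have zigzag: "(\<Sum>p\<in>{1..n}. \<Sum>c | c \<in> zwalks p \<and> c ! p = 1.
        monom 1 (sum_list c + 2 * (n - p) + 1)) = (g * ?H) $ n" .
    have n: "1 \<le> n" using Suc by simp
    have "D_series $ n = fc_inv_poly {1..Suc n} (matrix_D n)" using n by (simp add: D_series_def)
    also have "\<dots> = (M_series * flat_series) $ n + 2 * (Qo_series * flat_series) $ n + (g * ?H) $ n"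
      unfolding fc_inv_poly_D[OF n] zigzag
      using zwalk_sum_eq[of n "\<lambda>k. k = 0"] zwalk_sum_eq[of n odd]
      by (simp add: path_series_zstep M_series_def Qo_series_def)
    finally show "D_series $ n = (2 * (Qo_series * flat_series) + M_series * flat_series + g * ?H) $ n"
      by (simp only: mult_2 fps_add_nth add.assoc add.commute add.left_commute)
  qed
qed

text \<open>The last three conjuncts render the claim that the series can be computed from the
  functional equations: each equation has no other solution.\<close>

theorem proposition3p1:
  shows
    "A_series = M_series \<oslash> (1 - fps_X * M_series) - 1 \<and>
     B_series =
       Q_series \<oslash> (1 - fps_X * M_series) +
       ((fps_X ^ 2 * fps_t ^ 3) \<oslash> (1 - fps_X * fps_t ^ 2)) *
       ((M_series * (M_series oo (fps_t * fps_X))) \<oslash> (1 - fps_X * M_series)) \<and>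
     D_series =
       2 * (Qo_series \<oslash> (1 - fps_X * M_series)) +
       M_series \<oslash> (1 - fps_X * M_series) +
       ((fps_X * fps_t ^ 2) \<oslash> (1 - fps_X * fps_t ^ 2)) *
       ((M_series * (M_series oo (fps_t * fps_X))) \<oslash> (1 - fps_X * M_series)) \<and>
     M_series = 1 + fps_t * fps_X ^ 2 * M_series * (M_series oo (fps_t * fps_X)) \<and>
     Q_series = M_series * (1 + fps_X * fps_t * (Q_series oo (fps_t * fps_X))) \<and>
     Qo_series =
       fps_X * fps_t * M_series * (M_series oo (fps_t * fps_X)) *
       (1 + fps_X * fps_t ^ 2 * (Qo_series oo (fps_X * fps_t ^ 2))) \<and>
     (\<forall>F. F = 1 + fps_t * fps_X ^ 2 * F * (F oo (fps_t * fps_X)) \<longrightarrow> F = M_series) \<and>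
     (\<forall>F. F = M_series * (1 + fps_X * fps_t * (F oo (fps_t * fps_X))) \<longrightarrow> F = Q_series) \<and>
     (\<forall>F. F = fps_X * fps_t * M_series * (M_series oo (fps_t * fps_X)) *
             (1 + fps_X * fps_t ^ 2 * (F oo (fps_X * fps_t ^ 2))) \<longrightarrow> F = Qo_series)"
proof (intro conjI allI impI)
  show "A_series = M_series \<oslash> (1 - fps_X * M_series) - 1"
    by (simp add: quot_flat A_series_eq)
  show "B_series = Q_series \<oslash> (1 - fps_X * M_series) +
      ((fps_X ^ 2 * fps_t ^ 3) \<oslash> (1 - fps_X * fps_t ^ 2)) *
      ((M_series * scale M_series) \<oslash> (1 - fps_X * M_series))"
    \<comment> \<open>The factor x t from \<open>height_one\<close> turns x t^2 into x^2 t^3 here,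
      and t into x t^2 in type D.\<close>
    unfolding B_series_eq quot_flat quot_geometric height_one
    by (simp only: power2_eq_square power3_eq_cube ac_simps)
  show "D_series = 2 * (Qo_series \<oslash> (1 - fps_X * M_series)) + M_series \<oslash> (1 - fps_X * M_series) +
      ((fps_X * fps_t ^ 2) \<oslash> (1 - fps_X * fps_t ^ 2)) *
      ((M_series * scale M_series) \<oslash> (1 - fps_X * M_series))"
    unfolding D_series_eq quot_flat quot_geometric height_one
    by (simp only: power2_eq_square ac_simps)
qed (rule M_equation Q_equation Qo_equation M_unique Q_unique Qo_unique; assumption?)+

end
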